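(* Let $n$ and $k$ be positive integers with $k\le n/2$. Let $I=(i_1>i_2>\cdots>i_{\ell(I)}>0)$ be a strict partition with $I\subseteq \rho(n-1)=(n-1,n-2,\ldots,1)$, and let $\alpha=[\alpha_1\le\alpha_2\le\cdots\le\alpha_{2k}]\in\mathbb N^{2k}$ with $\alpha_{2k}\le n-2k$. Then the image $\widetilde P_I\, Y_\alpha\,\nabla_k^D(n)$ of the polynomial $\widetilde P_I\, Y_\alpha$ under $\nabla_k^D(n)$ is $0$ unless all the integers $n-1-\alpha_1,\ \ldots,\ n-2k-\alpha_{2k}$ (that is, $n-p-\alpha_p$ for $p=1,\ldots,2k$) belong to $\{i_1,\ldots,i_{\ell(I)},0\}$. In this case $$\widetilde P_I\, Y_\alpha\,\nabla_k^D(n)=(-1)^s\,\widetilde P_J,$$ where $J$ is the strict partition with parts $\{i_1,\ldots,i_{\ell(I)}\}\smallsetminus\{n-1-\alpha_1,\ldots,n-2k-\alpha_{2k}\}$. Moreover, let $s'$ be the sum of the positions in $I$ of the (positive) parts erased in passing from $I$ to $J$ (the part $i_p$ has position $p$), and let $s''=\ell(I)+1$. Then $s=s'$ if $\alpha_{2k}<n-2k$, and $s=s'+s''$ if $\alpha_{2k}=n-2k$.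
   Context: All operators act on what is written to their left, so products of operators are performed from left to right; polynomials used as operators act by multiplication. The operators act on $\mathbb Z[\tfrac12][x_1,\ldots,x_n]$. Simple divided differences: for $1\le i\le n-1$, $f\,\partial_i=\dfrac{f-f(\ldots,x_{i+1},x_i,\ldots)}{x_i-x_{i+1}}$ ($x_i$ and $x_{i+1}$ exchanged), and $f\,\partial_\heartsuit=\dfrac{f-f(-x_2,-x_1,x_3,\ldots,x_n)}{-x_1-x_2}$. For $k\le n/2$: $$\nabla_k^D(n)=(\partial_\heartsuit\partial_2\cdots\partial_{n-1}\,\partial_1\partial_2\cdots\partial_{n-2})(\partial_\heartsuit\partial_2\cdots\partial_{n-3}\,\partial_1\cdots\partial_{n-4})\cdots(\partial_\heartsuit\partial_2\cdots\partial_{n-2k+1}\,\partial_1\partial_2\cdots\partial_{n-2k}),$$ a product of $k$ factors (runs such as $\partial_2\cdots\partial_1$ or $\partial_1\cdots\partial_0$ are empty). For $\alpha=[\alpha_1\le\cdots\le\alpha_m]\in\mathbb N^m$, $m\le n$, $Y_\alpha$ is the Schur polynomial $s_{(\alpha_m,\ldots,\alpha_1)}(x_1,\ldots,x_m)$. $\widetilde Q$- and $\widetilde P$-polynomials: let $e_i$ be the $i$-th elementary symmetric polynomial in $x_1,\ldots,x_n$ ($e_0=1$, $e_i=0$ for $i>n$). Put $\widetilde Q_i=e_i$ and, for $i\ge j\ge0$, $\widetilde Q_{i,j}=e_ie_j+2\sum_{p=1}^j(-1)^pe_{i+p}e_{j-p}$. For a partition $I=(i_1,\ldots,i_m)$ with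 $m$ even (append a $0$ if necessary), $\widetilde Q_I$ is the Pfaffian of the $m\times m$ skew-symmetric matrix whose $(p,q)$ entry for $p<q$ is $\widetilde Q_{i_p,i_q}$; $\widetilde Q_\emptyset=1$. For a strict partition $I$ (all parts distinct), $\widetilde P_I=2^{-\ell(I)}\widetilde Q_I$, where $\ell(I)$ is the number of nonzero parts. $I\subseteq J$ for partitions means componentwise $\le$. *)

theory Defs
  imports
    "HOL-Library.Poly_Mapping"
    "HOL-Combinatorics.Permutations"
    "Jordan_Normal_Form.Determinant"
begin

section \<open>The coefficient ring \<open>\<int>[1/2]\<close>\<close>

typedef dyadic = "{q :: rat. \<exists>(a :: int) (k :: nat). q = of_int a / 2 ^ k}"
  by (rule exI[of _ 0]) (auto intro: exI[of _ 0])

setup_lifting type_definition_dyadic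

instantiation dyadic :: comm_ring_1
begin

lift_definition zero_dyadic :: dyadic is "0 :: rat"
  by (auto intro: exI[of _ 0])

lift_definition one_dyadic :: dyadic is "1 :: rat"
  by (rule exI[of _ 1], rule exI[of _ 0]) simp

lift_definition plus_dyadic :: "dyadic \<Rightarrow> dyadic \<Rightarrow> dyadic" is "(+) :: rat \<Rightarrow> _"
proof -
  fix p q :: rat
  assume "\<exists>(a :: int) k. p = of_int a / 2 ^ k" "\<exists>(a :: int) k. q = of_int a / 2 ^ k"
  then obtain a b :: int and k l where pq: "p = of_int a / 2 ^ k" "q = of_int b / 2 ^ l"
    by blast
  have "p + q = of_int (a * 2 ^ l + b * 2 ^ k) / 2 ^ (k + l)"
    unfolding pq by (simp add: field_simps power_add)
  then show "\<exists>(a :: int) k. p + q = of_int a / 2 ^ k" by blast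
qed

lift_definition uminus_dyadic :: "dyadic \<Rightarrow> dyadic" is "uminus :: rat \<Rightarrow> _"
  by (metis minus_divide_left of_int_minus)

lift_definition times_dyadic :: "dyadic \<Rightarrow> dyadic \<Rightarrow> dyadic" is "(*) :: rat \<Rightarrow> _"
  by (metis of_int_mult power_add times_divide_times_eq)

definition minus_dyadic :: "dyadic \<Rightarrow> dyadic \<Rightarrow> dyadic" where
  "minus_dyadic a b = a + (- b)"

instance
  by standard ((simp only: minus_dyadic_def | transfer, simp add: algebra_simps)+)

end

instance dyadic :: idom
  by standard (transfer; simp)

lift_definition half :: dyadic is "1 / 2 :: rat"
  by (rule exI[of _ 1], rule exI[of _ 1]) simp

lemma two_times_half: "2 * half = 1"
proof -
  have "half + half = 1" by transfer simp
  then show ?thesis by (simp only: mult_2)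
qed


section \<open>Polynomials and divided differences\<close>

text \<open>
  Polynomials in variables \<open>x\<^sub>0, x\<^sub>1, x\<^sub>2, \<dots>\<close> over \<open>\<int>[1/2]\<close>; a monomial is its finitely supported
  exponent function. \<open>\<int>[1/2][x\<^sub>1, \<dots>, x\<^sub>n]\<close> is the subring of the polynomials that involve
  only \<open>x\<^sub>1, \<dots>, x\<^sub>n\<close>.
\<close>

type_synonym dpoly = "(nat \<Rightarrow>\<^sub>0 nat) \<Rightarrow>\<^sub>0 dyadic"

definition const :: "dyadic \<Rightarrow> dpoly" where
  "const c = Poly_Mapping.single 0 c"

definition X :: "nat \<Rightarrow> dpoly" where
  "X i = Poly_Mapping.single (Poly_Mapping.single i 1) 1"

definition poly_subst :: "(nat \<Rightarrow> dpoly) \<Rightarrow> dpoly \<Rightarrow> dpoly" where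
  "poly_subst \<sigma> f = (\<Sum>m \<in> Poly_Mapping.keys f. const (Poly_Mapping.lookup f m) *
     (\<Prod>v \<in> Poly_Mapping.keys m. \<sigma> v ^ Poly_Mapping.lookup m v))"

text \<open>
  Exact division; used only when \<open>g\<close> is a nonzero divisor of \<open>f\<close>. As \<^typ>\<open>dpoly\<close> is an
  integral domain, the quotient is then unique.
\<close>

definition exact_quot :: "dpoly \<Rightarrow> dpoly \<Rightarrow> dpoly" where
  "exact_quot f g = (THE q. q * g = f)"

lemma exact_quot_eqI:
  assumes "q * g = f" "g \<noteq> 0"
  shows "exact_quot f g = q"
  unfolding exact_quot_def using assms by (intro the_equality) auto

datatype dd_index = Heart | Simple nat

fun divdiff :: "dd_index \<Rightarrow> dpoly \<Rightarrow> dpoly" where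
  "divdiff (Simple i) f =
     exact_quot (f - poly_subst (X(i := X (i + 1), i + 1 := X i)) f) (X i - X (i + 1))"
| "divdiff Heart f =
     exact_quot (f - poly_subst (X(1 := - X 2, 2 := - X 1)) f) (- X 1 - X 2)"

text \<open>
  Operators act from the left: the word \<open>[d\<^sub>1, \<dots>, d\<^sub>r]\<close> sends \<open>f\<close> to
  \<open>(\<dots>((f d\<^sub>1) d\<^sub>2)\<dots>) d\<^sub>r\<close>.
\<close>

definition act :: "dpoly \<Rightarrow> dd_index list \<Rightarrow> dpoly" where
  "act f w = fold divdiff w f"

definition nablaD_factor :: "nat \<Rightarrow> nat \<Rightarrow> dd_index list" where
  "nablaD_factor n j =
     Heart # map Simple [2..<n - 2 * j + 2] @ map Simple [1..<n - 2 * j + 1]"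

definition nablaD :: "nat \<Rightarrow> nat \<Rightarrow> dd_index list" where
  "nablaD n k = concat (map (nablaD_factor n) [1..<k + 1])"


section \<open>Schur polynomials\<close>

text \<open>
  The bialternant definition
  \<open>s\<^sub>\<lambda>(x\<^sub>1, \<dots>, x\<^sub>m) = det (x\<^sub>i^(\<lambda>\<^sub>j + m - j)) / det (x\<^sub>i^(m - j))\<close>,
  for a weakly decreasing list \<open>\<lambda>\<close> of length \<open>m\<close> (zero parts allowed). Matrix and list indices
  start at \<open>0\<close>, so entry \<open>(i, j)\<close> below is the entry \<open>(i + 1, j + 1)\<close> of the formula.
\<close>

definition alternant :: "nat list \<Rightarrow> dpoly" where
  "alternant \<mu> = det (mat (length \<mu>) (length \<mu>) (\<lambda>(i, j). X (i + 1) ^ (\<mu> ! j)))"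

definition schur :: "nat list \<Rightarrow> dpoly" where
  "schur lam = (let m = length lam in
     exact_quot (alternant (map (\<lambda>j. lam ! j + (m - 1 - j)) [0..<m]))
                (alternant (map (\<lambda>j. m - 1 - j) [0..<m])))"

definition Y :: "nat list \<Rightarrow> dpoly" where
  "Y \<alpha> = schur (rev \<alpha>)"


section \<open>\<open>Q\<close>- and \<open>P\<close>-tilde polynomials\<close>

definition esym :: "nat \<Rightarrow> nat \<Rightarrow> dpoly" where
  "esym n i = (\<Sum>S | S \<subseteq> {1..n} \<and> card S = i. \<Prod>v \<in> S. X v)"

definition Qtilde2 :: "nat \<Rightarrow> nat \<Rightarrow> nat \<Rightarrow> dpoly" where
  "Qtilde2 n i j =
     esym n i * esym n j + 2 * (\<Sum>p = 1..j. (- 1) ^ p * esym n (i + p) * esym n (j - p))"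

text \<open>
  Pfaffian of a skew-symmetric matrix of even size \<open>m\<close>: the sum over the perfect matchings of
  \<open>{0, \<dots>, m - 1}\<close>, each represented by the unique permutation \<open>\<sigma>\<close> listing it as
  \<open>{\<sigma> 0, \<sigma> 1}, {\<sigma> 2, \<sigma> 3}, \<dots>\<close> with every pair increasing and the pairs sorted by first element.
  The Pfaffian of the \<open>0 \<times> 0\<close> matrix is \<open>1\<close>.
\<close>

definition matching_perms :: "nat \<Rightarrow> (nat \<Rightarrow> nat) set" where
  "matching_perms m = {\<sigma>. \<sigma> permutes {..<m} \<and>
     (\<forall>a < m div 2. \<sigma> (2 * a) < \<sigma> (2 * a + 1)) \<and>
     (\<forall>a b. a < b \<longrightarrow> b < m div 2 \<longrightarrow> \<sigma> (2 * a) < \<sigma> (2 * b))}"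

definition pfaffian :: "dpoly mat \<Rightarrow> dpoly" where
  "pfaffian A = (\<Sum>\<sigma> \<in> matching_perms (dim_row A).
     of_int (sign \<sigma>) * (\<Prod>a < dim_row A div 2. A $$ (\<sigma> (2 * a), \<sigma> (2 * a + 1))))"

definition Qtilde_mat :: "nat \<Rightarrow> nat list \<Rightarrow> dpoly mat" where
  "Qtilde_mat n L = mat (length L) (length L) (\<lambda>(p, q).
     if p < q then Qtilde2 n (L ! p) (L ! q)
     else if q < p then - Qtilde2 n (L ! q) (L ! p)
     else 0)"

definition Qtilde :: "nat \<Rightarrow> nat list \<Rightarrow> dpoly" where
  "Qtilde n I = pfaffian (Qtilde_mat n (if even (length I) then I else I @ [0]))"

definition num_parts :: "nat list \<Rightarrow> nat" where
  "num_parts I = length (filter (\<lambda>i. i \<noteq> 0) I)"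

definition Ptilde :: "nat \<Rightarrow> nat list \<Rightarrow> dpoly" where
  "Ptilde n I = const (half ^ num_parts I) * Qtilde n I"


section \<open>Partitions\<close>

text \<open>Strict partitions are represented by the strictly decreasing list of their positive parts.\<close>

definition strict_partition :: "nat list \<Rightarrow> bool" where
  "strict_partition I \<longleftrightarrow> sorted_wrt (>) I \<and> 0 \<notin> set I"

definition part :: "nat list \<Rightarrow> nat \<Rightarrow> nat" where
  "part I p = (if p < length I then I ! p else 0)"

definition diagram_subset :: "nat list \<Rightarrow> nat list \<Rightarrow> bool" where
  "diagram_subset I J \<longleftrightarrow> (\<forall>p. part I p \<le> part J p)"

definition rho :: "nat \<Rightarrow> nat list" where
  "rho m = rev [1..<m + 1]"

end

theory Submission
  imports Defs
begin

text \<open>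
  All operators are evaluated at rational points where no two of the \<open>\<plusminus>x\<^sub>i\<close> coincide. Let \<open>\<tau>\<close> change
  the sign of \<open>x\<^sub>1\<close> and let \<open>\<Omega>\<^sub>m = \<tau> \<partial>\<^sub>1 \<dots> \<partial>\<^sub>m\<^sub>-\<^sub>1\<close>. As \<open>\<partial>\<^sub>\<heartsuit> = \<tau> \<partial>\<^sub>1 \<tau>\<close>, the operator \<open>\<nabla>\<^sub>k\<close> is
  \<open>\<Omega>\<^sub>n \<Omega>\<^sub>n\<^sub>-\<^sub>1 \<dots> \<Omega>\<^sub>n\<^sub>-\<^sub>2\<^sub>k\<^sub>+\<^sub>1\<close>. The Schur polynomial \<open>Y\<^sub>\<alpha>\<close> is the image of the monomial with the exponents \<open>d\<close> of
  its bialternant under the longest divided difference, which is absorbed by replacing every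
  \<open>\<Omega>\<^sub>m\<close> with \<open>\<Omega>\<^sub>n\<close>. Hence, for symmetric \<open>f\<close>, the image of \<open>f Y\<^sub>\<alpha>\<close> is obtained from \<open>f\<close> by iterating
  \<open>f \<mapsto> (x\<^sub>1 ^ d\<^sub>j f) \<Omega>\<^sub>n\<close>, which is up to sign
  \<open>f \<mapsto> \<Sum>\<^sub>m x\<^sub>m ^ d\<^sub>j f(\<dots>, -x\<^sub>m, \<dots>) / \<Prod>\<^sub>i (x\<^sub>m - x\<^sub>i)\<close>.
  These maps satisfy Clifford relations with each other and with operators \<open>\<phi>\<^sub>i\<close> that create
  \<open>Q\<close>-tilde polynomials from \<open>1\<close>, so they erase single parts, up to an explicit sign.
\<close>

section \<open>Evaluation of polynomials\<close>

text \<open>The single terms of the Lagrange sums are rational functions, not polynomials; hence the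
  passage to functions on points, from which polynomials are recovered by \<open>dpoly_eqI\<close>.
  Absorbing the longest divided difference rests on \<open>Om_Om\<close>, that is, on the
  commutation of \<open>\<partial>\<^sub>\<heartsuit>\<close> with
  \<open>\<partial>\<^sub>1\<close>. Exponents can be fed in one at a time only because the bound on
  \<open>\<alpha>\<close> makes all correction terms of the Leibniz rule die for lack of degree. The
  obstacle to Clifford relations is that multiplication by \<open>es n i\<close> does not commute
  with sign changes. So \<open>phi\<close> is built from the coefficients of E(t)E(-t), which do; a
  second form of \<open>phi\<close>, with exponents below \<open>n\<close>, yields the recursion of
  the Pfaffians. An exponent \<open>c\<close> erases the part \<open>n - 1 - c\<close>. The
  exponents decrease, so parts are erased in increasing order and keep their positions in
  \<open>I\<close>. The value 0 can only come first: it erases nothing and gives the sign behind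
  \<open>s''\<close>. Each of the \<open>2 * k\<close> steps also carries \<open>(- 1) ^ n\<close>,
  which cancels in the end.\<close>

definition meval :: "(nat \<Rightarrow> rat) \<Rightarrow> (nat \<Rightarrow>\<^sub>0 nat) \<Rightarrow> rat" where
  "meval x m = (\<Prod>v\<in>Poly_Mapping.keys m. x v ^ Poly_Mapping.lookup m v)"

definition ev :: "(nat \<Rightarrow> rat) \<Rightarrow> dpoly \<Rightarrow> rat" where
  "ev x f = (\<Sum>m\<in>Poly_Mapping.keys f. Rep_dyadic (Poly_Mapping.lookup f m) * meval x m)"

lemmas dyadic_rep = plus_dyadic.rep_eq times_dyadic.rep_eq zero_dyadic.rep_eq one_dyadic.rep_eq
  uminus_dyadic.rep_eq half.rep_eq

lemma meval_superset:
  assumes "finite A" "Poly_Mapping.keys m \<subseteq> A"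
  shows "meval x m = (\<Prod>v\<in>A. x v ^ Poly_Mapping.lookup m v)"
  unfolding meval_def using assms by (intro prod.mono_neutral_left) (auto simp: in_keys_iff)

lemma meval_add: "meval x (m + m') = meval x m * meval x m'"
proof -
  let ?A = "Poly_Mapping.keys m \<union> Poly_Mapping.keys m'"
  have "meval x (m + m') = (\<Prod>v\<in>?A. x v ^ Poly_Mapping.lookup (m + m') v)"
    by (rule meval_superset) (use keys_add[of m m'] in auto)
  also have "\<dots> = (\<Prod>v\<in>?A. x v ^ Poly_Mapping.lookup m v) * (\<Prod>v\<in>?A. x v ^ Poly_Mapping.lookup m' v)"
    by (simp add: lookup_add power_add prod.distrib)
  also have "\<dots> = meval x m * meval x m'"
    by (subst (1 2) meval_superset[of ?A]) auto
  finally show ?thesis .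
qed

lemma ev_superset:
  assumes "finite A" "Poly_Mapping.keys f \<subseteq> A"
  shows "ev x f = (\<Sum>m\<in>A. Rep_dyadic (Poly_Mapping.lookup f m) * meval x m)"
  unfolding ev_def using assms
  by (intro sum.mono_neutral_left) (auto simp: in_keys_iff dyadic_rep)

lemma ev_zero [simp]: "ev x 0 = 0"
  by (simp add: ev_def)

lemma ev_add [simp]: "ev x (f + g) = ev x f + ev x g"
proof -
  let ?A = "Poly_Mapping.keys f \<union> Poly_Mapping.keys g"
  have "ev x (f + g) = (\<Sum>m\<in>?A. Rep_dyadic (Poly_Mapping.lookup (f + g) m) * meval x m)"
    by (rule ev_superset) (use keys_add[of f g] in auto)
  also have "\<dots> = ev x f + ev x g"
    by (subst (1 2) ev_superset[of ?A]) (auto simp: lookup_add dyadic_rep sum.distrib distrib_right)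
  finally show ?thesis .
qed

lemma ev_sum [simp]: "ev x (sum f A) = (\<Sum>a\<in>A. ev x (f a))"
  by (induction A rule: infinite_finite_induct) auto

lemma ev_single: "ev x (Poly_Mapping.single m c) = Rep_dyadic c * meval x m"
  by (auto simp: ev_def dyadic_rep)

lemma dpoly_sum_monomials:
  fixes f :: dpoly
  shows "f = (\<Sum>m\<in>Poly_Mapping.keys f. Poly_Mapping.single m (Poly_Mapping.lookup f m))"
proof (rule poly_mapping_eqI)
  fix k
  have "(\<Sum>m\<in>Poly_Mapping.keys f. (Poly_Mapping.lookup f m when m = k)) = Poly_Mapping.lookup f k"
    by (cases "k \<in> Poly_Mapping.keys f") (auto simp: when_def in_keys_iff)
  then show "Poly_Mapping.lookup f k
      = Poly_Mapping.lookup (\<Sum>m\<in>Poly_Mapping.keys f. Poly_Mapping.single m (Poly_Mapping.lookup f m)) k"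
    by (simp add: lookup_sum lookup_single)
qed

lemma ev_mult [simp]: "ev x (f * g) = ev x f * ev x g"
proof -
  let ?F = "\<lambda>m. Poly_Mapping.single m (Poly_Mapping.lookup f m)"
  let ?G = "\<lambda>m. Poly_Mapping.single m (Poly_Mapping.lookup g m)"
  have "f * g = (\<Sum>m\<in>Poly_Mapping.keys f. ?F m) * (\<Sum>m\<in>Poly_Mapping.keys g. ?G m)"
    using dpoly_sum_monomials[of f] dpoly_sum_monomials[of g] by simp
  also have "ev x \<dots> = (\<Sum>m\<in>Poly_Mapping.keys f. \<Sum>m'\<in>Poly_Mapping.keys g. ev x (?F m * ?G m'))"
    by (simp add: sum_product)
  also have "\<dots> = ev x f * ev x g"
    by (simp add: mult_single ev_single dyadic_rep meval_add ev_def[of x f] ev_def[of x g] sum_product mult_ac)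
  finally show ?thesis .
qed

lemma ev_one [simp]: "ev x 1 = 1"
  using ev_single[of x 0 1] by (simp add: meval_def dyadic_rep)

lemma ev_uminus [simp]: "ev x (- f) = - ev x f"
  using ev_add[of x f "- f"] by (simp add: eq_neg_iff_add_eq_0 add.commute)

lemma ev_diff [simp]: "ev x (f - g) = ev x f - ev x g"
  using ev_add[of x f "- g"] by simp

lemma ev_power [simp]: "ev x (f ^ k) = ev x f ^ k"
  by (induction k) auto

lemma ev_prod [simp]: "ev x (prod f A) = (\<Prod>a\<in>A. ev x (f a))"
  by (induction A rule: infinite_finite_induct) auto

lemma ev_of_int [simp]: "ev x (of_int k) = of_int k"
proof (induction k rule: int_induct[of _ 0])
qed auto

lemma ev_numeral [simp]: "ev x (numeral w) = numeral w"
  using ev_of_int[of x "numeral w"] by simp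

lemma ev_const [simp]: "ev x (const c) = Rep_dyadic c"
  by (simp add: const_def ev_single meval_def)

lemma ev_X [simp]: "ev x (X i) = x i"
  by (simp add: X_def ev_single meval_def dyadic_rep)

lemma ev_poly_subst [simp]: "ev x (poly_subst \<sigma> f) = ev (\<lambda>v. ev x (\<sigma> v)) f"
  by (simp add: poly_subst_def ev_def[of _ f] meval_def)

lemma comm_ring_hom_ev: "comm_ring_hom (ev x)"
  by unfold_locales auto

lemma poly_subst_X: "poly_subst X f = f"
proof -
  have single_power: "X v ^ k = Poly_Mapping.single (Poly_Mapping.single v k) 1" for v k
    by (induction k) (simp_all add: X_def mult_single single_add [symmetric] single_one)
  have "(\<Prod>v\<in>A. X v ^ g v) = Poly_Mapping.single (\<Sum>v\<in>A. Poly_Mapping.single v (g v)) 1"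
    if "finite A" for A g
    using that by (induction A rule: finite_induct) (simp_all add: single_power mult_single)
  moreover have "(\<Sum>v\<in>Poly_Mapping.keys m. Poly_Mapping.single v (Poly_Mapping.lookup m v)) = m"
    for m :: "nat \<Rightarrow>\<^sub>0 nat"
  proof (rule poly_mapping_eqI)
    fix k
    have "(\<Sum>v\<in>Poly_Mapping.keys m. (Poly_Mapping.lookup m v when v = k)) = Poly_Mapping.lookup m k"
      by (cases "k \<in> Poly_Mapping.keys m") (auto simp: when_def in_keys_iff)
    then show "Poly_Mapping.lookup
         (\<Sum>v\<in>Poly_Mapping.keys m. Poly_Mapping.single v (Poly_Mapping.lookup m v)) k = Poly_Mapping.lookup m k"
      by (simp add: lookup_sum lookup_single)
  qed
  ultimately show ?thesis
    using dpoly_sum_monomials[of f] by (simp add: poly_subst_def const_def mult_single)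
qed

section \<open>Divisibility and values of divided differences\<close>

lemma dvd_power_diff:
  fixes a b g :: "'a::comm_ring_1"
  assumes "g dvd a - b"
  shows "g dvd a ^ k - b ^ k"
proof (induction k)
  case (Suc k)
  have "a ^ Suc k - b ^ Suc k = a * (a ^ k - b ^ k) + (a - b) * b ^ k"
    by (simp add: algebra_simps)
  then show ?case using Suc assms by (metis dvd_add dvd_mult dvd_mult2)
qed simp

lemma dvd_prod_diff:
  fixes a b :: "'b \<Rightarrow> 'a::comm_ring_1"
  assumes "\<And>v. g dvd a v - b v"
  shows "g dvd prod a A - prod b A"
proof (induction A rule: infinite_finite_induct)
  case (insert v A)
  have "prod a (insert v A) - prod b (insert v A) = a v * (prod a A - prod b A) + (a v - b v) * prod b A"
    using insert by (simp add: algebra_simps)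
  then show ?case using insert assms by (metis dvd_add dvd_mult dvd_mult2)
qed auto

text \<open>Congruence modulo \<open>g\<close> respects sums and products, and substituting the
  variables themselves gives back \<open>f\<close> (\<open>poly_subst_X\<close>). With
  \<open>g\<close> the denominator of a divided difference, this is what makes
  \<open>exact_quot\<close> meaningful.\<close>

lemma dvd_poly_subst_diff:
  assumes "\<And>v. g dvd X v - \<sigma> v"
  shows "g dvd f - poly_subst \<sigma> f"
proof -
  have "f - poly_subst \<sigma> f = poly_subst X f - poly_subst \<sigma> f"
    by (simp add: poly_subst_X)
  also have "\<dots> = (\<Sum>m\<in>Poly_Mapping.keys f. const (Poly_Mapping.lookup f m) *
     ((\<Prod>v\<in>Poly_Mapping.keys m. X v ^ Poly_Mapping.lookup m v)
      - (\<Prod>v\<in>Poly_Mapping.keys m. \<sigma> v ^ Poly_Mapping.lookup m v)))"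
    by (simp add: poly_subst_def sum_subtractf right_diff_distrib)
  also have "g dvd \<dots>"
    by (intro dvd_sum dvd_mult dvd_prod_diff dvd_power_diff assms)
  finally show ?thesis .
qed

lemma ev_exact_quot:
  assumes "g dvd f" "ev x g \<noteq> 0"
  shows "ev x (exact_quot f g) = ev x f / ev x g"
proof -
  obtain q where q: "f = g * q" using assms by auto
  have "exact_quot f g = q"
    using assms q by (intro exact_quot_eqI) (auto simp: mult.commute)
  then show ?thesis using assms q by simp
qed

lemma ev_divdiff_Simple:
  assumes "x i \<noteq> x (i + 1)"
  shows "ev x (divdiff (Simple i) f) = (ev x f - ev (x \<circ> Transposition.transpose i (i + 1)) f) / (x i - x (i + 1))"
proof -
  let ?s = "X(i := X (i + 1), i + 1 := X i)"
  have "X i - X (i + 1) dvd f - poly_subst ?s f"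
  proof (rule dvd_poly_subst_diff)
    fix v
    have "X v - ?s v = 0 \<or> X v - ?s v = X i - X (i + 1) \<or> X v - ?s v = - (X i - X (i + 1))"
      by auto
    then show "X i - X (i + 1) dvd X v - ?s v" by (metis dvd_0_right dvd_minus_iff dvd_refl)
  qed
  moreover have "(\<lambda>v. ev x (?s v)) = x \<circ> Transposition.transpose i (i + 1)"
    by (auto simp: Transposition.transpose_def fun_eq_iff)
  ultimately show ?thesis using assms by (simp add: ev_exact_quot)
qed

lemma ev_divdiff_Heart:
  assumes "- x 1 \<noteq> x 2"
  shows "ev x (divdiff Heart f) = (ev x f - ev (x(1 := - x 2, 2 := - x 1)) f) / (- x 1 - x 2)"
proof -
  let ?s = "X(1 := - X 2, 2 := - X 1)"
  have "- X 1 - X 2 dvd f - poly_subst ?s f"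
  proof (rule dvd_poly_subst_diff)
    fix v
    have "X v - ?s v = 0 \<or> X v - ?s v = - (- X 1 - X 2)"
      by auto
    then show "- X 1 - X 2 dvd X v - ?s v" by (metis dvd_0_right dvd_minus_iff dvd_refl)
  qed
  moreover have "(\<lambda>v. ev x (?s v)) = x(1 := - x 2, 2 := - x 1)"
    by (auto simp: fun_eq_iff)
  ultimately show ?thesis using assms by (simp add: ev_exact_quot)
qed

section \<open>Polynomials are determined by their values\<close>

lemma base_expansion_inj:
  fixes a b :: "nat \<Rightarrow> nat"
  assumes "\<And>v. a v < B" "\<And>v. b v < B" "(\<Sum>v<V. a v * B ^ v) = (\<Sum>v<V. b v * B ^ v)" "v < V"
  shows "a v = b v"
  using assms
proof (induction V arbitrary: a b v)
  case (Suc V)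
  have *: "(\<Sum>v<Suc V. c v * B ^ v) = c 0 + B * (\<Sum>v<V. c (Suc v) * B ^ v)" for c :: "nat \<Rightarrow> nat"
    by (subst sum.lessThan_Suc_shift) (simp add: sum_distrib_left mult_ac)
  have eq: "a 0 + B * (\<Sum>v<V. a (Suc v) * B ^ v) = b 0 + B * (\<Sum>v<V. b (Suc v) * B ^ v)"
    using Suc.prems(3) unfolding * .
  have 0: "a 0 = b 0"
    using arg_cong[OF eq, of "\<lambda>z. z mod B"] Suc.prems(1,2)[of 0] by simp
  then have "(\<Sum>v<V. a (Suc v) * B ^ v) = (\<Sum>v<V. b (Suc v) * B ^ v)"
    using eq Suc.prems(1)[of 0] by (cases "B = 0") auto
  then have "a (Suc w) = b (Suc w)" if "w < V" for w
    using Suc.IH[of "\<lambda>v. a (Suc v)" "\<lambda>v. b (Suc v)" w] Suc.prems(1,2) that by blast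
  then show ?case using 0 Suc.prems(4) by (cases v) auto
qed simp

text \<open>Kronecker substitution \<open>x\<^sub>v = T ^ B ^ (v + 1)\<close> separates the monomials of \<open>f\<close>.\<close>

lemma dpoly_eq_0I:
  fixes f :: dpoly
  assumes zero: "\<And>x. (\<And>i. x i > 0) \<Longrightarrow> inj x \<Longrightarrow> ev x f = 0"
  shows "f = 0"
proof (rule ccontr)
  assume "f \<noteq> 0"
  let ?K = "Poly_Mapping.keys f"
  define U where "U = insert 0 (\<Union>m\<in>?K. Poly_Mapping.keys m)"
  have finU: "finite U" by (simp add: U_def)
  define V where "V = Suc (Max U)"
  have V: "v < V" if "m \<in> ?K" "v \<in> Poly_Mapping.keys m" for m v
    using that finU unfolding V_def by (auto simp: U_def less_Suc_eq_le intro!: Max_ge)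
  define D where "D = insert 0 (\<Union>m\<in>?K. Poly_Mapping.lookup m ` Poly_Mapping.keys m)"
  have finD: "finite D" by (simp add: D_def)
  \<comment> \<open>\<open>B\<close> exceeds every exponent, so exponents are digits in base
    \<open>B\<close>; it is at least 2, so distinct variables become distinct powers of
    \<open>T\<close>.\<close>
  define B where "B = Max D + 2"
  have B: "Poly_Mapping.lookup m v < B" if "m \<in> ?K" for m v
  proof -
    have "Poly_Mapping.lookup m v \<in> D"
      using that by (cases "v \<in> Poly_Mapping.keys m") (auto simp: D_def not_in_keys_iff_lookup_eq_zero)
    then have "Poly_Mapping.lookup m v \<le> Max D" by (rule Max_ge[OF finD])
    then show ?thesis by (simp add: B_def)
  qed
  define code where "code m = (\<Sum>v<V. Poly_Mapping.lookup m v * B ^ v)" for m :: "nat \<Rightarrow>\<^sub>0 nat"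
  have inj: "inj_on code ?K"
  proof (rule inj_onI)
    fix m m' assume m: "m \<in> ?K" "m' \<in> ?K" "code m = code m'"
    show "m = m'"
    proof (rule poly_mapping_eqI)
      fix v
      show "Poly_Mapping.lookup m v = Poly_Mapping.lookup m' v"
      proof (cases "v < V")
        case True
        then show ?thesis
          using base_expansion_inj[of "Poly_Mapping.lookup m" B "Poly_Mapping.lookup m'" V v] B m
          unfolding code_def by blast
      next
        case False
        then have "v \<notin> Poly_Mapping.keys m" "v \<notin> Poly_Mapping.keys m'" using V m by blast+
        then show ?thesis by (simp add: in_keys_iff)
      qed
    qed
  qed
  \<comment> \<open>The image of \<open>f\<close> as a polynomial in \<open>T\<close>: it keeps a
    nonzero coefficient, yet every integer \<open>T \<ge> 2\<close> will be a root.\<close>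
  define p :: "rat poly" where
    "p = (\<Sum>m\<in>?K. Polynomial.monom (Rep_dyadic (Poly_Mapping.lookup f m)) (B * code m))"
  obtain m0 where m0: "m0 \<in> ?K" using \<open>f \<noteq> 0\<close> by (metis all_not_in_conv keys_eq_empty)
  have "Polynomial.coeff p (B * code m0) = (\<Sum>m\<in>?K. if m = m0 then Rep_dyadic (Poly_Mapping.lookup f m) else 0)"
    unfolding p_def Polynomial.coeff_sum
  proof (rule sum.cong[OF refl])
    fix m assume "m \<in> ?K"
    moreover have "B > 0" by (simp add: B_def)
    ultimately show "Polynomial.coeff (Polynomial.monom (Rep_dyadic (Poly_Mapping.lookup f m)) (B * code m)) (B * code m0)
      = (if m = m0 then Rep_dyadic (Poly_Mapping.lookup f m) else 0)"
      using inj m0 by (auto simp: inj_on_def)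
  qed
  also have "\<dots> = Rep_dyadic (Poly_Mapping.lookup f m0)" using m0 by simp
  also have "\<dots> \<noteq> 0" using m0 by (metis Rep_dyadic_inject in_keys_iff zero_dyadic.rep_eq)
  finally have "p \<noteq> 0" by auto
  have "poly p (of_nat T) = 0" if T: "T \<ge> 2" for T :: nat
  proof -
    define x :: "nat \<Rightarrow> rat" where "x v = of_nat T ^ (B ^ (v + 1))" for v
    have pos: "x v > 0" for v using T by (simp add: x_def)
    have "inj x"
    proof (rule injI)
      fix u v assume "x u = x v"
      then have "B ^ (u + 1) = B ^ (v + 1)"
        unfolding x_def using T by (subst (asm) power_inject_exp) auto
      then show "u = v" using power_inject_exp[of B "u + 1" "v + 1"] by (simp add: B_def)
    qed
    have "meval x m = of_nat T ^ (B * code m)" if "m \<in> ?K" for m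
    proof -
      have "meval x m = (\<Prod>v<V. x v ^ Poly_Mapping.lookup m v)"
        by (rule meval_superset) (use V that in auto)
      also have "\<dots> = of_nat T ^ (\<Sum>v<V. B ^ (v + 1) * Poly_Mapping.lookup m v)"
        by (simp add: x_def power_mult [symmetric] power_sum)
      also have "(\<Sum>v<V. B ^ (v + 1) * Poly_Mapping.lookup m v) = B * code m"
        by (simp add: code_def sum_distrib_left mult_ac)
      finally show ?thesis .
    qed
    then have "ev x f = poly p (of_nat T)"
      by (simp add: ev_def p_def poly_sum poly_monom)
    then show ?thesis using zero[OF pos \<open>inj x\<close>] by simp
  qed
  then have "of_nat ` {2..} \<subseteq> {x. poly p x = 0}" by auto
  moreover have "finite {x. poly p x = 0}" using \<open>p \<noteq> 0\<close> by (rule poly_roots_finite)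
  ultimately have "finite (of_nat ` {2..} :: rat set)" by (rule finite_subset)
  then have "finite {2::nat..}" by (rule finite_imageD) (auto simp: inj_on_def)
  then show False by (simp add: infinite_Ici)
qed

section \<open>Divided differences of functions at generic points\<close>

text \<open>The points at which no denominator of a divided difference of type \<open>D\<close> vanishes.\<close>

typedef gpt = "{x :: nat \<Rightarrow> rat. inj x \<and> (\<forall>i j. x i \<noteq> - x j)}"
proof (rule exI[of _ "\<lambda>i. of_nat i + 1"], intro CollectI conjI allI)
  fix i j :: nat
  have "(of_nat i + 1 :: rat) > 0" "(of_nat j + 1 :: rat) > 0"
    by (simp_all add: add_nonneg_pos)
  then show "(of_nat i + 1 :: rat) \<noteq> - (of_nat j + 1)" by linarith
qed (simp add: inj_def)

setup_lifting type_definition_gpt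

abbreviation co :: "gpt \<Rightarrow> nat \<Rightarrow> rat" where "co \<equiv> Rep_gpt"

lemma gpt_eqI: "(\<And>i. co x i = co y i) \<Longrightarrow> x = y"
  by (simp add: Rep_gpt_inject [symmetric] fun_eq_iff)

lemma co_eq_iff [simp]: "co x i = co x j \<longleftrightarrow> i = j"
  using Rep_gpt[of x] by (auto dest: injD)

lemma co_neq_minus [simp]: "co x i \<noteq> - co x j"
  using Rep_gpt[of x] by auto

lemma co_add_neq_0 [simp]: "co x i + co x j \<noteq> 0"
  using co_neq_minus[of x i j] by (simp only: eq_neg_iff_add_eq_0 simp_thms)

lemma co_neq_0 [simp]: "co x i \<noteq> 0"
  using co_neq_minus[of x i i] by auto

lift_definition sw :: "nat \<Rightarrow> gpt \<Rightarrow> gpt" is "\<lambda>i x. x \<circ> Transposition.transpose i (Suc i)"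
  by (auto intro!: inj_compose)

lift_definition fl :: "nat \<Rightarrow> gpt \<Rightarrow> gpt" is "\<lambda>i x. x(i := - x i)"
proof -
  fix i and x :: "nat \<Rightarrow> rat"
  assume x: "inj x \<and> (\<forall>i j. x i \<noteq> - x j)"
  then have inj: "x j = x k \<longleftrightarrow> j = k" and neg: "x j \<noteq> - x k" "- x k \<noteq> x j" for j k
    by (simp_all add: inj_eq) metis
  have "j = k" if "(x(i := - x i)) j = (x(i := - x i)) k" for j k
    using that by (simp add: inj neg split: if_splits)
  moreover have "(x(i := - x i)) j \<noteq> - (x(i := - x i)) k" for j k
    using neg(1)[of j k] neg(1)[of i i] inj[of i k] inj[of j i] by (auto simp: fun_upd_apply)
  ultimately show "inj (x(i := - x i)) \<and> (\<forall>j k. (x(i := - x i)) j \<noteq> - (x(i := - x i)) k)"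
    unfolding inj_def by blast
qed

lemma co_sw: "co (sw i x) j = (if j = i then co x (Suc i) else if j = Suc i then co x i else co x j)"
  by (auto simp: sw.rep_eq Transposition.transpose_def)

lemma co_fl: "co (fl i x) j = (if j = i then - co x i else co x j)"
  by (auto simp: fl.rep_eq)

lemma sw_sw [simp]: "sw i (sw i x) = x"
  by (rule gpt_eqI) (simp add: co_sw)

lemma fl_fl [simp]: "fl i (fl i x) = x"
  by (rule gpt_eqI) (simp add: co_fl)

lemma sw_commute: "Suc i < j \<Longrightarrow> sw j (sw i x) = sw i (sw j x)"
  by (rule gpt_eqI) (simp add: co_sw)

lemma sw_braid: "sw (Suc i) (sw i (sw (Suc i) x)) = sw i (sw (Suc i) (sw i x))"
  by (rule gpt_eqI) (simp add: co_sw)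

lemma fl_sw_commute: "j < i \<Longrightarrow> fl j (sw i x) = sw i (fl j x)"
  by (rule gpt_eqI) (auto simp add: co_sw co_fl)

type_synonym gfun = "gpt \<Rightarrow> rat"

definition dd :: "nat \<Rightarrow> gfun \<Rightarrow> gfun" where
  "dd i f = (\<lambda>x. (f x - f (sw i x)) / (co x i - co x (Suc i)))"

definition tau :: "gfun \<Rightarrow> gfun" where
  "tau f = (\<lambda>x. f (fl 1 x))"

abbreviation dds :: "nat list \<Rightarrow> gfun \<Rightarrow> gfun" where
  "dds w f \<equiv> fold dd w f"

definition Om :: "nat \<Rightarrow> gfun \<Rightarrow> gfun" where
  "Om m f = dds [1..<m] (tau f)"

definition sym_on :: "nat \<Rightarrow> nat \<Rightarrow> gfun \<Rightarrow> bool" where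
  "sym_on a b f \<longleftrightarrow> (\<forall>i x. a \<le> i \<longrightarrow> i < b \<longrightarrow> f (sw i x) = f x)"

lemma sym_onD: "sym_on a b f \<Longrightarrow> a \<le> i \<Longrightarrow> i < b \<Longrightarrow> f (sw i x) = f x"
  by (simp add: sym_on_def)

section \<open>Relations between divided differences and the sign change\<close>

lemma co_diff_neq_0 [simp]: "i \<noteq> j \<Longrightarrow> co x i - co x j \<noteq> 0"
  by simp

text \<open>\<open>f0\<close> to \<open>f5\<close> are the values of a function on an orbit of the
  symmetric group on three letters. The two sides differ by a multiple of
  \<open>p * q - (p + q) * r\<close>, which vanishes because 1/u + 1/v = (u + v)/(uv).\<close>

lemma braid_field:
  fixes u v :: "'a::field"
  assumes "u \<noteq> 0" "v \<noteq> 0" "u + v \<noteq> 0"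
  shows "(((f0 - f1) / u - (f2 - f3) / (u + v)) / v - ((f1 - f0) / - u - (f4 - f5) / v) / (u + v)) / u
       = (((f0 - f2) / v - (f1 - f4) / (u + v)) / u - ((f2 - f0) / - v - (f3 - f5) / u) / (u + v)) / v"
proof -
  define p q r where pqr: "p = inverse u" "q = inverse v" "r = inverse (u + v)"
  have "p * q - (p + q) * r = 0"
    using assms by (simp add: pqr field_simps)
  moreover have "(((f0 - f1) * p - (f2 - f3) * r) * q - ((f1 - f0) * - p - (f4 - f5) * q) * r) * p
      - (((f0 - f2) * q - (f1 - f4) * r) * p - ((f2 - f0) * - q - (f3 - f5) * p) * r) * q
      = ((p - q) * f0 - p * f1 + q * f2) * (p * q - (p + q) * r)"
    by (simp add: algebra_simps)
  ultimately show ?thesis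
    unfolding divide_inverse inverse_minus_eq pqr(1) [symmetric] pqr(2) [symmetric] pqr(3) [symmetric]
    by simp
qed

lemma dd_braid: "dd i (dd (Suc i) (dd i f)) = dd (Suc i) (dd i (dd (Suc i) f))"
proof
  fix x
  let ?s = "sw i" and ?t = "sw (Suc i)"
  define a b c where abc: "a = co x i" "b = co x (Suc i)" "c = co x (Suc (Suc i))"
  define u v where uv: "u = a - b" "v = b - c"
  have ne: "u \<noteq> 0" "v \<noteq> 0" "u + v \<noteq> 0" by (simp_all add: uv abc)
  have d: "a - b = u" "b - c = v" "a - c = u + v" "b - a = - u" "c - b = - v" "c - a = - (u + v)"
    by (simp_all add: uv)
  have co: "co (?s y) i = co y (Suc i)" "co (?s y) (Suc i) = co y i" "co (?s y) (Suc (Suc i)) = co y (Suc (Suc i))"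
    "co (?t y) i = co y i" "co (?t y) (Suc i) = co y (Suc (Suc i))" "co (?t y) (Suc (Suc i)) = co y (Suc i)" for y
    by (simp_all add: co_sw)
  show "dd i (dd (Suc i) (dd i f)) x = dd (Suc i) (dd i (dd (Suc i) f)) x"
    unfolding dd_def co sw_braid sw_sw abc [symmetric] d
    by (rule braid_field[OF ne])
qed

lemma dd_commute:
  assumes "Suc i < j"
  shows "dd j (dd i f) = dd i (dd j f)"
proof
  fix x
  have d: "co (sw j x) i = co x i" "co (sw j x) (Suc i) = co x (Suc i)"
    "co (sw i x) j = co x j" "co (sw i x) (Suc j) = co x (Suc j)"
    using assms by (simp_all add: co_sw)
  show "dd j (dd i f) x = dd i (dd j f) x"
    unfolding dd_def d sw_commute[OF assms] divide_inverse by (simp add: algebra_simps)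
qed

lemma dd_tau_commute: "1 < i \<Longrightarrow> dd i (tau f) = tau (dd i f)"
  unfolding dd_def tau_def by (auto simp: fun_eq_iff fl_sw_commute co_fl)

lemma dd_mult_sym:
  assumes "\<And>x. f (sw i x) = f x"
  shows "dd i (\<lambda>x. f x * g x) = (\<lambda>x. f x * dd i g x)"
  unfolding dd_def by (auto simp: fun_eq_iff assms right_diff_distrib)

lemma dds_mult_sym:
  assumes "sym_on a b f" "set w \<subseteq> {a..<b}"
  shows "dds w (\<lambda>x. f x * g x) = (\<lambda>x. f x * dds w g x)"
  using assms(2)
proof (induction w arbitrary: g)
  case (Cons i w)
  have "dd i (\<lambda>x. f x * g x) = (\<lambda>x. f x * dd i g x)"
    by (rule dd_mult_sym) (use Cons.prems assms(1) in \<open>auto intro: sym_onD\<close>)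
  then show ?case using Cons by simp
qed simp

lemma dd_sum: "dd i (\<lambda>x. \<Sum>s\<in>S. f s x) = (\<lambda>x. \<Sum>s\<in>S. dd i (f s) x)"
  unfolding dd_def by (simp add: fun_eq_iff sum_subtractf flip: sum_divide_distrib)

lemma dds_sum: "dds w (\<lambda>x. \<Sum>s\<in>S. f s x) = (\<lambda>x. \<Sum>s\<in>S. dds w (f s) x)"
  by (induction w arbitrary: f) (simp_all add: dd_sum)

lemma dd_diff: "dd i (\<lambda>x. f x - g x) = (\<lambda>x. dd i f x - dd i g x)"
  unfolding dd_def by (auto simp: fun_eq_iff diff_divide_distrib)

lemma dds_diff: "dds w (\<lambda>x. f x - g x) = (\<lambda>x. dds w f x - dds w g x)"
  by (induction w arbitrary: f g) (simp_all add: dd_diff)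

lemma dds_zero [simp]: "dds w (\<lambda>x. 0) = (\<lambda>x. 0)"
  using dds_diff[of w "\<lambda>x. 0" "\<lambda>x. 0"] by simp

lemma dds_tau_commute: "\<forall>i\<in>set w. 1 < i \<Longrightarrow> dds w (tau f) = tau (dds w f)"
  by (induction w arbitrary: f) (simp_all add: dd_tau_commute)

lemma dd_dds_commute:
  assumes "\<forall>j\<in>set w. Suc j < i \<or> Suc i < j"
  shows "dd i (dds w f) = dds w (dd i f)"
  using assms
proof (induction w arbitrary: f)
  case (Cons j w)
  then show ?case using dd_commute[of i j f] dd_commute[of j i f] by auto
qed simp

text \<open>The extra operator passes the letters below \<open>i\<close> by commutation, turns from
  \<open>dd (Suc i)\<close> into \<open>dd i\<close> by the braid relation at the letters
  \<open>i\<close> and \<open>Suc i\<close>, and passes the remaining letters by commutation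
  again.\<close>

lemma dds_shift:
  assumes "a \<le> i" "Suc i < m"
  shows "dds [a..<m] (dd (Suc i) f) = dd i (dds [a..<m] f)"
proof -
  have 1: "[a..<m] = [a..<i] @ [i, Suc i] @ [Suc (Suc i)..<m]"
    using assms upt_add_eq_append[of a i "m - i"] by (simp add: upt_conv_Cons)
  have 2: "dds [a..<i] (dd (Suc i) f) = dd (Suc i) (dds [a..<i] f)"
    by (rule dd_dds_commute [symmetric]) auto
  have 3: "dd i (dds [Suc (Suc i)..<m] g) = dds [Suc (Suc i)..<m] (dd i g)" for g
    by (rule dd_dds_commute) auto
  show ?thesis unfolding 1 by (simp add: 2 3 dd_braid)
qed

lemma dds_map_Suc_shift:
  assumes "\<forall>i\<in>set w. a \<le> i \<and> Suc i < m"
  shows "dds [a..<m] (dds (map Suc w) f) = dds w (dds [a..<m] f)"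
  using assms by (induction w arbitrary: f) (simp_all add: dds_shift)

lemma Om_dds_Suc:
  assumes "\<forall>i\<in>set w. 1 \<le> i \<and> Suc i < m"
  shows "Om m (dds (map Suc w) f) = dds w (Om m f)"
proof -
  have "tau (dds (map Suc w) f) = dds (map Suc w) (tau f)"
    by (rule dds_tau_commute [symmetric]) (use assms in auto)
  then show ?thesis unfolding Om_def using dds_map_Suc_shift[OF assms] by simp
qed

lemma tau_field:
  fixes a b :: "'a::field"
  shows "((f0 - f1) / (- a - b) - (f2 - f3) / (- b - a)) / (a - b)
       = ((f0 - f2) / (- (- a) - b) - (f1 - f3) / (- b - - a)) / (- a - b)"
proof -
  have 1: "- b - a = - a - b" "- b - - a = a - b" by simp_all
  have "((f0 - f1) * q - (f2 - f3) * q) * p = ((f0 - f2) * p - (f1 - f3) * p) * q" for p q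
    by (simp add: algebra_simps)
  then show ?thesis unfolding 1 divide_inverse minus_minus .
qed

text \<open>\<open>\<partial>\<^sub>1\<close> and \<open>\<partial>\<^sub>\<heartsuit>\<close>
  commute: their reflections commute, and each fixes the linear form by which the other operator
  divides.\<close>

lemma dd_tau_dd_tau: "dd 1 (tau (dd 1 (tau f))) = tau (dd 1 (tau (dd 1 f)))"
proof
  fix x
  let ?s = "sw 1" and ?t = "fl 1"
  have pt: "?s (?t (?s (?t x))) = ?t (?s (?t (?s x)))"
    by (rule gpt_eqI) (simp add: co_sw co_fl)
  have co: "co (?s y) 1 = co y (Suc 1)" "co (?s y) (Suc 1) = co y 1"
    "co (?t y) 1 = - co y 1" "co (?t y) (Suc 1) = co y (Suc 1)" for y
    by (simp_all add: co_sw co_fl)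
  show "dd 1 (tau (dd 1 (tau f))) x = tau (dd 1 (tau (dd 1 f))) x"
    unfolding dd_def tau_def co fl_fl pt by (rule tau_field)
qed

lemma upt_1_split: "2 \<le> m \<Longrightarrow> [1..<m] = 1 # [2..<m]"
  by (simp add: upt_conv_Cons numeral_2_eq_2)

text \<open>Both sides equal \<open>tau dd\<^sub>1 tau\<close> followed by \<open>dd\<^sub>2 \<dots> dd\<^sub>m\<^sub>-\<^sub>1\<close> and \<open>dd\<^sub>1 \<dots> dd\<^sub>m\<^sub>-\<^sub>1\<close>.\<close>

lemma Om_Om:
  assumes "2 \<le> m"
  shows "Om m (Om m f) = Om (m - 1) (Om m (dd 1 f))"
proof -
  have tau2: "dds [2..<m] (tau g) = tau (dds [2..<m] g)" for g
    by (rule dds_tau_commute) auto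
  have shift: "dds [1..<m] (dds [2..<m] g) = dds [1..<m - 1] (dds [1..<m] g)" for g
  proof -
    have 1: "[2..<m] = map Suc [1..<m - 1]" using assms by (simp add: map_Suc_upt numeral_2_eq_2)
    show ?thesis unfolding 1 by (rule dds_map_Suc_shift) auto
  qed
  have "Om (m - 1) (Om m (dd 1 f)) = dds [1..<m - 1] (tau (dds [2..<m] (dd 1 (tau (dd 1 f)))))"
    unfolding Om_def upt_1_split[OF assms] by simp
  also have "\<dots> = dds [1..<m - 1] (dds [2..<m] (tau (dd 1 (tau (dd 1 f)))))"
    by (simp add: tau2)
  also have "\<dots> = dds [1..<m - 1] (dds [1..<m] (tau (dd 1 (tau f))))"
    unfolding upt_1_split[OF assms] using dd_tau_dd_tau[of f] by simp
  also have "\<dots> = dds [1..<m] (dds [2..<m] (tau (dd 1 (tau f))))"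
    by (rule shift [symmetric])
  also have "\<dots> = Om m (Om m f)"
    unfolding Om_def upt_1_split[OF assms] by (simp add: tau2)
  finally show ?thesis by simp
qed

section \<open>Products of the operators \<open>Om\<close>\<close>

fun Omc :: "nat \<Rightarrow> nat \<Rightarrow> gfun \<Rightarrow> gfun" where
  "Omc n 0 f = f"
| "Omc n (Suc r) f = Omc (n - 1) r (Om n f)"

text \<open>A run of \<open>r\<close> letters in front raises the index of each of the
  \<open>r\<close> later factors by one. The letter 1 does this for the second factor by
  \<open>Om_Om\<close>; the others pass the first factor, are lowered by one, and act in the same
  way on the shorter product.\<close>

lemma Omc_dds_upt:
  assumes "Suc r \<le> n"
  shows "Omc n (Suc r) (dds [1..<Suc r] f) = Omc n r (Om n f)"
  using assms
proof (induction r arbitrary: n f)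
  case (Suc r)
  have "[1..<Suc (Suc r)] = 1 # map Suc [1..<Suc r]"
    by (simp add: map_Suc_upt upt_conv_Cons del: upt_Suc)
  then have "dds [1..<Suc (Suc r)] f = dds (map Suc [1..<Suc r]) (dd 1 f)"
    by (simp only: fold_simps)
  then have "Omc n (Suc (Suc r)) (dds [1..<Suc (Suc r)] f)
      = Omc (n - 1) (Suc r) (Om n (dds (map Suc [1..<Suc r]) (dd 1 f)))"
    by simp
  also have "\<dots> = Omc (n - 1) (Suc r) (dds [1..<Suc r] (Om n (dd 1 f)))"
  proof -
    have "\<forall>i\<in>set [1..<Suc r]. 1 \<le> i \<and> Suc i < n" using Suc.prems by auto
    then show ?thesis by (simp only: Om_dds_Suc)
  qed
  also have "\<dots> = Omc (n - 1) r (Om (n - 1) (Om n (dd 1 f)))"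
    by (rule Suc.IH) (use Suc.prems in simp)
  also have "\<dots> = Omc (n - 1) r (Om n (Om n f))"
    using Om_Om[of n f] Suc.prems by simp
  finally show ?case by simp
qed simp

section \<open>Products with monomials\<close>

lemma dd_eq_0_iff: "dd i f = (\<lambda>x. 0) \<longleftrightarrow> (\<forall>x. f (sw i x) = f x)"
  by (auto simp: dd_def fun_eq_iff)

lemma dd_dd [simp]: "dd i (dd i f) = (\<lambda>x. 0)"
proof -
  have "dd i f (sw i x) = dd i f x" for x
    using minus_divide_divide[of "f x - f (sw i x)" "co x i - co x (Suc i)"]
    by (simp add: dd_def co_sw)
  then show ?thesis by (simp add: dd_eq_0_iff)
qed

text \<open>Invariance under \<open>sw l\<close> means being killed by \<open>dd l\<close>. Behind
  the run, \<open>dd l\<close> equals \<open>dd (Suc l)\<close> in front of it, which kills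
  \<open>g\<close>; for the last letter of the run, \<open>dd_dd\<close> applies instead.\<close>

lemma sym_on_dds_upt:
  assumes "sym_on (Suc i) m g"
  shows "sym_on i m (dds [i..<m] g)"
  unfolding sym_on_def
proof (intro allI impI)
  fix l x assume l: "i \<le> l" "l < m"
  have "dd l (dds [i..<m] g) = (\<lambda>x. 0)"
  proof (cases "Suc l = m")
    case True
    then show ?thesis using l by (auto simp: upt_Suc)
  next
    case False
    then have "Suc l < m" using l by simp
    moreover have "dd (Suc l) g = (\<lambda>x. 0)"
      using assms l \<open>Suc l < m\<close> by (simp add: dd_eq_0_iff sym_on_def)
    ultimately show ?thesis using dds_shift[OF l(1), of m g] by simp
  qed
  then show "dds [i..<m] g (sw l x) = dds [i..<m] g x" by (simp add: dd_eq_0_iff)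
qed

lemma power_alternating_sum:
  fixes u v :: "'a::comm_ring_1"
  assumes "q \<le> p"
  shows "u ^ p * v ^ q - v ^ p * u ^ q = (u - v) * (\<Sum>s\<in>{q..<p}. u ^ (p + q - 1 - s) * v ^ s)"
  using assms
proof (induction p rule: dec_induct)
  case (step p)
  have "(\<Sum>s\<in>{q..<p}. u ^ (Suc p + q - 1 - s) * v ^ s) = u * (\<Sum>s\<in>{q..<p}. u ^ (p + q - 1 - s) * v ^ s)"
    unfolding sum_distrib_left
  proof (rule sum.cong[OF refl])
    fix s assume "s \<in> {q..<p}"
    then have "Suc p + q - 1 - s = Suc (p + q - 1 - s)" by auto
    then show "u ^ (Suc p + q - 1 - s) * v ^ s = u * (u ^ (p + q - 1 - s) * v ^ s)"
      by (simp add: mult.assoc)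
  qed
  then have *: "(\<Sum>s\<in>{q..<Suc p}. u ^ (Suc p + q - 1 - s) * v ^ s)
      = u * (\<Sum>s\<in>{q..<p}. u ^ (p + q - 1 - s) * v ^ s) + u ^ q * v ^ p"
    using step by simp
  have "u ^ Suc p * v ^ q - v ^ Suc p * u ^ q = u * (u ^ p * v ^ q - v ^ p * u ^ q) + (u - v) * (u ^ q * v ^ p)"
    by (simp add: algebra_simps)
  then show ?case unfolding * step.IH by (simp add: algebra_simps)
qed simp

text \<open>What is used later is the degree bound in \<open>v\<close> alone. The coefficients
  depend only on \<open>u\<close>, a variable that the rest of a run no longer touches.\<close>

lemma power_alternating_quotient:
  obtains \<kappa> :: "nat \<Rightarrow> rat \<Rightarrow> rat" where
    "\<And>u v. u \<noteq> v \<Longrightarrow> (u ^ p * v ^ q - v ^ p * u ^ q) / (u - v) = (\<Sum>s<max p q. \<kappa> s u * v ^ s)"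
proof -
  define \<kappa> :: "nat \<Rightarrow> rat \<Rightarrow> rat" where
    "\<kappa> s u = (if s < min p q then 0 else (if q \<le> p then 1 else - 1) * u ^ (p + q - 1 - s))" for s u
  have "(u ^ p * v ^ q - v ^ p * u ^ q) / (u - v) = (\<Sum>s<max p q. \<kappa> s u * v ^ s)" if "u \<noteq> v" for u v
  proof -
    have "(\<Sum>s<max p q. \<kappa> s u * v ^ s) = (\<Sum>s\<in>{min p q..<max p q}. \<kappa> s u * v ^ s)"
      by (rule sum.mono_neutral_right) (auto simp: \<kappa>_def)
    also have "\<dots> = (if q \<le> p then 1 else - 1) * (\<Sum>s\<in>{min p q..<max p q}. u ^ (p + q - 1 - s) * v ^ s)"
      unfolding sum_distrib_left by (intro sum.cong) (auto simp: \<kappa>_def)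
    also have "\<dots> = (u ^ p * v ^ q - v ^ p * u ^ q) / (u - v)"
    proof (cases "q \<le> p")
      case True
      then show ?thesis using power_alternating_sum[OF True, of u v] that by simp
    next
      case False
      then have "(u - v) * (\<Sum>s\<in>{p..<q}. u ^ (p + q - 1 - s) * v ^ s) = - (u ^ p * v ^ q - v ^ p * u ^ q)"
        using power_alternating_sum[of p q u v] by (simp add: add.commute mult.commute)
      then show ?thesis using False that by (simp add: field_simps)
    qed
    finally show ?thesis ..
  qed
  then show ?thesis using that by blast
qed

text \<open>Each \<open>dd\<^sub>j\<close> leaves degree at most \<open>n - j - 2\<close> in \<open>x\<^sub>j\<^sub>+\<^sub>1\<close>, so no degree is left at the last step.\<close>

lemma dds_low_degree_eq_0:
  assumes "i \<le> n" "sym_on i n g" "b i < n - i" "\<forall>j. i < j \<and> j \<le> n \<longrightarrow> b j \<le> n - j"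
  shows "dds [i..<n] (\<lambda>x. g x * (\<Prod>j=i..n. co x j ^ b j)) = (\<lambda>_. 0)"
  using assms
proof (induction "n - i" arbitrary: i g b)
  case (Suc k)
  then have i: "i < n" by simp
  obtain \<kappa> :: "nat \<Rightarrow> rat \<Rightarrow> rat" where \<kappa>: "\<And>u v. u \<noteq> v \<Longrightarrow>
      (u ^ b i * v ^ b (Suc i) - v ^ b i * u ^ b (Suc i)) / (u - v) = (\<Sum>s<max (b i) (b (Suc i)). \<kappa> s u * v ^ s)"
    using power_alternating_quotient[of "b i" "b (Suc i)"] by blast
  let ?R = "\<lambda>x. \<Prod>j=Suc (Suc i)..n. co x j ^ b j"
  have split: "(\<Prod>j=i..n. co x j ^ c j) = co x i ^ c i * co x (Suc i) ^ c (Suc i) * (\<Prod>j=Suc (Suc i)..n. co x j ^ c j)"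
    for c x using i by (simp add: prod.atLeast_Suc_atMost mult.assoc)
  have R: "?R (sw i x) = ?R x" for x by (intro prod.cong) (auto simp: co_sw)
  have "dd i (\<lambda>x. g x * (\<Prod>j=i..n. co x j ^ b j))
      = (\<lambda>x. \<Sum>s<max (b i) (b (Suc i)). (g x * \<kappa> s (co x i)) * (\<Prod>j=Suc i..n. co x j ^ (b(Suc i := s)) j))"
  proof
    fix x
    let ?u = "co x i" and ?v = "co x (Suc i)"
    have "dd i (\<lambda>x. g x * (\<Prod>j=i..n. co x j ^ b j)) x
       = g x * ?R x * ((?u ^ b i * ?v ^ b (Suc i) - ?v ^ b i * ?u ^ b (Suc i)) / (?u - ?v))"
      unfolding dd_def split R using sym_onD[OF Suc.prems(2) order_refl i]
      by (simp add: co_sw algebra_simps)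
    also have "\<dots> = (\<Sum>s<max (b i) (b (Suc i)). g x * ?R x * (\<kappa> s ?u * ?v ^ s))"
      by (subst \<kappa>) (simp_all add: sum_distrib_left)
    also have "\<dots> = (\<Sum>s<max (b i) (b (Suc i)). (g x * \<kappa> s ?u) * (\<Prod>j=Suc i..n. co x j ^ (b(Suc i := s)) j))"
      using i by (simp add: prod.atLeast_Suc_atMost[of "Suc i"] mult_ac)
    finally show "dd i (\<lambda>x. g x * (\<Prod>j=i..n. co x j ^ b j)) x = \<dots>" .
  qed
  moreover have "dds [Suc i..<n] (\<lambda>x. (g x * \<kappa> s (co x i)) * (\<Prod>j=Suc i..n. co x j ^ (b(Suc i := s)) j)) = (\<lambda>_. 0)"
    if s: "s < max (b i) (b (Suc i))" for s
  proof (rule Suc.hyps(1))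
    show "k = n - Suc i" using Suc.hyps(2) by simp
    show "sym_on (Suc i) n (\<lambda>x. g x * \<kappa> s (co x i))"
      using Suc.prems(2) by (auto simp: sym_on_def co_sw)
    have "b (Suc i) \<le> n - Suc i" using Suc.prems(4) i by simp
    then show "(b(Suc i := s)) (Suc i) < n - Suc i" using s Suc.prems(3) by auto
  qed (use i Suc.prems(4) in auto)
  ultimately show ?case
    using i by (simp add: upt_conv_Cons dds_sum)
qed simp

text \<open>Leibniz rule: \<open>dd i\<close> of \<open>g\<close> times the \<open>q\<close>-th
  power of \<open>x\<^sub>i\<^sub>+\<^sub>1\<close> is the \<open>q\<close>-th power of
  \<open>x\<^sub>i\<close> times \<open>dd i g\<close>, minus terms of degree below
  \<open>q \<le> n - Suc i\<close> in \<open>x\<^sub>i\<^sub>+\<^sub>1\<close>. The rest of the run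
  kills these by \<open>dds_low_degree_eq_0\<close>, so the monomial merely moves down by one
  variable.\<close>

lemma dds_monomial_shift:
  assumes "i \<le> n" "sym_on (Suc i) n g" "\<forall>j. i < j \<and> j \<le> n \<longrightarrow> b j \<le> n - j"
  shows "dds [i..<n] (\<lambda>x. g x * (\<Prod>j=Suc i..n. co x j ^ b j))
       = (\<lambda>x. dds [i..<n] g x * (\<Prod>j=i..<n. co x j ^ b (Suc j)))"
  using assms
proof (induction "n - i" arbitrary: i g)
  case (Suc k)
  then have i: "i < n" by simp
  define q where "q = b (Suc i)"
  let ?R = "\<lambda>x. \<Prod>j=Suc (Suc i)..n. co x j ^ b j"
  let ?g = "\<lambda>x. co x i ^ q * dd i g x"
  have R: "?R (sw i x) = ?R x" for x by (intro prod.cong) (auto simp: co_sw)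
  have A: "dd i (\<lambda>x. g x * (\<Prod>j=Suc i..n. co x j ^ b j))
      = (\<lambda>x. ?g x * ?R x - (\<Sum>s<q. (g x * co x i ^ (q - 1 - s)) * (\<Prod>j=Suc i..n. co x j ^ (b(Suc i := s)) j)))"
  proof
    fix x
    let ?u = "co x i" and ?v = "co x (Suc i)"
    have "(?u ^ q - ?v ^ q) / (?u - ?v) = (\<Sum>s<q. ?u ^ (q - 1 - s) * ?v ^ s)"
      using power_alternating_sum[of 0 q ?u ?v] by (simp add: lessThan_atLeast0)
    then have eq: "g x * ?R x * ((?u ^ q - ?v ^ q) / (?u - ?v))
        = (\<Sum>s<q. (g x * co x i ^ (q - 1 - s)) * (\<Prod>j=Suc i..n. co x j ^ (b(Suc i := s)) j))"
      using i by (simp add: prod.atLeast_Suc_atMost[of "Suc i"] sum_distrib_left mult_ac)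
    have "dd i (\<lambda>x. g x * (\<Prod>j=Suc i..n. co x j ^ b j)) x
        = (g x * ?v ^ q - g (sw i x) * ?u ^ q) / (?u - ?v) * ?R x"
      using i by (simp add: dd_def prod.atLeast_Suc_atMost[of "Suc i"] R q_def[symmetric]) (simp add: co_sw algebra_simps)
    also have "\<dots> = ?g x * ?R x - g x * ?R x * ((?u ^ q - ?v ^ q) / (?u - ?v))"
      by (simp add: dd_def diff_divide_distrib algebra_simps)
    finally show "dd i (\<lambda>x. g x * (\<Prod>j=Suc i..n. co x j ^ b j)) x
      = ?g x * ?R x - (\<Sum>s<q. (g x * co x i ^ (q - 1 - s)) * (\<Prod>j=Suc i..n. co x j ^ (b(Suc i := s)) j))"
      unfolding eq .
  qed
  have B: "dds [Suc i..<n] (\<lambda>x. (g x * co x i ^ (q - 1 - s)) * (\<Prod>j=Suc i..n. co x j ^ (b(Suc i := s)) j)) = (\<lambda>_. 0)"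
    if s: "s < q" for s
  proof (rule dds_low_degree_eq_0)
    show "sym_on (Suc i) n (\<lambda>x. g x * co x i ^ (q - 1 - s))"
      using Suc.prems(2) by (auto simp: sym_on_def co_sw)
    have "q \<le> n - Suc i" using Suc.prems(3) i by (simp add: q_def)
    then show "(b(Suc i := s)) (Suc i) < n - Suc i" using s by simp
  qed (use i Suc.prems(3) in auto)
  have C: "dds [Suc i..<n] (\<lambda>x. ?g x * ?R x)
      = (\<lambda>x. dds [Suc i..<n] ?g x * (\<Prod>j=Suc i..<n. co x j ^ b (Suc j)))"
  proof (rule Suc.hyps(1))
    show "k = n - Suc i" using Suc.hyps(2) by simp
    show "sym_on (Suc (Suc i)) n ?g"
      using Suc.prems(2) by (auto simp: sym_on_def co_sw dd_def sw_commute [symmetric])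
  qed (use i Suc.prems(3) in auto)
  have D: "dds [Suc i..<n] ?g = (\<lambda>x. co x i ^ q * dds [Suc i..<n] (dd i g) x)"
    by (rule dds_mult_sym[of "Suc i" n]) (auto simp: sym_on_def co_sw)
  have E: "(\<Sum>s<q. dds [Suc i..<n] (\<lambda>x. (g x * co x i ^ (q - 1 - s)) * (\<Prod>j=Suc i..n. co x j ^ (b(Suc i := s)) j)) x) = 0" for x
    by (rule sum.neutral, rule ballI, rule fun_cong[OF B]) simp
  have "dds [i..<n] (\<lambda>x. g x * (\<Prod>j=Suc i..n. co x j ^ b j))
      = dds [Suc i..<n] (dd i (\<lambda>x. g x * (\<Prod>j=Suc i..n. co x j ^ b j)))"
    using i by (simp add: upt_conv_Cons)
  also have "\<dots> = (\<lambda>x. co x i ^ q * dds [Suc i..<n] (dd i g) x * (\<Prod>j=Suc i..<n. co x j ^ b (Suc j)))"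
    unfolding A dds_diff dds_sum E C D by simp
  also have "\<dots> = (\<lambda>x. dds [i..<n] g x * (\<Prod>j=i..<n. co x j ^ b (Suc j)))"
    using i by (simp add: upt_conv_Cons prod.atLeast_Suc_lessThan q_def fun_eq_iff mult_ac)
  finally show ?case .
qed simp

section \<open>Monomials passing through \<open>Om\<close>\<close>

definition lmono :: "nat \<Rightarrow> nat list \<Rightarrow> gfun" where
  "lmono i d x = (\<Prod>j<length d. co x (i + j) ^ (d ! j))"

lemma lmono_Nil [simp]: "lmono i [] = (\<lambda>x. 1)"
  by (simp add: lmono_def fun_eq_iff)

lemma lmono_Cons: "lmono i (c # d) x = co x i ^ c * lmono (Suc i) d x"
  by (simp add: lmono_def prod.lessThan_Suc_shift del: prod.lessThan_Suc)

lemma sym_on_Om: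
  assumes "sym_on 1 n f"
  shows "sym_on 1 n (Om n (\<lambda>x. co x 1 ^ c * f x))"
  unfolding Om_def
  by (rule sym_on_dds_upt) (use assms in \<open>auto simp: sym_on_def tau_def fl_sw_commute co_sw co_fl\<close>)

text \<open>Once the power of \<open>x\<^sub>1\<close> is joined to \<open>f\<close>, the remaining
  monomial starts at \<open>x\<^sub>2\<close> and is unaffected by \<open>tau\<close>. The run moves
  it down by one variable, so the next \<open>Om\<close> again finds its exponent at
  \<open>x\<^sub>1\<close>. The entry \<open>d ! j\<close> sits at variable \<open>j + 2\<close>,
  whence the bound.\<close>

lemma Om_monomial_shift:
  assumes "sym_on 1 n f" "length d < n" "\<forall>j<length d. d ! j + j + 2 \<le> n"
  shows "Om n (\<lambda>x. f x * lmono 1 (c # d) x) = (\<lambda>x. Om n (\<lambda>x. co x 1 ^ c * f x) x * lmono 1 d x)"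
proof -
  \<comment> \<open>For \<open>j \<ge> 2\<close> this is the exponent of variable \<open>j\<close>
    in \<open>lmono 2 d\<close>, continued by zeros; smaller \<open>j\<close> never occur
    below.\<close>
  define b where "b j = (if j - 2 < length d then d ! (j - 2) else 0)" for j
  have *: "lmono i d x = (\<Prod>j=i..<i + n - 1. co x j ^ b (j + 2 - i))" for i x
  proof -
    have "(\<Prod>j=i..<i + n - 1. co x j ^ b (j + 2 - i)) = (\<Prod>j<n - 1. co x (i + j) ^ b (j + 2))"
      by (rule prod.reindex_bij_witness[of _ "\<lambda>j. i + j" "\<lambda>j. j - i"]) (use assms(2) in \<open>auto simp: Suc_diff_le\<close>)
    also have "\<dots> = (\<Prod>j<length d. co x (i + j) ^ b (j + 2))"
      by (rule prod.mono_neutral_right) (use assms(2) in \<open>auto simp: b_def\<close>)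
    finally show ?thesis by (simp add: lmono_def b_def)
  qed
  have 1: "lmono 1 d x = (\<Prod>j=1..<n. co x j ^ b (Suc j))" for x
    using *[of 1 x] by simp
  have 2: "lmono 2 d x = (\<Prod>j=Suc 1..n. co x j ^ b j)" for x
    using *[of 2 x] assms(2) by (simp add: numeral_2_eq_2 flip: atLeastLessThanSuc_atLeastAtMost)
  define g where "g = tau (\<lambda>x. co x 1 ^ c * f x)"
  have "lmono 2 d (fl 1 x) = lmono 2 d x" for x
    unfolding lmono_def by (intro prod.cong) (auto simp: co_fl)
  then have "tau (\<lambda>x. f x * lmono 1 (c # d) x) = (\<lambda>x. g x * (\<Prod>j=Suc 1..n. co x j ^ b j))"
    unfolding 2 [symmetric] by (simp add: tau_def g_def lmono_Cons numeral_2_eq_2 fun_eq_iff)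
  moreover have "dds [1..<n] (\<lambda>x. g x * (\<Prod>j=Suc 1..n. co x j ^ b j))
      = (\<lambda>x. dds [1..<n] g x * (\<Prod>j=1..<n. co x j ^ b (Suc j)))"
  proof (rule dds_monomial_shift)
    show "1 \<le> n" using assms(2) by simp
    show "sym_on (Suc 1) n g"
      using assms(1) by (auto simp: sym_on_def g_def tau_def fl_sw_commute co_sw co_fl)
    show "\<forall>j. 1 < j \<and> j \<le> n \<longrightarrow> b j \<le> n - j"
    proof (intro allI impI)
      fix j assume j: "1 < j \<and> j \<le> n"
      have "d ! (j - 2) + (j - 2) + 2 \<le> n" if "j - 2 < length d" using assms(3) that by blast
      then show "b j \<le> n - j" using j by (auto simp: b_def)
    qed
  qed
  ultimately show ?thesis
    unfolding Om_def 1 by (simp only: g_def)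
qed

text \<open>Of the reduced words of the longest permutation of \<open>k\<close> variables from
  \<open>i\<close> on, this one ends in a full run, which \<open>Omc_dds_upt\<close> absorbs, and
  begins with the word for the variables after the first, which matches Laplace expansion along the
  first column.\<close>

fun wd :: "nat \<Rightarrow> nat \<Rightarrow> nat list" where
  "wd i 0 = []"
| "wd i (Suc k) = wd (Suc i) k @ [i..<i + k]"

lemma map_Suc_wd: "map Suc (wd i k) = wd (Suc i) k"
  by (induction k arbitrary: i) (auto simp: map_Suc_upt)

lemma set_wd: "set (wd i k) \<subseteq> {i..<i + k - 1}"
  by (induction k arbitrary: i) (auto, force+)

text \<open>The word \<open>wd 1 r\<close> of the longest permutation is absorbed one run at a time into the \<open>Om\<close>'s.\<close>

lemma Omc_lmono:
  assumes "sym_on 1 n f" "length d \<le> n" "\<forall>j<length d. d ! j + j + 1 \<le> n"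
  shows "Omc n (length d) (dds (wd 1 (length d)) (\<lambda>x. f x * lmono 1 d x))
       = fold (\<lambda>c f. Om n (\<lambda>x. co x 1 ^ c * f x)) d f"
  using assms
proof (induction d arbitrary: f)
  case (Cons c d)
  let ?p = "\<lambda>x. f x * lmono 1 (c # d) x"
  have "Omc n (Suc (length d)) (dds (wd 1 (Suc (length d))) ?p)
      = Omc n (Suc (length d)) (dds [1..<Suc (length d)] (dds (wd 2 (length d)) ?p))"
    by (simp add: numeral_2_eq_2 del: upt_Suc)
  also have "\<dots> = Omc n (length d) (Om n (dds (map Suc (wd 1 (length d))) ?p))"
    using Cons.prems(2) by (subst Omc_dds_upt) (simp_all add: map_Suc_wd numeral_2_eq_2)
  also have "Om n (dds (map Suc (wd 1 (length d))) ?p) = dds (wd 1 (length d)) (Om n ?p)"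
    by (rule Om_dds_Suc) (use set_wd[of 1 "length d"] Cons.prems(2) in auto)
  also have "Om n ?p = (\<lambda>x. Om n (\<lambda>x. co x 1 ^ c * f x) x * lmono 1 d x)"
  proof (rule Om_monomial_shift)
    show "length d < n" using Cons.prems(2) by simp
    show "\<forall>j<length d. d ! j + j + 2 \<le> n" using Cons.prems(3) by fastforce
  qed (fact Cons.prems)
  also have "Omc n (length d) (dds (wd 1 (length d)) \<dots>)
      = fold (\<lambda>c f. Om n (\<lambda>x. co x 1 ^ c * f x)) d (Om n (\<lambda>x. co x 1 ^ c * f x))"
  proof (rule Cons.IH)
    show "sym_on 1 n (Om n (\<lambda>x. co x 1 ^ c * f x))" by (rule sym_on_Om) (fact Cons.prems)
    show "length d \<le> n" using Cons.prems(2) by simp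
    show "\<forall>j<length d. d ! j + j + 1 \<le> n" using Cons.prems(3) by fastforce
  qed
  finally show ?case by simp
qed simp

section \<open>Lagrange sums and bialternants\<close>

text \<open>Coset representatives: \<open>co x (i + k)\<close> is brought to place \<open>i\<close>
  and the entries before it move up by one.\<close>

primrec cyc :: "nat \<Rightarrow> nat \<Rightarrow> gpt \<Rightarrow> gpt" where
  "cyc i 0 x = x"
| "cyc i (Suc k) x = cyc i k (sw (i + k) x)"

lemma co_cyc: "co (cyc i k x) j = (if j = i then co x (i + k) else if i < j \<and> j \<le> i + k then co x (j - 1) else co x j)"
  by (induction k arbitrary: x) (auto simp: co_sw)

lemma fl_cyc: "fl i (cyc i k x) = cyc i k (fl (i + k) x)"
  by (rule gpt_eqI) (auto simp: co_fl co_cyc)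

lemma sw_cyc_commute: "l < k \<Longrightarrow> cyc i l (sw (i + k) x) = sw (i + k) (cyc i l x)"
  by (rule gpt_eqI) (auto simp: co_sw co_cyc)

lemma sym_on_cyc:
  assumes "sym_on i (i + k) f"
  shows "f (cyc i k x) = f x"
  using assms by (induction k arbitrary: x) (auto simp: sym_on_def)

text \<open>By symmetry of \<open>h\<close> a term depends only on which variable is brought to the
  front. In the induction, the last letter compares \<open>x\<close> with the swapped point
  \<open>y\<close>; for \<open>l < k\<close> the numerators at both points agree, and with A and B
  the differences of \<open>z l\<close> to \<open>z k\<close> and \<open>z (Suc k)\<close>, (1/A -
  1/B)/(B - A) = 1/(AB) supplies the new factor. The terms \<open>k\<close> and \<open>Suc k\<close>
  come from one point each.\<close>

lemma dds_upt_lagrange: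
  assumes "sym_on (Suc i) (i + k) h"
  shows "dds [i..<i + k] h x
    = (\<Sum>l\<le>k. h (cyc i l x) / (\<Prod>j\<in>{..k} - {l}. co x (i + l) - co x (i + j)))"
  using assms
proof (induction k arbitrary: x)
  case (Suc k)
  define y where "y = sw (i + k) x"
  define z where "z j = co x (i + j)" for j
  define P where "P l = (\<Prod>j\<in>{..<k} - {l}. z l - z j)" for l
  have z: "z l - z j \<noteq> 0" if "l \<noteq> j" for l j using that by (simp add: z_def)
  have IH: "dds [i..<i + k] h u = (\<Sum>l\<le>k. h (cyc i l u) / (\<Prod>j\<in>{..k} - {l}. co u (i + l) - co u (i + j)))" for u
    by (rule Suc.IH) (use Suc.prems in \<open>simp add: sym_on_def\<close>)
  have yz: "co y (i + j) = (if j = k then z (Suc k) else if j = Suc k then z k else z j)" for j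
    by (auto simp: y_def co_sw z_def)
  have set1: "{..k} - {l} = insert k ({..<k} - {l})" if "l < k" for l using that by auto
  have set2: "{..k} - {k} = {..<k} - {k}" "{..Suc k} - {Suc k} = insert k ({..<k} - {Suc k})"
    "{..Suc k} - {k} = insert (Suc k) ({..<k} - {k})" by auto
  have set3: "{..Suc k} - {l} = insert (Suc k) (insert k ({..<k} - {l}))" if "l < k" for l using that by auto
  have hx: "dds [i..<i + k] h x = (\<Sum>l<k. h (cyc i l x) / ((z l - z k) * P l)) + h (cyc i k x) / P k"
  proof -
    have "(\<Prod>j\<in>{..k} - {l}. z l - z j) = (z l - z k) * P l" if "l < k" for l
      unfolding set1[OF that] P_def using that by simp
    then show ?thesis
      unfolding IH z_def [symmetric] lessThan_Suc_atMost [symmetric] sum.lessThan_Suc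
      by (simp add: lessThan_Suc_atMost set2 P_def)
  qed
  have "P (Suc k) = (\<Prod>j\<in>{..<k}. z (Suc k) - z j)" unfolding P_def by (rule prod.cong) auto
  moreover have "(\<Prod>j\<in>{..k} - {l}. co y (i + l) - co y (i + j)) = (z l - z (Suc k)) * P l" if "l < k" for l
  proof -
    have "(\<Prod>j\<in>{..<k} - {l}. co y (i + l) - co y (i + j)) = P l"
      unfolding P_def by (rule prod.cong) (use that in \<open>auto simp: yz\<close>)
    then show ?thesis unfolding set1[OF that] using that by (simp add: yz)
  qed
  moreover have "(\<Prod>j\<in>{..k} - {k}. co y (i + k) - co y (i + j)) = (\<Prod>j\<in>{..<k}. z (Suc k) - z j)"
    by (rule prod.cong) (auto simp: yz)
  moreover have "h (cyc i l y) = h (cyc i l x)" if "l < k" for l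
    using Suc.prems that unfolding y_def sw_cyc_commute[OF that] by (intro sym_onD[of "Suc i" "i + Suc k"]) auto
  ultimately have hy: "dds [i..<i + k] h y
      = (\<Sum>l<k. h (cyc i l x) / ((z l - z (Suc k)) * P l)) + h (cyc i (Suc k) x) / P (Suc k)"
    unfolding IH lessThan_Suc_atMost [symmetric] sum.lessThan_Suc
    by (simp add: lessThan_Suc_atMost) (simp add: y_def)
  have tm: "(h (cyc i l x) / ((z l - z k) * P l) - h (cyc i l x) / ((z l - z (Suc k)) * P l)) / (z k - z (Suc k))
      = h (cyc i l x) / (\<Prod>j\<in>{..Suc k} - {l}. z l - z j)" if "l < k" for l
  proof -
    have prod: "(\<Prod>j\<in>{..Suc k} - {l}. z l - z j) = (z l - z (Suc k)) * ((z l - z k) * P l)"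
      unfolding set3[OF that] P_def using that by simp
    have gen: "(h' / (A * p) - h' / (B * p)) / (B - A) = h' / (B * (A * p))"
      if "A \<noteq> 0" "B \<noteq> 0" "B - A \<noteq> 0" for h' A B p :: rat
    proof -
      have "h' / (A * p) - h' / (B * p) = (B - A) * (h' / (B * (A * p)))"
        using that(1,2) by (simp add: divide_simps) (simp add: algebra_simps)
      then show ?thesis using that by simp
    qed
    have "z k - z (Suc k) = (z l - z (Suc k)) - (z l - z k)" by simp
    then show ?thesis unfolding prod using gen[of "z l - z k" "z l - z (Suc k)"] that z by simp
  qed
  have P0: "(\<Prod>j\<in>{..Suc k} - {k}. z k - z j) = (z k - z (Suc k)) * P k"
    unfolding set2 P_def by simp
  have P1: "(\<Prod>j\<in>{..Suc k} - {Suc k}. z (Suc k) - z j) = - (z k - z (Suc k)) * P (Suc k)"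
    unfolding set2 P_def by simp
  have "dds [i..<i + Suc k] h x = (dds [i..<i + k] h x - dds [i..<i + k] h y) / (z k - z (Suc k))"
    by (simp add: dd_def y_def z_def)
  also have "\<dots> = (\<Sum>l<k. (h (cyc i l x) / ((z l - z k) * P l) - h (cyc i l x) / ((z l - z (Suc k)) * P l)) / (z k - z (Suc k)))
      + h (cyc i k x) / P k / (z k - z (Suc k)) - h (cyc i (Suc k) x) / P (Suc k) / (z k - z (Suc k))"
    unfolding hx hy
  proof -
    have "(sum F S + a - (sum G S + b)) / d = (\<Sum>l\<in>S. (F l - G l) / d) + a / d - b / d"
      for F G :: "nat \<Rightarrow> rat" and S a b d
      by (simp only: sum_divide_distrib [symmetric] sum_subtractf) (simp add: diff_divide_distrib add_divide_distrib)
    then show "((\<Sum>l<k. h (cyc i l x) / ((z l - z k) * P l)) + h (cyc i k x) / P k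
        - ((\<Sum>l<k. h (cyc i l x) / ((z l - z (Suc k)) * P l)) + h (cyc i (Suc k) x) / P (Suc k))) / (z k - z (Suc k))
      = (\<Sum>l<k. (h (cyc i l x) / ((z l - z k) * P l) - h (cyc i l x) / ((z l - z (Suc k)) * P l)) / (z k - z (Suc k)))
        + h (cyc i k x) / P k / (z k - z (Suc k)) - h (cyc i (Suc k) x) / P (Suc k) / (z k - z (Suc k))" .
  qed
  also have "(\<Sum>l<k. (h (cyc i l x) / ((z l - z k) * P l) - h (cyc i l x) / ((z l - z (Suc k)) * P l)) / (z k - z (Suc k)))
      = (\<Sum>l<k. h (cyc i l x) / (\<Prod>j\<in>{..Suc k} - {l}. z l - z j))"
    by (rule sum.cong) (use tm in auto)
  also have "h (cyc i k x) / P k / (z k - z (Suc k)) = h (cyc i k x) / (\<Prod>j\<in>{..Suc k} - {k}. z k - z j)"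
    unfolding P0 by (simp add: mult.commute)
  also have "h (cyc i (Suc k) x) / P (Suc k) / (z k - z (Suc k))
      = - (h (cyc i (Suc k) x) / (\<Prod>j\<in>{..Suc k} - {Suc k}. z (Suc k) - z j))"
  proof -
    have "a / p / d = - (a / (- d * p))" for a p d :: rat by (simp add: mult.commute)
    then show ?thesis unfolding P1 .
  qed
  finally have fin: "dds [i..<i + Suc k] h x = (\<Sum>l<k. h (cyc i l x) / (\<Prod>j\<in>{..Suc k} - {l}. z l - z j))
      + h (cyc i k x) / (\<Prod>j\<in>{..Suc k} - {k}. z k - z j)
      - - (h (cyc i (Suc k) x) / (\<Prod>j\<in>{..Suc k} - {Suc k}. z (Suc k) - z j))" .
  have split: "(\<Sum>l\<le>Suc k. G l) = (\<Sum>l<k. G l) + G k - - G (Suc k)" for G :: "nat \<Rightarrow> rat"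
    by (simp flip: lessThan_Suc_atMost)
  show ?case unfolding fin split z_def ..
qed simp

text \<open>
  \<open>aop n (n - 1 - b)\<close> acts on the \<open>Q\<close>-tilde polynomials as \<open>2 (-1) ^ b\<close> times the fermionic
  annihilation operator of the part \<open>b > 0\<close>; for \<open>b = 0\<close> it is the sign \<open>(-1) ^ length\<close>.
\<close>

definition aop :: "nat \<Rightarrow> nat \<Rightarrow> gfun \<Rightarrow> gfun" where
  "aop n c f x = (\<Sum>m\<in>{1..n}. co x m ^ c * f (fl m x) / (\<Prod>j\<in>{1..n} - {m}. co x m - co x j))"

text \<open>\<open>tau\<close> flips the variable that \<open>cyc\<close> has brought to the front.
  As \<open>f\<close> does not see the order of the variables, only the flip and the sign of the
  power of a negated variable remain.\<close>

lemma Om_eq_aop: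
  assumes "sym_on 1 n f" "1 \<le> n"
  shows "Om n (\<lambda>x. co x 1 ^ c * f x) = (\<lambda>x. (- 1) ^ c * aop n c f x)"
proof
  fix x
  obtain k where n: "n = 1 + k" using assms(2) by (metis le_Suc_ex)
  define h where "h = tau (\<lambda>x. co x 1 ^ c * f x)"
  have "sym_on (Suc 1) (1 + k) h"
    using assms(1) by (auto simp: sym_on_def h_def tau_def fl_sw_commute co_sw co_fl n)
  then have "Om n (\<lambda>x. co x 1 ^ c * f x) x
      = (\<Sum>l\<le>k. h (cyc 1 l x) / (\<Prod>j\<in>{..k} - {l}. co x (1 + l) - co x (1 + j)))"
    unfolding Om_def n h_def by (rule dds_upt_lagrange)
  also have "\<dots> = (\<Sum>m\<in>{1..n}. (- 1) ^ c * (co x m ^ c * f (fl m x) / (\<Prod>j\<in>{1..n} - {m}. co x m - co x j)))"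
  proof (rule sum.reindex_bij_witness[of _ "\<lambda>m. m - 1" "\<lambda>l. 1 + l"])
    fix l assume l: "l \<in> {..k}"
    have "h (cyc 1 l x) = (- co x (1 + l)) ^ c * f (cyc 1 l (fl (1 + l) x))"
      by (simp add: h_def tau_def co_fl co_cyc fl_cyc)
    also have "f (cyc 1 l (fl (1 + l) x)) = f (fl (1 + l) x)"
      by (rule sym_on_cyc) (use assms(1) l in \<open>auto simp: n sym_on_def\<close>)
    also have "(- co x (1 + l)) ^ c = (- 1) ^ c * co x (1 + l) ^ c" by (rule power_minus)
    finally have 1: "h (cyc 1 l x) = (- 1) ^ c * co x (1 + l) ^ c * f (fl (1 + l) x)" .
    have "(\<Prod>j\<in>{1..n} - {1 + l}. co x (1 + l) - co x j) = (\<Prod>j\<in>{..k} - {l}. co x (1 + l) - co x (1 + j))"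
      by (rule prod.reindex_bij_witness[of _ "\<lambda>l. 1 + l" "\<lambda>m. m - 1"]) (auto simp: n)
    then show "(- 1) ^ c * (co x (1 + l) ^ c * f (fl (1 + l) x) / (\<Prod>j\<in>{1..n} - {1 + l}. co x (1 + l) - co x j))
        = h (cyc 1 l x) / (\<Prod>j\<in>{..k} - {l}. co x (1 + l) - co x (1 + j))"
      unfolding 1 by simp
  qed (auto simp: n)
  also have "\<dots> = (- 1) ^ c * aop n c f x"
    by (simp add: aop_def sum_distrib_left)
  finally show "Om n (\<lambda>x. co x 1 ^ c * f x) x = (- 1) ^ c * aop n c f x" .
qed

text \<open>Multiplying the numerators by \<open>z m - z a\<close> deletes the node
  \<open>a\<close>, so \<open>F M (Suc p) = z a * F M p + F (M - {a}) p\<close> for every node. The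
  last term does not depend on \<open>a\<close> by induction, so comparing two nodes gives
  \<open>F M p = 0\<close> below the top degree; the recursion then yields 1 at the top.\<close>

lemma lagrange_power_sum:
  fixes z :: "'b \<Rightarrow> 'a::field"
  assumes "finite M" "inj_on z M" "p < card M"
  shows "(\<Sum>m\<in>M. z m ^ p / (\<Prod>j\<in>M - {m}. z m - z j)) = (if Suc p = card M then 1 else 0)"
  using assms
proof (induction "card M" arbitrary: M p)
  case (Suc k)
  define F where "F M p = (\<Sum>m\<in>M. z m ^ p / (\<Prod>j\<in>M - {m}. z m - z j))" for M p
  note [simp] = \<open>finite M\<close>
  have rec: "F M (Suc p) = z a * F M p + F (M - {a}) p" if a: "a \<in> M" for a p
  proof -
    have "F M (Suc p) - z a * F M p = (\<Sum>m\<in>M. z m ^ p * (z m - z a) / (\<Prod>j\<in>M - {m}. z m - z j))"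
      unfolding F_def sum_distrib_left sum_subtractf [symmetric]
      by (rule sum.cong) (simp_all add: algebra_simps diff_divide_distrib)
    also have "\<dots> = (\<Sum>m\<in>M - {a}. z m ^ p * (z m - z a) / (\<Prod>j\<in>M - {m}. z m - z j))"
      by (rule sum.mono_neutral_right) auto
    also have "\<dots> = F (M - {a}) p"
      unfolding F_def
    proof (rule sum.cong[OF refl])
      fix m assume m: "m \<in> M - {a}"
      have "(\<Prod>j\<in>M - {m}. z m - z j) = (z m - z a) * (\<Prod>j\<in>M - {m} - {a}. z m - z j)"
        by (rule prod.remove) (use a m in auto)
      moreover have "M - {m} - {a} = M - {a} - {m}" by auto
      moreover have "z m - z a \<noteq> 0" using m a Suc.prems(2) by (auto simp: inj_on_def)
      ultimately show "z m ^ p * (z m - z a) / (\<Prod>j\<in>M - {m}. z m - z j) = z m ^ p / (\<Prod>j\<in>M - {a} - {m}. z m - z j)"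
        by simp
    qed
    finally show ?thesis by (simp add: algebra_simps)
  qed
  have sub: "F (M - {a}) p = (if Suc p = k then 1 else 0)" if "a \<in> M" "p < k" for a p
  proof -
    have "inj_on z (M - {a})" by (rule inj_on_subset[OF Suc.prems(2)]) auto
    moreover have "k = card (M - {a})" using Suc.hyps(2) that by simp
    ultimately show ?thesis unfolding F_def using Suc.hyps(1)[of "M - {a}" p] that by simp
  qed
  have small: "F M p = 0" if p: "p < k" for p
  proof -
    have "1 < card M" using p Suc.hyps(2) by simp
    then obtain a b where ab: "a \<in> M" "b \<in> M" "a \<noteq> b"
      by (metis One_nat_def card_le_Suc0_iff_eq linorder_not_le \<open>finite M\<close>)
    have "z a * F M p = z b * F M p"
      using trans[OF rec[OF ab(1), of p, symmetric] rec[OF ab(2)]]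
      unfolding sub[OF ab(1) p] sub[OF ab(2) p] by (rule add_right_imp_eq)
    moreover have "z a \<noteq> z b" using ab Suc.prems(2) by (auto simp: inj_on_def)
    ultimately show ?thesis by simp
  qed
  have "F M k = 1"
  proof (cases k)
    case 0
    then obtain a where "M = {a}" using Suc.hyps(2) by (metis card_1_singletonE One_nat_def)
    then show ?thesis using 0 by (simp add: F_def)
  next
    case (Suc l)
    obtain a where "a \<in> M" using Suc.hyps(2) by (metis card_eq_0_iff ex_in_conv nat.distinct(1))
    then show ?thesis using rec[of a l] small[of l] sub[of a l] Suc by simp
  qed
  then have "F M p = (if Suc p = card M then 1 else 0)"
    using small[of p] Suc.prems(3) unfolding Suc.hyps(2) [symmetric] by (cases "p = k") simp_all
  then show ?case unfolding F_def .
qed simp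

section \<open>Vandermonde determinants and bialternants\<close>

definition vdet :: "(nat \<Rightarrow> rat) \<Rightarrow> nat list \<Rightarrow> rat" where
  "vdet z d = det (mat (length d) (length d) (\<lambda>(a, b). z a ^ (d ! b)))"

definition staircase :: "nat \<Rightarrow> nat list" where
  "staircase m = map (\<lambda>j. m - 1 - j) [0..<m]"

lemma length_staircase [simp]: "length (staircase m) = m"
  by (simp add: staircase_def)

lemma staircase_Suc: "staircase (Suc m) = m # staircase m"
  by (rule nth_equalityI) (auto simp: staircase_def nth_Cons' simp del: upt_Suc)

definition skip :: "nat \<Rightarrow> (nat \<Rightarrow> rat) \<Rightarrow> nat \<Rightarrow> rat" where
  "skip l z a = z (if a < l then a else Suc a)"

lemma cofactor_vdet:
  "l \<le> length d \<Longrightarrow> cofactor (mat (Suc (length d)) (Suc (length d)) (\<lambda>(a, b). z a ^ ((c # d) ! b))) l 0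
     = (- 1) ^ l * vdet (skip l z) d"
  unfolding cofactor_def vdet_def mat_delete_def
  by (intro arg_cong2[where f = "(*)"] arg_cong[where f = det] eq_matI) (auto simp: skip_def)

lemma vdet_Cons: "vdet z (c # d) = (\<Sum>l\<le>length d. z l ^ c * ((- 1) ^ l * vdet (skip l z) d))"
proof -
  let ?A = "mat (Suc (length d)) (Suc (length d)) (\<lambda>(a, b). z a ^ ((c # d) ! b))"
  have "vdet z (c # d) = (\<Sum>l<Suc (length d). ?A $$ (l, 0) * cofactor ?A l 0)"
    unfolding vdet_def by (simp only: length_Cons) (rule laplace_expansion_column[of _ _ 0], auto)
  also have "\<dots> = (\<Sum>l\<le>length d. z l ^ c * ((- 1) ^ l * vdet (skip l z) d))"
    by (rule sum.cong) (auto simp: cofactor_vdet)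
  finally show ?thesis .
qed

text \<open>By \<open>lagrange_power_sum\<close> the Lagrange weights \<open>v\<close>, as a row
  vector, multiply the Vandermonde matrix to the first unit vector. Multiplying by the adjugate
  identifies \<open>v\<close> times the determinant with the cofactors of the first column.
  Invertibility is not presupposed here; \<open>vdet_staircase_neq_0\<close> deduces it from this
  identity.\<close>

lemma vdet_staircase_skip:
  assumes "inj_on z {..m}" "l \<le> m"
  shows "(- 1) ^ l * vdet (skip l z) (staircase m) = vdet z (staircase (Suc m)) / (\<Prod>j\<in>{..m} - {l}. z l - z j)"
proof -
  let ?n = "Suc m"
  define A where "A = mat ?n ?n (\<lambda>(a, b). z a ^ (staircase ?n ! b))"
  define v where "v a = 1 / (\<Prod>j\<in>{..m} - {a}. z a - z j)" for a
  have A: "A \<in> carrier_mat ?n ?n" by (simp add: A_def)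
  note adj = adj_mat[OF A]
  have vA: "(\<Sum>a<?n. v a * A $$ (a, b)) = (if b = 0 then 1 else 0)" if "b < ?n" for b
  proof -
    have "staircase ?n ! b = m - b" using that by (simp add: staircase_def del: upt_Suc)
    then have "(\<Sum>a<?n. v a * A $$ (a, b)) = (\<Sum>a\<in>{..m}. z a ^ (m - b) / (\<Prod>j\<in>{..m} - {a}. z a - z j))"
      using that by (intro sum.cong) (auto simp: A_def v_def)
    also have "\<dots> = (if Suc (m - b) = card {..m} then 1 else 0)"
      by (rule lagrange_power_sum) (use assms in auto)
    finally show ?thesis using that by auto
  qed
  have "vdet z (staircase ?n) * v l = (\<Sum>a<?n. v a * (A * adj_mat A) $$ (a, l))"
    using assms(2) unfolding adj(2) by (simp add: vdet_def A_def if_distrib cong: if_cong)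
  also have "\<dots> = (\<Sum>a<?n. v a * (\<Sum>b<?n. A $$ (a, b) * adj_mat A $$ (b, l)))"
    using A adj(1) assms(2) by (intro sum.cong) (auto simp: scalar_prod_def lessThan_atLeast0)
  also have "\<dots> = (\<Sum>b<?n. (\<Sum>a<?n. v a * A $$ (a, b)) * adj_mat A $$ (b, l))"
    unfolding sum_distrib_left sum_distrib_right by (subst sum.swap) (simp add: mult.assoc)
  also have "\<dots> = (\<Sum>b<?n. if b = 0 then adj_mat A $$ (b, l) else 0)"
    by (rule sum.cong) (simp_all add: vA del: sum.lessThan_Suc)
  also have "\<dots> = cofactor A l 0"
    using A assms(2) by (simp add: adj_mat_def)
  also have "\<dots> = (- 1) ^ l * vdet (skip l z) (staircase m)"
    using cofactor_vdet[of l "staircase m" z m] assms(2) by (simp add: A_def staircase_Suc)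
  finally show ?thesis by (simp add: v_def)
qed

lemma inj_on_skip: "inj_on z {..m} \<Longrightarrow> inj_on (skip l z) {..<m}"
proof (rule inj_onI)
  fix a b assume inj: "inj_on z {..m}" and ab: "a \<in> {..<m}" "b \<in> {..<m}" "skip l z a = skip l z b"
  have "(if a < l then a else Suc a) = (if b < l then b else Suc b)"
    by (rule inj_onD[OF inj]) (use ab in \<open>auto simp: skip_def\<close>)
  then show "a = b" by (auto split: if_splits)
qed

lemma vdet_staircase_neq_0: "inj_on z {..<m} \<Longrightarrow> vdet z (staircase m) \<noteq> 0"
proof (induction m arbitrary: z)
  case 0
  then show ?case by (simp add: vdet_def staircase_def)
next
  case (Suc m)
  have "vdet (skip 0 z) (staircase m) \<noteq> 0"
    by (rule Suc.IH, rule inj_on_skip) (use Suc.prems in \<open>simp add: lessThan_Suc_atMost\<close>)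
  then show ?case
    using vdet_staircase_skip[of z m 0] Suc.prems by (auto simp: lessThan_Suc_atMost)
qed

lemma sym_on_dds_wd: "sym_on i (i + k - 1) (dds (wd i k) f)"
proof (induction k arbitrary: i f)
  case (Suc k)
  show ?case using sym_on_dds_upt[of i "i + k"] Suc[of "Suc i"] by simp
qed (auto simp: sym_on_def)

text \<open>Jacobi's bialternant formula, by Laplace expansion along the first column.\<close>

lemma dds_wd_lmono:
  "dds (wd i (length d)) (lmono i d) x * vdet (\<lambda>a. co x (i + a)) (staircase (length d))
    = vdet (\<lambda>a. co x (i + a)) d"
proof (induction d arbitrary: i x)
  case Nil
  then show ?case by (simp add: vdet_def staircase_def)
next
  case (Cons c d)
  let ?k = "length d" and ?z = "\<lambda>a. co x (i + a)"
  define y where "y = dds (wd (Suc i) ?k) (lmono (Suc i) d)"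
  have inj: "inj_on ?z {..?k}" by (auto simp: inj_on_def)
  have "dds (wd (Suc i) ?k) (\<lambda>x. co x i ^ c * lmono (Suc i) d x) = (\<lambda>x. co x i ^ c * y x)"
    unfolding y_def by (rule dds_mult_sym[of "Suc i" "i + ?k"]) (use set_wd[of "Suc i" ?k] in \<open>auto simp: sym_on_def co_sw\<close>)
  moreover have "lmono i (c # d) = (\<lambda>x. co x i ^ c * lmono (Suc i) d x)"
    by (simp add: fun_eq_iff lmono_Cons)
  ultimately have 1: "dds (wd i (length (c # d))) (lmono i (c # d)) = dds [i..<i + ?k] (\<lambda>x. co x i ^ c * y x)"
    by simp
  have ysym: "sym_on (Suc i) (i + ?k) (\<lambda>x. co x i ^ c * y x)"
    using sym_on_dds_wd[of "Suc i" ?k "lmono (Suc i) d"] unfolding y_def by (auto simp: sym_on_def co_sw)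
  have skip: "(\<lambda>a. co (cyc i l x) (Suc i + a)) = skip l ?z" if "l \<le> ?k" for l
    by (auto simp: fun_eq_iff skip_def co_cyc)
  have y: "y (cyc i l x) * vdet (skip l ?z) (staircase ?k) = vdet (skip l ?z) d" if "l \<le> ?k" for l
    using Cons.IH[of "Suc i" "cyc i l x"] unfolding skip[OF that] y_def .
  have "dds (wd i (length (c # d))) (lmono i (c # d)) x * vdet ?z (staircase (Suc ?k))
     = (\<Sum>l\<le>?k. ?z l ^ c * y (cyc i l x) * (vdet ?z (staircase (Suc ?k)) / (\<Prod>j\<in>{..?k} - {l}. ?z l - ?z j)))"
    unfolding 1 dds_upt_lagrange[OF ysym] by (simp add: sum_distrib_right co_cyc)
  also have "\<dots> = (\<Sum>l\<le>?k. ?z l ^ c * ((- 1) ^ l * vdet (skip l ?z) d))"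
    by (rule sum.cong) (auto simp: vdet_staircase_skip[OF inj, symmetric] y [symmetric])
  also have "\<dots> = vdet ?z (c # d)" by (simp add: vdet_Cons)
  finally show ?case by simp
qed

section \<open>Clifford relations\<close>

text \<open>Elementary symmetric polynomials (\<open>EV_esym\<close>), taken as coefficients of E(t)
  so that sign changes and roots can be read off from polynomials in t.\<close>

definition es :: "nat \<Rightarrow> nat \<Rightarrow> gfun" where
  "es n i x = Polynomial.coeff (\<Prod>j\<in>{1..n}. [:1, co x j:]) i"

text \<open>\<open>gq n q\<close> is the coefficient of \<open>t ^ q\<close> in \<open>E(t) E(-t)\<close>; unlike \<open>es n q\<close> it is invariant under sign changes.\<close>

definition gq :: "nat \<Rightarrow> nat \<Rightarrow> gfun" where
  "gq n q x = Polynomial.coeff (\<Prod>j\<in>{1..n}. [:1, 0, - (co x j)\<^sup>2:]) q"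

lemma coeff_prod_alternating: "Polynomial.coeff (\<Prod>j\<in>{1..n}. [:1, - co x j:]) s = (- 1) ^ s * es n s x"
proof -
  have "(\<Prod>j\<in>{1..n}. [:1, - co x j:]) = pcompose (\<Prod>j\<in>{1..n}. [:1, co x j:]) [:0, - 1:]"
    by (simp add: pcompose_prod pcompose_pCons)
  then show ?thesis by (simp add: coeff_pcompose_linear es_def)
qed

lemma gq_eq_sum: "gq n q x = (\<Sum>s\<le>q. (- 1) ^ s * es n s x * es n (q - s) x)"
proof -
  have eq: "(\<Prod>j\<in>{1..n}. [:1, 0, - (co x j)\<^sup>2:]) = (\<Prod>j\<in>{1..n}. [:1, - co x j:]) * (\<Prod>j\<in>{1..n}. [:1, co x j:])"
    by (simp add: prod.distrib [symmetric] power2_eq_square)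
  show ?thesis unfolding gq_def eq coeff_mult coeff_prod_alternating by (simp only: es_def)
qed

lemma gq_fl [simp]: "gq n q (fl m x) = gq n q x"
  unfolding gq_def by (intro arg_cong2[where f = Polynomial.coeff] prod.cong) (auto simp: co_fl)

lemma degree_prod_le:
  assumes "\<And>j. j \<in> A \<Longrightarrow> degree (p j :: rat poly) \<le> d"
  shows "degree (prod p A) \<le> card A * d"
proof (cases "finite A")
  case True
  then show ?thesis
    using degree_prod_sum_le[OF True, of p] sum_bounded_above[of A "\<lambda>j. degree (p j)" d] assms by fastforce
qed simp

lemma es_0 [simp]: "es n 0 x = 1"
  by (simp add: es_def poly_prod flip: poly_0_coeff_0)

lemma gq_0 [simp]: "gq n 0 x = 1"
  by (simp add: gq_def poly_prod flip: poly_0_coeff_0)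

lemma es_eq_0: "n < i \<Longrightarrow> es n i x = 0"
proof -
  have "degree (\<Prod>j\<in>{1..n}. [:1, co x j:]) \<le> card {1..n} * 1" by (rule degree_prod_le) simp
  then show "n < i \<Longrightarrow> es n i x = 0" unfolding es_def by (intro coeff_eq_0) simp
qed

lemma gq_odd_eq_0: "odd q \<Longrightarrow> gq n q x = 0"
proof -
  have "(\<Prod>j\<in>{1..n}. [:1, 0, - (co x j)\<^sup>2:]) = pcompose (\<Prod>j\<in>{1..n}. [:1, 0, - (co x j)\<^sup>2:]) [:0, - 1:]"
    by (simp add: pcompose_prod pcompose_pCons)
  then have "gq n q x = (- 1) ^ q * gq n q x"
    unfolding gq_def by (metis coeff_pcompose_linear)
  then show "odd q \<Longrightarrow> gq n q x = 0" by simp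
qed

lemma reversed_root:
  fixes p :: "rat poly"
  assumes "degree p \<le> d" "z \<noteq> 0" "poly p (1 / z) = 0"
  shows "(\<Sum>s\<le>d. Polynomial.coeff p s * z ^ (d - s)) = 0"
proof -
  have "poly p (1 / z) = (\<Sum>s\<le>d. Polynomial.coeff p s * (1 / z) ^ s)"
    unfolding poly_altdef by (rule sum.mono_neutral_left) (use assms(1) in \<open>auto simp: coeff_eq_0\<close>)
  then have "0 = z ^ d * (\<Sum>s\<le>d. Polynomial.coeff p s * (1 / z) ^ s)" using assms(3) by simp
  also have "\<dots> = (\<Sum>s\<le>d. Polynomial.coeff p s * z ^ (d - s))"
    unfolding sum_distrib_left
    by (rule sum.cong) (use assms(2) in \<open>auto simp: power_diff field_simps\<close>)
  finally show ?thesis ..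
qed

lemma es_root:
  assumes "m \<in> {1..n}"
  shows "(\<Sum>s\<le>n. (- 1) ^ s * es n s x * co x m ^ (n - s)) = 0"
proof -
  have "(\<Sum>s\<le>n. Polynomial.coeff (\<Prod>j\<in>{1..n}. [:1, - co x j:]) s * co x m ^ (n - s)) = 0"
  proof (rule reversed_root)
    have "degree (\<Prod>j\<in>{1..n}. [:1, - co x j:]) \<le> card {1..n} * 1" by (rule degree_prod_le) simp
    then show "degree (\<Prod>j\<in>{1..n}. [:1, - co x j:]) \<le> n" by simp
    show "poly (\<Prod>j\<in>{1..n}. [:1, - co x j:]) (1 / co x m) = 0"
      unfolding poly_prod using assms by (intro prod_zero) auto
  qed simp
  then show ?thesis unfolding coeff_prod_alternating .
qed

lemma gq_root:
  assumes "m \<in> {1..n}"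
  shows "(\<Sum>q\<le>2 * n. gq n q x * co x m ^ (2 * n - q)) = 0"
  unfolding gq_def
proof (rule reversed_root)
  have "degree (\<Prod>j\<in>{1..n}. [:1, 0, - (co x j)\<^sup>2:]) \<le> card {1..n} * 2" by (rule degree_prod_le) simp
  then show "degree (\<Prod>j\<in>{1..n}. [:1, 0, - (co x j)\<^sup>2:]) \<le> 2 * n" by simp
  show "poly (\<Prod>j\<in>{1..n}. [:1, 0, - (co x j)\<^sup>2:]) (1 / co x m) = 0"
    unfolding poly_prod using assms by (intro prod_zero) (auto simp: power2_eq_square)
qed simp

text \<open>
  The operator creating the part \<open>i\<close>. Its form \<open>phi_eq_kap\<close> involves annihilation operators only, with
  coefficients that depend on the point.
\<close>

definition phi :: "nat \<Rightarrow> nat \<Rightarrow> gfun \<Rightarrow> gfun" where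
  "phi n i f x = (\<Sum>q\<le>n - 1 + i. gq n q x * aop n (n - 1 + i - q) f x)"

text \<open>Up to the sign \<open>(- 1) ^ b\<close>, this is half of the sum of
  \<open>Q\<close>-tilde of \<open>i, b\<close> and \<open>es n i * es n b\<close>; see
  \<open>q2\<close>.\<close>

definition kap :: "nat \<Rightarrow> nat \<Rightarrow> nat \<Rightarrow> gfun" where
  "kap n i b x = (\<Sum>q\<le>b. (- 1) ^ q * es n q x * es n (i + b - q) x)"

text \<open>Expand \<open>gq\<close> into products of \<open>es n s\<close> and
  \<open>es n u\<close>. For \<open>u < i\<close> the sum over \<open>s\<close> contains all of
  E(-t), reversed and evaluated at its root \<open>co x m\<close>, and vanishes by
  \<open>es_root\<close>. The rest, grouped by \<open>b = u + s - i\<close>, has exponents below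
  \<open>n\<close> only.\<close>

lemma phi_weight:
  assumes m: "m \<in> {1..n}"
  shows "(\<Sum>q\<le>n - 1 + i. gq n q x * co x m ^ (n - 1 + i - q)) = (\<Sum>b<n. kap n i b x * co x m ^ (n - 1 - b))"
proof -
  define N z where Nz: "N = n - 1 + i" "z = co x m"
  define F where "F s u = (- 1) ^ s * es n s x * es n u x * z ^ (N - s - u)" for s u
  have n: "1 \<le> n" using m by simp
  have "(\<Sum>q\<le>N. gq n q x * z ^ (N - q)) = (\<Sum>q\<le>N. \<Sum>s\<le>q. F s (q - s))"
    unfolding gq_eq_sum sum_distrib_right F_def by (intro sum.cong) auto
  also have "\<dots> = (\<Sum>(q, s)\<in>(SIGMA q:{..N}. {..q}). F s (q - s))"
    by (simp add: sum.Sigma)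
  also have "\<dots> = (\<Sum>(u, s)\<in>(SIGMA u:{..N}. {..N - u}). F s u)"
    by (rule sum.reindex_bij_witness[of _ "\<lambda>(u, s). (u + s, s)" "\<lambda>(q, s). (q - s, s)"]) auto
  also have "\<dots> = (\<Sum>u\<le>N. \<Sum>s\<le>N - u. F s u)"
    by (simp add: sum.Sigma)
  also have "\<dots> = (\<Sum>u\<in>{i..N}. \<Sum>s\<le>N - u. F s u)"
  proof (rule sum.mono_neutral_right)
    show "\<forall>u\<in>{..N} - {i..N}. (\<Sum>s\<le>N - u. F s u) = 0"
    proof
      fix u assume "u \<in> {..N} - {i..N}"
      then have u: "n + u \<le> N" using n by (auto simp: Nz)
      have "(\<Sum>s\<le>N - u. F s u) = (\<Sum>s\<le>n. F s u)"
        by (rule sum.mono_neutral_right) (use u in \<open>auto simp: F_def es_eq_0\<close>)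
      also have "\<dots> = (\<Sum>s\<le>n. es n u x * z ^ (N - n - u) * ((- 1) ^ s * es n s x * z ^ (n - s)))"
      proof (rule sum.cong[OF refl])
        fix s assume "s \<in> {..n}"
        then have "N - s - u = (N - n - u) + (n - s)" using u by auto
        then show "F s u = es n u x * z ^ (N - n - u) * ((- 1) ^ s * es n s x * z ^ (n - s))"
          by (simp add: F_def power_add mult_ac)
      qed
      also have "\<dots> = 0"
        unfolding sum_distrib_left [symmetric] using es_root[OF m, of x] by (simp add: Nz)
      finally show "(\<Sum>s\<le>N - u. F s u) = 0" .
    qed
  qed auto
  also have "\<dots> = (\<Sum>(u, s)\<in>(SIGMA u:{i..N}. {..N - u}). F s u)"
    by (simp add: sum.Sigma)
  also have "\<dots> = (\<Sum>(b, q)\<in>(SIGMA b:{..<n}. {..b}). F q (i + b - q))"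
    by (rule sum.reindex_bij_witness[of _ "\<lambda>(b, q). (i + b - q, q)" "\<lambda>(u, s). (u + s - i, s)"])
      (use n in \<open>auto simp: Nz\<close>)
  also have "\<dots> = (\<Sum>b<n. \<Sum>q\<le>b. F q (i + b - q))"
    by (simp add: sum.Sigma)
  also have "\<dots> = (\<Sum>b<n. kap n i b x * z ^ (n - 1 - b))"
    unfolding kap_def sum_distrib_right
  proof (intro sum.cong refl)
    fix b q assume "b \<in> {..<n}" "q \<in> {..b}"
    then have "N - q - (i + b - q) = n - 1 - b" by (auto simp: Nz)
    then show "F q (i + b - q) = (- 1) ^ q * es n q x * es n (i + b - q) x * z ^ (n - 1 - b)"
      by (simp add: F_def)
  qed
  finally show ?thesis unfolding Nz .
qed

lemma sum_mult_aop:
  "(\<Sum>q\<in>S. k q * aop n (c q) f x)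
    = (\<Sum>m\<in>{1..n}. (\<Sum>q\<in>S. k q * co x m ^ c q) * f (fl m x) / (\<Prod>j\<in>{1..n} - {m}. co x m - co x j))"
  unfolding aop_def sum_distrib_left sum_distrib_right sum_divide_distrib
  by (subst sum.swap) (simp add: mult.assoc)

lemma phi_eq_kap: "phi n i f x = (\<Sum>b<n. kap n i b x * aop n (n - 1 - b) f x)"
  unfolding phi_def sum_mult_aop by (rule sum.cong) (simp_all only: phi_weight)

text \<open>For even \<open>p\<close>, the complete homogeneous symmetric polynomial of degree
  \<open>p/2 - n + 1\<close> in the squares of the variables (0 in negative degree). It arises from
  the diagonal terms in \<open>aop_anticommute\<close>.\<close>

definition hq :: "nat \<Rightarrow> nat \<Rightarrow> gfun" where
  "hq n p x = (\<Sum>m\<in>{1..n}. co x m ^ p / (\<Prod>j\<in>{1..n} - {m}. (co x m)\<^sup>2 - (co x j)\<^sup>2))"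

lemma hq_even:
  assumes "p < n"
  shows "hq n (2 * p) x = (if Suc p = n then 1 else 0)"
proof -
  have "inj_on (\<lambda>m. (co x m)\<^sup>2) {1..n}" by (auto simp: inj_on_def power2_eq_iff)
  then show ?thesis
    using lagrange_power_sum[of "{1..n}" "\<lambda>m. (co x m)\<^sup>2" p] assms by (simp add: hq_def power_mult)
qed

lemma aop_one:
  assumes "c < n"
  shows "aop n c (\<lambda>x. 1) x = (if Suc c = n then 1 else 0)"
  using lagrange_power_sum[of "{1..n}" "co x" c] assms by (simp add: aop_def inj_on_def)

text \<open>For \<open>m \<noteq> m'\<close> the two flips commute, and the denominators of the two
  orders differ exactly by the sign of \<open>co x m - co x m'\<close>, so these terms cancel. For
  \<open>m = m'\<close> the second flip undoes the first, and the factors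
  \<open>x\<^sub>m - x\<^sub>j\<close> and \<open>x\<^sub>m + x\<^sub>j\<close> combine to
  differences of squares.\<close>

lemma aop_anticommute:
  "aop n c (aop n d f) x + aop n d (aop n c f) x = (- 1) ^ (n - 1) * ((- 1) ^ c + (- 1) ^ d) * hq n (c + d) x * f x"
proof -
  define P where "P m y = (\<Prod>j\<in>{1..n} - {m}. co y m - co y j)" for m y
  define t where "t m m' c d = co x m ^ c * (co (fl m x) m' ^ d * f (fl m' (fl m x)) / P m' (fl m x)) / P m x" for m m' c d
  have e: "aop n c (aop n d f) x = (\<Sum>m\<in>{1..n}. \<Sum>m'\<in>{1..n}. t m m' c d)" for c d
    unfolding aop_def t_def P_def sum_distrib_left sum_divide_distrib ..
  have diag: "t m m c d + t m m d c
      = (- 1) ^ (n - 1) * ((- 1) ^ c + (- 1) ^ d) * (co x m ^ (c + d) / (\<Prod>j\<in>{1..n} - {m}. (co x m)\<^sup>2 - (co x j)\<^sup>2)) * f x"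
    if m: "m \<in> {1..n}" for m
  proof -
    define R where "R = (\<Prod>j\<in>{1..n} - {m}. co x m + co x j)"
    have "P m (fl m x) = (\<Prod>j\<in>{1..n} - {m}. (- 1) * (co x m + co x j))"
      unfolding P_def by (rule prod.cong) (auto simp: co_fl)
    also have "\<dots> = (- 1) ^ (n - 1) * R"
      using m by (simp only: prod.distrib R_def prod_constant) simp
    finally have 1: "P m (fl m x) = (- 1) ^ (n - 1) * R" .
    have 2: "(\<Prod>j\<in>{1..n} - {m}. (co x m)\<^sup>2 - (co x j)\<^sup>2) = P m x * R"
      unfolding P_def R_def prod.distrib [symmetric]
      by (rule prod.cong) (auto simp: power2_eq_square algebra_simps)
    have gen: "A * (s * B * F / (e * R)) / Q + B * (s' * A * F / (e * R)) / Q = e * (s' + s) * (A * B / (Q * R)) * F"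
      if "e * e = 1" for A B F Q e s s' :: rat
    proof -
      have "inverse e = e" using that by (rule inverse_unique)
      then show ?thesis by (simp add: divide_inverse algebra_simps)
    qed
    have e: "((- 1) ^ (n - 1) * (- 1) ^ (n - 1) :: rat) = 1" by (simp flip: power_mult_distrib)
    have "co (fl m x) m = - co x m" by (simp add: co_fl)
    then show ?thesis
      unfolding t_def 1 2 fl_fl power_add power_minus[of "co x m"]
      using gen[OF e] by (simp only: power_minus[of "co x m"])
  qed
  have off: "t m m' c d + t m' m d c = 0" if m: "m \<in> {1..n}" "m' \<in> {1..n}" "m \<noteq> m'" for m m'
  proof -
    define R where "R = (\<Prod>j\<in>{1..n} - {m} - {m'}. co x m - co x j)"
    define R' where "R' = (\<Prod>j\<in>{1..n} - {m} - {m'}. co x m' - co x j)"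
    have sets: "{1..n} - {m'} - {m} = {1..n} - {m} - {m'}" by auto
    have 1: "P m x = (co x m - co x m') * R"
      unfolding P_def R_def by (rule prod.remove) (use m in auto)
    have 2: "P m' x = (co x m' - co x m) * R'"
      unfolding P_def R'_def sets [symmetric] by (rule prod.remove) (use m in auto)
    have "P m' (fl m x) = (co (fl m x) m' - co (fl m x) m) * (\<Prod>j\<in>{1..n} - {m'} - {m}. co (fl m x) m' - co (fl m x) j)"
      unfolding P_def by (rule prod.remove) (use m in auto)
    also have "(\<Prod>j\<in>{1..n} - {m'} - {m}. co (fl m x) m' - co (fl m x) j) = R'"
      unfolding R'_def sets by (rule prod.cong) (use m in \<open>auto simp: co_fl\<close>)
    finally have 3: "P m' (fl m x) = (co x m + co x m') * R'" using m by (simp add: co_fl add.commute)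
    have "P m (fl m' x) = (co (fl m' x) m - co (fl m' x) m') * (\<Prod>j\<in>{1..n} - {m} - {m'}. co (fl m' x) m - co (fl m' x) j)"
      unfolding P_def by (rule prod.remove) (use m in auto)
    also have "(\<Prod>j\<in>{1..n} - {m} - {m'}. co (fl m' x) m - co (fl m' x) j) = R"
      unfolding R_def by (rule prod.cong) (use m in \<open>auto simp: co_fl\<close>)
    finally have 4: "P m (fl m' x) = (co x m + co x m') * R" using m by (simp add: co_fl)
    have 5: "fl m (fl m' x) = fl m' (fl m x)" by (rule gpt_eqI) (use m in \<open>simp add: co_fl\<close>)
    have gen: "a * (b * F / (s * r')) / (u * r) + b * (a * F / (s * r)) / (- u * r') = 0" for a b F s r r' u :: rat
      by (simp add: mult_ac)
    have "co x m' - co x m = - (co x m - co x m')" by simp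
    then show ?thesis
      unfolding t_def 1 2 3 4 5 using m gen by (simp only: co_fl if_False not_sym simp_thms)
  qed
  have "aop n c (aop n d f) x + aop n d (aop n c f) x
      = (\<Sum>m\<in>{1..n}. \<Sum>m'\<in>{1..n}. t m m' c d) + (\<Sum>m'\<in>{1..n}. \<Sum>m\<in>{1..n}. t m m' d c)"
    unfolding e by (simp add: sum.swap[of "\<lambda>m m'. t m m' d c"])
  also have "\<dots> = (\<Sum>m\<in>{1..n}. \<Sum>m'\<in>{1..n}. t m m' c d + t m' m d c)"
    by (simp add: sum.distrib)
  also have "\<dots> = (\<Sum>m\<in>{1..n}. \<Sum>m'\<in>{1..n}. if m' = m then t m m c d + t m m d c else 0)"
    by (intro sum.cong refl) (use off in auto)
  also have "\<dots> = (\<Sum>m\<in>{1..n}. t m m c d + t m m d c)" by simp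
  also have "\<dots> = (- 1) ^ (n - 1) * ((- 1) ^ c + (- 1) ^ d) * hq n (c + d) x * f x"
    unfolding hq_def sum_distrib_left sum_distrib_right by (rule sum.cong) (use diag in auto)
  finally show ?thesis .
qed

lemma gq_hq_sum:
  assumes "2 * n \<le> M"
  shows "(\<Sum>q\<le>2 * n. gq n q x * hq n (M - q) x) = 0"
proof -
  have "(\<Sum>q\<le>2 * n. gq n q x * hq n (M - q) x)
    = (\<Sum>m\<in>{1..n}. (\<Sum>q\<le>2 * n. gq n q x * co x m ^ (M - q)) / (\<Prod>j\<in>{1..n} - {m}. (co x m)\<^sup>2 - (co x j)\<^sup>2))"
    unfolding hq_def sum_distrib_left sum_divide_distrib by (subst sum.swap) simp
  also have "\<dots> = 0"
  proof (rule sum.neutral, rule ballI)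
    fix m assume m: "m \<in> {1..n}"
    have "(\<Sum>q\<le>2 * n. gq n q x * co x m ^ (M - q)) = (\<Sum>q\<le>2 * n. co x m ^ (M - 2 * n) * (gq n q x * co x m ^ (2 * n - q)))"
    proof (rule sum.cong[OF refl])
      fix q assume "q \<in> {..2 * n}"
      then have "M - q = (M - 2 * n) + (2 * n - q)" using assms by auto
      then show "gq n q x * co x m ^ (M - q) = co x m ^ (M - 2 * n) * (gq n q x * co x m ^ (2 * n - q))"
        by (simp add: power_add)
    qed
    also have "\<dots> = 0" unfolding sum_distrib_left [symmetric] gq_root[OF m] by simp
    finally show "(\<Sum>q\<le>2 * n. gq n q x * co x m ^ (M - q)) / (\<Prod>j\<in>{1..n} - {m}. (co x m)\<^sup>2 - (co x j)\<^sup>2) = 0"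
      by simp
  qed
  finally show ?thesis .
qed

text \<open>The usual orthogonality of elementary and complete symmetric polynomials, in the
  squares. Only even \<open>q\<close> count, so by the parity of \<open>c + N\<close> the two signs
  cancel everywhere or agree everywhere. The range stops at \<open>N\<close> instead of
  \<open>2 * n\<close>: if \<open>c + i < n\<close>, only \<open>q = 0\<close> can contribute;
  otherwise the missing terms are zero and \<open>gq_hq_sum\<close> applies.\<close>

lemma gq_hq_contraction:
  assumes c: "c < n" and i: "i < n"
  shows "(\<Sum>q\<le>n - 1 + i. gq n q x * (((- 1) ^ c + (- 1) ^ (n - 1 + i - q)) * hq n (c + (n - 1 + i - q)) x))
    = (if Suc (c + i) = n then 2 * (- 1) ^ c else 0)"
proof -
  define N where "N = n - 1 + i"
  have N: "Suc N = n + i" using c by (simp add: N_def)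
  let ?t = "\<lambda>q. gq n q x * (((- 1) ^ c + (- 1) ^ (N - q)) * hq n (c + (N - q)) x)"
  have "(\<Sum>q\<le>N. ?t q) = (if Suc (c + i) = n then 2 * (- 1) ^ c else 0)"
  proof (cases "even (c + N)")
    case False
    have "?t q = 0" if "q \<le> N" for q
    proof (cases "even q")
      case True
      then have "even c \<longleftrightarrow> odd (N - q)" using False that by auto
      then show ?thesis by (cases "even c") auto
    qed (simp add: gq_odd_eq_0)
    then have "(\<Sum>q\<le>N. ?t q) = 0" by (intro sum.neutral) blast
    moreover have "Suc (c + i) \<noteq> n" using False N by auto
    ultimately show ?thesis by simp
  next
    case True
    have "?t q = 2 * (- 1) ^ c * (gq n q x * hq n (c + N - q) x)" if "q \<le> N" for q
    proof (cases "even q")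
      case True
      then have "even c \<longleftrightarrow> even (N - q)" using \<open>even (c + N)\<close> that by auto
      then show ?thesis using that by (cases "even c") auto
    qed (simp add: gq_odd_eq_0)
    then have "(\<Sum>q\<le>N. ?t q) = 2 * (- 1) ^ c * (\<Sum>q\<le>N. gq n q x * hq n (c + N - q) x)"
      unfolding sum_distrib_left by (intro sum.cong) auto
    moreover have "(\<Sum>q\<le>N. gq n q x * hq n (c + N - q) x) = (if Suc (c + i) = n then 1 else 0)"
    proof (cases "c + i < n")
      case True
      have "gq n q x * hq n (c + N - q) x = (if q = 0 then if Suc (c + i) = n then 1 else 0 else 0)" if "q \<le> N" for q
      proof (cases "even q")
        case e: True
        then have "even (c + N - q)" using \<open>even (c + N)\<close> by simp
        then obtain p where p: "c + N - q = 2 * p" by (rule evenE)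
        have sum: "2 * p + q + 1 = c + i + n" using p that N by linarith
        then have "p < n" using True by linarith
        moreover have "Suc p = n \<longleftrightarrow> q = 0 \<and> Suc (c + i) = n" using sum True by arith
        ultimately show ?thesis unfolding p using hq_even[of p n x] by auto
      qed (auto simp: gq_odd_eq_0 odd_pos)
      then have "(\<Sum>q\<le>N. gq n q x * hq n (c + N - q) x) = (\<Sum>q\<le>N. if q = 0 then if Suc (c + i) = n then 1 else 0 else 0)"
        by (intro sum.cong) auto
      then show ?thesis by simp
    next
      case False
      \<comment> \<open>From \<open>c + i \<ge> n\<close> alone follows only
        \<open>c + N \<ge> 2 * n - 1\<close>; parity supplies the missing unit for
        \<open>gq_hq_sum\<close>.\<close>
      have "odd (2 * n - 1)" using c by (cases n) auto
      then have "c + N \<noteq> 2 * n - 1" using \<open>even (c + N)\<close> by metis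
      then have ge: "2 * n \<le> c + N" using False N by linarith
      have un: "{..2 * n} = {..N} \<union> {N<..2 * n}" using N i by auto
      have "(\<Sum>q\<le>2 * n. gq n q x * hq n (c + N - q) x)
        = (\<Sum>q\<le>N. gq n q x * hq n (c + N - q) x) + (\<Sum>q\<in>{N<..2 * n}. gq n q x * hq n (c + N - q) x)"
        unfolding un by (rule sum.union_disjoint) auto
      moreover have "(\<Sum>q\<in>{N<..2 * n}. gq n q x * hq n (c + N - q) x) = 0"
      proof (rule sum.neutral, rule ballI)
        fix q assume q: "q \<in> {N<..2 * n}"
        show "gq n q x * hq n (c + N - q) x = 0"
        proof (cases "even q")
          case True
          then have "even (c + N - q)" using \<open>even (c + N)\<close> by simp
          then obtain p where p: "c + N - q = 2 * p" by (rule evenE)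
          have "q \<le> c + N" using q ge by simp
          then have "2 * p + q = c + N" "N < q" using p q by auto
          then have "2 * p + 1 \<le> c" by linarith
          then have "Suc p < n" using c by linarith
          then show ?thesis unfolding p using hq_even[of p n x] by simp
        qed (simp add: gq_odd_eq_0)
      qed
      ultimately show ?thesis using gq_hq_sum[OF ge, of x] False by simp
    qed
    ultimately show ?thesis by simp
  qed
  then show ?thesis unfolding N_def .
qed

text \<open>The coefficients \<open>gq\<close> are invariant under sign changes and hence pass
  through \<open>aop\<close>. What is left are anticommutators of two \<open>aop\<close>, contracted
  by \<open>gq_hq_contraction\<close>.\<close>

lemma aop_phi_anticommute:
  assumes "b < n" "i < n"
  shows "aop n (n - 1 - b) (phi n i f) x + phi n i (aop n (n - 1 - b) f) x
    = (if i = b then 2 * (- 1) ^ b * f x else 0)"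
proof -
  let ?c = "n - 1 - b" and ?N = "n - 1 + i"
  have "aop n ?c (phi n i f) x = (\<Sum>q\<le>?N. gq n q x * aop n ?c (aop n (?N - q) f) x)"
    unfolding aop_def[of n ?c] phi_def gq_fl sum_distrib_left sum_divide_distrib
    by (subst sum.swap) (simp add: mult_ac)
  then have "aop n ?c (phi n i f) x + phi n i (aop n ?c f) x
      = (\<Sum>q\<le>?N. gq n q x * (aop n ?c (aop n (?N - q) f) x + aop n (?N - q) (aop n ?c f) x))"
    by (simp add: phi_def sum.distrib distrib_left)
  also have "\<dots> = (- 1) ^ (n - 1) * f x * (\<Sum>q\<le>?N. gq n q x * (((- 1) ^ ?c + (- 1) ^ (?N - q)) * hq n (?c + (?N - q)) x))"
    unfolding aop_anticommute sum_distrib_left by (rule sum.cong) (auto simp: mult_ac)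
  also have "\<dots> = (if i = b then (- 1) ^ (n - 1) * f x * (2 * (- 1) ^ ?c) else 0)"
    using assms by (subst gq_hq_contraction) auto
  also have "(- 1) ^ (n - 1) * f x * (2 * (- 1) ^ ?c) = 2 * (- 1) ^ b * f x"
  proof -
    have "n - 1 + ?c = 2 * ?c + b" using assms by simp
    then have "(- 1 :: rat) ^ (n - 1) * (- 1) ^ ?c = (- 1) ^ b"
      unfolding power_add [symmetric] by (simp add: power_add power_mult)
    then show ?thesis by (simp add: mult_ac)
  qed
  finally show ?thesis .
qed

section \<open>Pfaffians\<close>

definition del_nth :: "nat \<Rightarrow> 'a list \<Rightarrow> 'a list" where
  "del_nth j L = take j L @ drop (Suc j) L"

lemma del_nth_0 [simp]: "del_nth 0 (i # L) = L"
  by (simp add: del_nth_def)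

lemma del_nth_Suc [simp]: "del_nth (Suc j) (i # L) = i # del_nth j L"
  by (simp add: del_nth_def)

lemma length_del_nth [simp]: "j < length L \<Longrightarrow> length (del_nth j L) = length L - 1"
  by (simp add: del_nth_def)

lemma nth_del_nth:
  "j < length L \<Longrightarrow> l < length L - 1 \<Longrightarrow> del_nth j L ! l = L ! (if l < j then l else Suc l)"
  by (auto simp: del_nth_def nth_append min_def)

lemma set_del_nth: "set (del_nth j L) \<subseteq> set L"
  unfolding del_nth_def using set_take_subset[of j L] set_drop_subset[of "Suc j" L] by auto

lemma del_nth_del_nth:
  assumes "j < length L" "l < length L - 1"
  shows "del_nth l (del_nth j L) = (if l < j then del_nth (j - 1) (del_nth l L) else del_nth j (del_nth (Suc l) L))"
  using assms by (intro nth_equalityI) (auto simp: nth_del_nth)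

text \<open>Deleting two entries in either order reverses the sign of the pair of deletions.\<close>

lemma sum_two_deletions:
  fixes F :: "'b \<Rightarrow> 'b \<Rightarrow> 'b list \<Rightarrow> 'a::comm_ring_1"
  shows "(\<Sum>j<length L. \<Sum>l<length L - 1. (- 1) ^ j * (- 1) ^ l * F (L ! j) (del_nth j L ! l) (del_nth l (del_nth j L)))
       = - (\<Sum>l<length L. \<Sum>j<length L - 1. (- 1) ^ l * (- 1) ^ j * F (del_nth l L ! j) (L ! l) (del_nth j (del_nth l L)))"
proof -
  let ?m = "length L"
  have "(\<Sum>j<?m. \<Sum>l<?m - 1. (- 1) ^ j * (- 1) ^ l * F (L ! j) (del_nth j L ! l) (del_nth l (del_nth j L)))
    = (\<Sum>(j, l)\<in>{..<?m} \<times> {..<?m - 1}. (- 1) ^ j * (- 1) ^ l * F (L ! j) (del_nth j L ! l) (del_nth l (del_nth j L)))"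
    by (simp add: sum.cartesian_product)
  also have "\<dots> = (\<Sum>(l, j)\<in>{..<?m} \<times> {..<?m - 1}. - ((- 1) ^ l * (- 1) ^ j * F (del_nth l L ! j) (L ! l) (del_nth j (del_nth l L))))"
  proof (rule sum.reindex_bij_witness[of _ "\<lambda>(j, l). if l < j then (l, j - 1) else (Suc l, j)"
        "\<lambda>(j, l). if l < j then (l, j - 1) else (Suc l, j)"])
    fix p assume p: "p \<in> {..<?m} \<times> {..<?m - 1}"
    obtain j l where [simp]: "p = (j, l)" by (cases p)
    have jl: "j < ?m" "l < ?m - 1" using p by auto
    show "(case (case p of (j, l) \<Rightarrow> if l < j then (l, j - 1) else (Suc l, j)) of (l, j) \<Rightarrow>
        - ((- 1) ^ l * (- 1) ^ j * F (del_nth l L ! j) (L ! l) (del_nth j (del_nth l L))))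
      = (case p of (j, l) \<Rightarrow> (- 1) ^ j * (- 1) ^ l * F (L ! j) (del_nth j L ! l) (del_nth l (del_nth j L)))"
    proof (cases "l < j")
      case True
      then obtain i where i: "j = Suc i" by (cases j) auto
      have "del_nth l (del_nth (Suc i) L) = del_nth i (del_nth l L)"
        using del_nth_del_nth[OF jl] True i by simp
      then show ?thesis using True jl i by (simp add: nth_del_nth mult_ac)
    next
      case False
      moreover have "del_nth l (del_nth j L) = del_nth j (del_nth (Suc l) L)"
        using del_nth_del_nth[OF jl] False by simp
      ultimately show ?thesis using jl by (simp add: nth_del_nth)
    qed
  qed (auto split: if_splits)
  also have "\<dots> = - (\<Sum>l<?m. \<Sum>j<?m - 1. (- 1) ^ l * (- 1) ^ j * F (del_nth l L ! j) (L ! l) (del_nth j (del_nth l L)))"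
    by (simp add: sum.cartesian_product sum_negf case_prod_beta)
  finally show ?thesis .
qed

text \<open>For odd length this rewrites \<open>N L\<close> as a sum over deletions, so that the
  term with \<open>e i\<close> in the recursion of \<open>N\<close> can be merged with the terms in
  \<open>M\<close>. Expanding each \<open>N (i # del_nth j K)\<close> gives a sum over two
  deletions; taken in the other order (\<open>sum_two_deletions\<close>), its inner sum is the same
  expression for a list shorter by two.\<close>

lemma alternating_deletion_sum:
  fixes e :: "nat \<Rightarrow> 'a::comm_ring_1" and M :: "nat \<Rightarrow> nat \<Rightarrow> 'a" and N :: "nat list \<Rightarrow> 'a"
  assumes N: "\<And>i L. set (i # L) \<subseteq> A \<Longrightarrow>
    N (i # L) = (- 1) ^ length L * e i * N L + (\<Sum>j<length L. (- 1) ^ j * M i (L ! j) * N (del_nth j L))"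
    and "set L \<subseteq> A"
  shows "(\<Sum>j<length L. (- 1) ^ j * e (L ! j) * N (del_nth j L)) = (if odd (length L) then N L else 0)"
  using assms(2)
proof (induction "length L" arbitrary: L rule: less_induct)
  case less
  show ?case
  proof (cases L)
    case (Cons i K)
    define S where "S L = (\<Sum>j<length L. (- 1) ^ j * e (L ! j) * N (del_nth j L))" for L
    have K: "set K \<subseteq> A" and iK: "set (i # K) \<subseteq> A" using less.prems Cons by auto
    have sub: "set (del_nth j K) \<subseteq> A" "set (i # del_nth j K) \<subseteq> A" for j
      using iK set_del_nth[of j K] by auto
    have SK: "S K = (if odd (length K) then N K else 0)"
      unfolding S_def by (rule less.hyps) (use Cons K in auto)
    have Sdel: "S (del_nth l K) = (if odd (length K - 1) then N (del_nth l K) else 0)" if "l < length K" for l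
      using less.hyps[of "del_nth l K"] Cons sub(1)[of l] that by (simp add: S_def)
    have "S L = e i * N K - (\<Sum>j<length K. (- 1) ^ j * e (K ! j) * N (i # del_nth j K))"
      unfolding S_def Cons by (simp add: sum.lessThan_Suc_shift sum_negf del: sum.lessThan_Suc)
    also have "(\<Sum>j<length K. (- 1) ^ j * e (K ! j) * N (i # del_nth j K))
      = (\<Sum>j<length K. (- 1) ^ j * e (K ! j) * ((- 1) ^ (length K - 1) * e i * N (del_nth j K)))
        + (\<Sum>j<length K. \<Sum>l<length K - 1. (- 1) ^ j * (- 1) ^ l * (e (K ! j) * M i (del_nth j K ! l) * N (del_nth l (del_nth j K))))"
      unfolding sum.distrib [symmetric]
      by (rule sum.cong) (simp_all add: N[OF sub(2)] distrib_left sum_distrib_left mult_ac)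
    also have "(\<Sum>j<length K. (- 1) ^ j * e (K ! j) * ((- 1) ^ (length K - 1) * e i * N (del_nth j K)))
      = (- 1) ^ (length K - 1) * e i * S K"
      unfolding S_def sum_distrib_left by (simp add: mult_ac)
    also have "(\<Sum>j<length K. \<Sum>l<length K - 1. (- 1) ^ j * (- 1) ^ l * (e (K ! j) * M i (del_nth j K ! l) * N (del_nth l (del_nth j K))))
      = - (\<Sum>l<length K. (- 1) ^ l * M i (K ! l) * S (del_nth l K))"
      unfolding sum_two_deletions[where F = "\<lambda>a b L. e a * M i b * N L"] S_def
      by (simp add: sum_distrib_left mult_ac)
    finally have S: "S L = e i * N K - ((- 1) ^ (length K - 1) * e i * S K
      + - (\<Sum>l<length K. (- 1) ^ l * M i (K ! l) * S (del_nth l K)))" .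
    show ?thesis
    proof (cases "odd (length K)")
      case True
      then have "(\<Sum>l<length K. (- 1) ^ l * M i (K ! l) * S (del_nth l K)) = 0"
        by (intro sum.neutral) (simp add: Sdel)
      then show ?thesis using S SK True Cons by (simp add: S_def)
    next
      case False
      have "(\<Sum>l<length K. (- 1) ^ l * M i (K ! l) * S (del_nth l K)) = (\<Sum>l<length K. (- 1) ^ l * M i (K ! l) * N (del_nth l K))"
        by (rule sum.cong) (use False in \<open>auto simp: Sdel\<close>)
      then have "S L = N (i # K)" using S SK N[OF iK] False by simp
      then show ?thesis using False Cons by (simp add: S_def)
    qed
  qed simp
qed

text \<open>A Pfaffian indexed by a list: matchings list every pair in increasing order, so only
  entries above the diagonal are read, and deleting list entries replaces deleting rows and
  columns.\<close>

definition pfl :: "(nat \<Rightarrow> nat \<Rightarrow> 'a::comm_ring_1) \<Rightarrow> nat list \<Rightarrow> 'a" where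
  "pfl q L = (\<Sum>\<sigma>\<in>matching_perms (length L).
     of_int (sign \<sigma>) * (\<Prod>a<length L div 2. q (L ! \<sigma> (2 * a)) (L ! \<sigma> (2 * a + 1))))"

section \<open>Perfect matchings and expansion along the first row\<close>

definition ski :: "nat \<Rightarrow> nat \<Rightarrow> nat" where
  "ski j b = (if b < j then b else Suc b)"

text \<open>The matching that pairs \<open>0\<close> with \<open>j + 1\<close> and matches the other indices by \<open>\<tau>\<close>.\<close>

definition ext :: "nat \<Rightarrow> (nat \<Rightarrow> nat) \<Rightarrow> nat \<Rightarrow> nat" where
  "ext j \<tau> a = (case a of 0 \<Rightarrow> 0 | Suc 0 \<Rightarrow> Suc j | Suc (Suc a) \<Rightarrow> Suc (ski j (\<tau> a)))"

lemma ext_simps [simp]: "ext j \<tau> 0 = 0" "ext j \<tau> (Suc 0) = Suc j" "ext j \<tau> (Suc (Suc a)) = Suc (ski j (\<tau> a))"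
  by (simp_all add: ext_def)

lemma ski_less_iff [simp]: "ski j a < ski j b \<longleftrightarrow> a < b"
  by (auto simp: ski_def)

lemma ski_eq_iff [simp]: "ski j a = ski j b \<longleftrightarrow> a = b"
  by (auto simp: ski_def)

lemma ski_neq [simp]: "ski j a \<noteq> j" "j \<noteq> ski j a"
  by (auto simp: ski_def)

lemma ext_eqI: "f 0 = 0 \<Longrightarrow> f (Suc 0) = Suc j \<Longrightarrow> (\<And>a. f (Suc (Suc a)) = Suc (ski j (\<tau> a))) \<Longrightarrow> f = ext j \<tau>"
proof
  fix a assume "f 0 = 0" "f (Suc 0) = Suc j" "\<And>a. f (Suc (Suc a)) = Suc (ski j (\<tau> a))"
  then show "f a = ext j \<tau> a" by (cases a rule: nat.exhaust; cases "a - 1") (auto simp: ext_def split: nat.splits)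
qed

text \<open>\<open>ext j id\<close> is a cycle of length \<open>j + 1\<close>, and raising
  \<open>j\<close> by one composes it with one more adjacent transposition.\<close>

lemma ext_id: "j < Suc k \<Longrightarrow> ext j id permutes {..<Suc (Suc k)} \<and> sign (ext j id) = (- 1) ^ j"
proof (induction j)
  case 0
  have "id = ext 0 id" by (rule ext_eqI) (auto simp: ski_def)
  then show ?case by (metis permutes_id power_0 sign_id)
next
  case (Suc j)
  let ?t = "Transposition.transpose (Suc j) (Suc (Suc j))"
  have eq: "?t \<circ> ext j id = ext (Suc j) id"
    by (rule ext_eqI) (auto simp: ski_def Transposition.transpose_def)
  have "ext j id permutes {..<Suc (Suc k)} \<and> sign (ext j id) = (- 1) ^ j"
    by (rule Suc.IH) (use Suc.prems in simp)
  then have IH: "ext j id permutes {..<Suc (Suc k)}" "sign (ext j id) = (- 1) ^ j" by blast+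
  have t: "?t permutes {..<Suc (Suc k)}" using Suc.prems by (intro permutes_swap_id) auto
  have "sign (?t \<circ> ext j id) = sign ?t * sign (ext j id)"
    by (intro sign_compose permutation_permutes[THEN iffD2] exI conjI) (use t IH(1) in auto)
  then show ?case using permutes_compose[OF IH(1) t] IH(2) unfolding eq by (simp add: sign_swap_id id_def)
qed

lemma ext_permutes_sign:
  assumes j: "j < Suc k" and "\<tau> permutes {..<k}"
  shows "ext j \<tau> permutes {..<Suc (Suc k)} \<and> sign (ext j \<tau>) = (- 1) ^ j * sign \<tau>"
  using assms(2) finite_lessThan
proof (induction rule: permutes_induct)
  case id
  then show ?case using ext_id[OF j] by (simp add: sign_id id_def)
next
  case (swap a b \<tau>)
  let ?t = "Transposition.transpose (Suc (ski j a)) (Suc (ski j b))"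
  have eq: "?t \<circ> ext j \<tau> = ext j (Transposition.transpose a b \<circ> \<tau>)"
    by (rule ext_eqI) (auto simp: Transposition.transpose_def)
  have IH: "ext j \<tau> permutes {..<Suc (Suc k)}" "sign (ext j \<tau>) = (- 1) ^ j * sign \<tau>" using swap by auto
  have t: "?t permutes {..<Suc (Suc k)}" using swap by (intro permutes_swap_id) (auto simp: ski_def)
  have sgn: "sign (?t \<circ> ext j \<tau>) = sign ?t * sign (ext j \<tau>)"
    by (intro sign_compose permutation_permutes[THEN iffD2] exI conjI) (use t IH(1) in auto)
  have \<tau>: "\<tau> permutes {..<k}" using swap by simp
  have "sign (Transposition.transpose a b \<circ> \<tau>) = sign (Transposition.transpose a b) * sign \<tau>"
    by (intro sign_compose permutation_permutes[THEN iffD2] exI conjI)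
      (use \<tau> permutes_swap_id[OF swap(1,2)] in auto)
  then show ?case
    using permutes_compose[OF IH(1) t] IH(2) swap(3) sgn unfolding eq by (simp add: sign_swap_id o_def)
qed

lemma matching_perms_ext:
  assumes "j < Suc k" "\<tau> \<in> matching_perms k"
  shows "ext j \<tau> \<in> matching_perms (Suc (Suc k))"
proof -
  have \<tau>: "\<tau> permutes {..<k}" "\<And>a. a < k div 2 \<Longrightarrow> \<tau> (2 * a) < \<tau> (2 * a + 1)"
    "\<And>a b. a < b \<Longrightarrow> b < k div 2 \<Longrightarrow> \<tau> (2 * a) < \<tau> (2 * b)"
    using assms(2) by (auto simp: matching_perms_def)
  have "ext j \<tau> (2 * a) < ext j \<tau> (2 * a + 1)" if "a < Suc (Suc k) div 2" for a
    using that \<tau>(2) by (cases a) auto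
  moreover have "ext j \<tau> (2 * a) < ext j \<tau> (2 * b)" if "a < b" "b < Suc (Suc k) div 2" for a b
    using that \<tau>(3) by (cases a; cases b) auto
  ultimately show ?thesis using ext_permutes_sign[OF assms(1) \<tau>(1)] by (auto simp: matching_perms_def)
qed

text \<open>The ordering conditions force 0 to be first in its pair and that pair to be first of
  all, so \<open>\<sigma> 0 = 0\<close>. The matching is then given by the partner of 0 and the
  matching of the rest.\<close>

lemma matching_perms_ext_surj:
  assumes "even k" "\<sigma> \<in> matching_perms (Suc (Suc k))"
  obtains j \<tau> where "j < Suc k" "\<tau> \<in> matching_perms k" "\<sigma> = ext j \<tau>"
proof -
  have \<sigma>: "\<sigma> permutes {..<Suc (Suc k)}" "\<And>a. a < Suc (k div 2) \<Longrightarrow> \<sigma> (2 * a) < \<sigma> (2 * a + 1)"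
    "\<And>a b. a < b \<Longrightarrow> b < Suc (k div 2) \<Longrightarrow> \<sigma> (2 * a) < \<sigma> (2 * b)"
    using assms(2) by (auto simp: matching_perms_def)
  note inj = permutes_inj[OF \<sigma>(1), THEN inj_eq]
  have bound: "\<sigma> a < Suc (Suc k) \<longleftrightarrow> a < Suc (Suc k)" for a
    using permutes_in_image[OF \<sigma>(1), of a] by simp
  obtain t where t: "\<sigma> t = 0" using permutes_surj[OF \<sigma>(1)] by (metis surjD)
  have "t < Suc (Suc k)" using bound[of t] t by simp
  have "t = 0"
  proof (cases "even t")
    case True
    then obtain a where "t = 2 * a" by blast
    then show ?thesis using \<sigma>(3)[of 0 a] t \<open>t < Suc (Suc k)\<close> assms(1) by (cases a) auto
  next
    case False
    then obtain a where "t = 2 * a + 1" using oddE by blast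
    then show ?thesis using \<sigma>(2)[of a] t \<open>t < Suc (Suc k)\<close> assms(1) by auto
  qed
  then have 0: "\<sigma> 0 = 0" using t by simp
  then have "\<sigma> (Suc 0) \<noteq> 0" using inj[of "Suc 0" 0] by simp
  then obtain j where j: "\<sigma> (Suc 0) = Suc j" by (cases "\<sigma> (Suc 0)") auto
  then have jk: "j < Suc k" using bound[of "Suc 0"] by simp
  have nz: "\<sigma> (Suc (Suc a)) \<noteq> 0" "\<sigma> (Suc (Suc a)) \<noteq> Suc j" for a
    using inj[of "Suc (Suc a)" 0] inj[of "Suc (Suc a)" "Suc 0"] 0 j by auto
  \<comment> \<open>The inverse of the renumbering in \<open>ext\<close>: the values 0 and
    \<open>Suc j\<close>, excluded by \<open>nz\<close>, are closed up.\<close>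
  define \<tau> where "\<tau> a = (let b = \<sigma> (Suc (Suc a)) - 1 in if b < j then b else b - 1)" for a
  have \<tau>: "\<sigma> (Suc (Suc a)) = Suc (ski j (\<tau> a))" for a
    using nz[of a] by (auto simp: \<tau>_def ski_def Let_def)
  have eq: "\<sigma> = ext j \<tau>" by (rule ext_eqI) (use 0 j \<tau> in auto)
  have "\<tau> permutes {..<k}"
  proof (rule bij_imp_permutes)
    have "inj_on \<tau> {..<k}"
    proof (rule inj_onI)
      fix a b assume "\<tau> a = \<tau> b"
      then have "\<sigma> (Suc (Suc a)) = \<sigma> (Suc (Suc b))" by (simp add: \<tau>)
      then show "a = b" by (simp add: inj)
    qed
    moreover have "\<tau> a < k" if "a < k" for a
      using bound[of "Suc (Suc a)"] \<tau>[of a] that jk by (auto simp: ski_def split: if_splits)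
    ultimately show "bij_betw \<tau> {..<k} {..<k}"
      by (metis bij_betw_def endo_inj_surj finite_lessThan image_subsetI lessThan_iff)
    fix a assume "a \<notin> {..<k}"
    then have "\<sigma> (Suc (Suc a)) = Suc (Suc a)" by (intro permutes_not_in[OF \<sigma>(1)]) simp
    then show "\<tau> a = a" using jk \<open>a \<notin> {..<k}\<close> by (auto simp: \<tau>_def)
  qed
  moreover have "\<tau> (2 * a) < \<tau> (2 * a + 1)" if "a < k div 2" for a
    using \<sigma>(2)[of "Suc a"] that by (simp add: eq)
  moreover have "\<tau> (2 * a) < \<tau> (2 * b)" if "a < b" "b < k div 2" for a b
    using \<sigma>(3)[of "Suc a" "Suc b"] that by (simp add: eq)
  ultimately have "\<tau> \<in> matching_perms k" by (auto simp: matching_perms_def)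
  then show ?thesis using that jk eq by blast
qed

text \<open>Matchings are sorted by the partner \<open>Suc j\<close> of the index 0;
  \<open>ext_permutes_sign\<close> gives the sign \<open>(- 1) ^ j\<close> relative to the matching
  that remains.\<close>

lemma pfl_Cons:
  assumes "odd (length L)"
  shows "pfl q (i # L) = (\<Sum>j<length L. (- 1) ^ j * q i (L ! j) * pfl q (del_nth j L))"
proof -
  obtain k where k: "length L = Suc k" "even k" using assms by (cases "length L") auto
  let ?S = "{..<Suc k} \<times> matching_perms k"
  let ?f = "\<lambda>\<sigma>. of_int (sign \<sigma>) * (\<Prod>a<Suc (k div 2). q ((i # L) ! \<sigma> (2 * a)) ((i # L) ! \<sigma> (2 * a + 1)))"
  have inj: "inj_on (\<lambda>(j, \<tau>). ext j \<tau>) ?S"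
  proof (rule inj_onI, clarify)
    fix j j' \<tau> \<tau>' assume e: "ext j \<tau> = ext j' \<tau>'"
    have "j = j'" using fun_cong[OF e, of "Suc 0"] by simp
    moreover have "\<tau> a = \<tau>' a" for a using fun_cong[OF e, of "Suc (Suc a)"] \<open>j = j'\<close> by simp
    ultimately show "j = j' \<and> \<tau> = \<tau>'" by auto
  qed
  have "matching_perms (Suc (Suc k)) = (\<lambda>(j, \<tau>). ext j \<tau>) ` ?S"
    using matching_perms_ext matching_perms_ext_surj[OF k(2)] by (auto simp: image_iff) blast+
  then have "pfl q (i # L) = sum ?f ((\<lambda>(j, \<tau>). ext j \<tau>) ` ?S)"
    unfolding pfl_def by (simp add: k del: prod.lessThan_Suc)
  also have "\<dots> = (\<Sum>(j, \<tau>)\<in>?S. ?f (ext j \<tau>))"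
    unfolding sum.reindex[OF inj] by (simp add: o_def case_prod_unfold del: prod.lessThan_Suc)
  also have "\<dots> = (\<Sum>(j, \<tau>)\<in>?S. (- 1) ^ j * q i (L ! j)
      * (of_int (sign \<tau>) * (\<Prod>a<k div 2. q (del_nth j L ! \<tau> (2 * a)) (del_nth j L ! \<tau> (2 * a + 1)))))"
  proof (rule sum.cong[OF refl], clarify)
    fix j \<tau> assume j: "j < Suc k" and \<tau>: "\<tau> \<in> matching_perms k"
    have perm: "\<tau> permutes {..<k}" using \<tau> by (simp add: matching_perms_def)
    have "\<tau> a < k" if "a < k" for a using permutes_in_image[OF perm, of a] that by simp
    then have nth: "L ! ski j (\<tau> a) = del_nth j L ! \<tau> a" if "a < k" for a
      using that j k by (subst nth_del_nth) (auto simp: ski_def)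
    have "(\<Prod>a<Suc (k div 2). q ((i # L) ! ext j \<tau> (2 * a)) ((i # L) ! ext j \<tau> (2 * a + 1)))
       = q i (L ! j) * (\<Prod>a<k div 2. q (L ! ski j (\<tau> (2 * a))) (L ! ski j (\<tau> (2 * a + 1))))"
      by (simp add: prod.lessThan_Suc_shift del: prod.lessThan_Suc)
    also have "(\<Prod>a<k div 2. q (L ! ski j (\<tau> (2 * a))) (L ! ski j (\<tau> (2 * a + 1))))
      = (\<Prod>a<k div 2. q (del_nth j L ! \<tau> (2 * a)) (del_nth j L ! \<tau> (2 * a + 1)))"
      by (rule prod.cong) (auto simp: nth)
    finally show "?f (ext j \<tau>) = (- 1) ^ j * q i (L ! j)
      * (of_int (sign \<tau>) * (\<Prod>a<k div 2. q (del_nth j L ! \<tau> (2 * a)) (del_nth j L ! \<tau> (2 * a + 1))))"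
      using ext_permutes_sign[OF j perm] by (simp add: mult_ac)
  qed
  also have "\<dots> = (\<Sum>j<length L. (- 1) ^ j * q i (L ! j) * pfl q (del_nth j L))"
    unfolding pfl_def using k by (simp add: sum.cartesian_product [symmetric] sum_distrib_left)
  finally show ?thesis .
qed

lemma pfl_Nil [simp]: "pfl q [] = 1"
proof -
  have "matching_perms 0 = {id}" by (auto simp: matching_perms_def)
  then show ?thesis by (simp add: pfl_def sign_id)
qed

section \<open>Products of creation operators as Pfaffians\<close>

definition phiL :: "nat \<Rightarrow> nat list \<Rightarrow> gfun" where
  "phiL n L = foldr (phi n) L (\<lambda>x. 1)"

lemma phiL_Nil [simp]: "phiL n [] = (\<lambda>x. 1)"
  by (simp add: phiL_def)

lemma phiL_Cons: "phiL n (i # L) = phi n i (phiL n L)"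
  by (simp add: phiL_def)

text \<open>The shape, a sum over deletions plus one multiple, is that of the right-hand side of
  \<open>aop_phiL\<close>, to which \<open>phi_linear\<close> is applied there.\<close>

lemma aop_linear:
  "aop n c (\<lambda>x. (\<Sum>j\<in>S. k j * F j x) + r * G x) x = (\<Sum>j\<in>S. k j * aop n c (F j) x) + r * aop n c G x"
proof -
  have "(\<Sum>j\<in>S. k j * aop n c (F j) x)
      = (\<Sum>m\<in>{1..n}. \<Sum>j\<in>S. k j * (co x m ^ c * F j (fl m x) / (\<Prod>j\<in>{1..n} - {m}. co x m - co x j)))"
    unfolding aop_def sum_distrib_left by (rule sum.swap)
  moreover have "r * aop n c G x = (\<Sum>m\<in>{1..n}. r * (co x m ^ c * G (fl m x) / (\<Prod>j\<in>{1..n} - {m}. co x m - co x j)))"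
    unfolding aop_def sum_distrib_left ..
  ultimately show ?thesis
    unfolding aop_def[of n c "\<lambda>x. (\<Sum>j\<in>S. k j * F j x) + r * G x"]
    by (simp add: sum.distrib [symmetric] distrib_left add_divide_distrib sum_distrib_left sum_divide_distrib mult_ac)
qed

lemma phi_linear:
  "phi n i (\<lambda>x. (\<Sum>j\<in>S. k j * F j x) + r * G x) x = (\<Sum>j\<in>S. k j * phi n i (F j) x) + r * phi n i G x"
proof -
  have "(\<Sum>j\<in>S. k j * phi n i (F j) x) = (\<Sum>q\<le>n - 1 + i. \<Sum>j\<in>S. k j * (gq n q x * aop n (n - 1 + i - q) (F j) x))"
    unfolding phi_def sum_distrib_left by (rule sum.swap)
  moreover have "r * phi n i G x = (\<Sum>q\<le>n - 1 + i. r * (gq n q x * aop n (n - 1 + i - q) G x))"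
    unfolding phi_def sum_distrib_left ..
  ultimately show ?thesis
    unfolding phi_def[of n i "\<lambda>x. (\<Sum>j\<in>S. k j * F j x) + r * G x"] aop_linear
    by (simp add: sum.distrib [symmetric] distrib_left sum_distrib_left mult_ac)
qed

text \<open>The annihilation operator is moved past one \<open>phi\<close> after another, changing
  sign each time and leaving a contraction where the part equals \<open>b\<close>. It finally meets
  the constant 1, which it kills unless \<open>b = 0\<close> (\<open>aop_one\<close>); hence the
  last term.\<close>

lemma aop_phiL:
  assumes "b < n" "set L \<subseteq> {..<n}"
  shows "aop n (n - 1 - b) (phiL n L) x
    = (\<Sum>j<length L. (- 1) ^ j * (if L ! j = b then 2 * (- 1) ^ b else 0) * phiL n (del_nth j L) x)
      + (if b = 0 then (- 1) ^ length L else 0) * phiL n L x"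
  using assms(2)
proof (induction L arbitrary: x)
  case Nil
  then show ?case using aop_one[of "n - 1 - b" n x] assms(1) by auto
next
  case (Cons i L)
  let ?k = "\<lambda>j. (- 1) ^ j * (if L ! j = b then 2 * (- 1) ^ b else 0) :: rat"
  let ?r = "if b = 0 then (- 1) ^ length L else 0 :: rat"
  have IH: "aop n (n - 1 - b) (phiL n L) = (\<lambda>x. (\<Sum>j<length L. ?k j * phiL n (del_nth j L) x) + ?r * phiL n L x)"
    using Cons by auto
  have "aop n (n - 1 - b) (phiL n (i # L)) x
     = (if i = b then 2 * (- 1) ^ b * phiL n L x else 0) - phi n i (aop n (n - 1 - b) (phiL n L)) x"
    unfolding phiL_Cons using aop_phi_anticommute[OF assms(1), of i "phiL n L" x] Cons.prems by (simp add: algebra_simps)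
  also have "phi n i (aop n (n - 1 - b) (phiL n L)) x
     = (\<Sum>j<length L. ?k j * phiL n (i # del_nth j L) x) + ?r * phiL n (i # L) x"
    unfolding IH phi_linear phiL_Cons ..
  finally show ?case
    by (simp add: sum.lessThan_Suc_shift sum_negf del: sum.lessThan_Suc)
qed

lemma kap_0 [simp]: "kap n i 0 x = es n i x"
  by (simp add: kap_def)

text \<open>In the form \<open>phi_eq_kap\<close>, \<open>aop_phiL\<close> leaves only those
  \<open>b\<close> that occur in \<open>L\<close>, and from \<open>b = 0\<close> the term with
  \<open>kap n i 0 x = es n i x\<close>.\<close>

lemma phiL_Cons_recursion:
  assumes "set (i # L) \<subseteq> {..<n}"
  shows "phiL n (i # L) x = (- 1) ^ length L * es n i x * phiL n L x
    + (\<Sum>j<length L. (- 1) ^ j * (2 * (- 1) ^ (L ! j) * kap n i (L ! j) x) * phiL n (del_nth j L) x)"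
proof -
  have n: "0 < n" using assms by auto
  have "phiL n (i # L) x = (\<Sum>b<n. kap n i b x * aop n (n - 1 - b) (phiL n L) x)"
    by (simp add: phiL_Cons phi_eq_kap)
  also have "\<dots> = (\<Sum>b<n. (\<Sum>j<length L. if b = L ! j then (- 1) ^ j * (2 * (- 1) ^ b * kap n i b x) * phiL n (del_nth j L) x else 0)
      + (if b = 0 then (- 1) ^ length L * kap n i b x * phiL n L x else 0))"
  proof (rule sum.cong[OF refl])
    fix b assume "b \<in> {..<n}"
    then have eq: "aop n (n - 1 - b) (phiL n L) x
      = (\<Sum>j<length L. (- 1) ^ j * (if L ! j = b then 2 * (- 1) ^ b else 0) * phiL n (del_nth j L) x)
        + (if b = 0 then (- 1) ^ length L else 0) * phiL n L x"
      using assms by (intro aop_phiL) auto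
    show "kap n i b x * aop n (n - 1 - b) (phiL n L) x
      = (\<Sum>j<length L. if b = L ! j then (- 1) ^ j * (2 * (- 1) ^ b * kap n i b x) * phiL n (del_nth j L) x else 0)
        + (if b = 0 then (- 1) ^ length L * kap n i b x * phiL n L x else 0)"
      unfolding eq distrib_left sum_distrib_left
      by (intro arg_cong2[where f = "(+)"] sum.cong) (auto simp: mult_ac)
  qed
  also have "\<dots> = (\<Sum>j<length L. \<Sum>b<n. if b = L ! j then (- 1) ^ j * (2 * (- 1) ^ b * kap n i b x) * phiL n (del_nth j L) x else 0)
      + (- 1) ^ length L * es n i x * phiL n L x"
    unfolding sum.distrib using n by (subst sum.swap) simp
  also have "(\<Sum>j<length L. \<Sum>b<n. if b = L ! j then (- 1) ^ j * (2 * (- 1) ^ b * kap n i b x) * phiL n (del_nth j L) x else 0)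
      = (\<Sum>j<length L. (- 1) ^ j * (2 * (- 1) ^ (L ! j) * kap n i (L ! j) x) * phiL n (del_nth j L) x)"
  proof (rule sum.cong[OF refl])
    fix j assume "j \<in> {..<length L}"
    then have "L ! j \<in> set L" by simp
    then have "L ! j < n" using assms by auto
    then show "(\<Sum>b<n. if b = L ! j then (- 1) ^ j * (2 * (- 1) ^ b * kap n i b x) * phiL n (del_nth j L) x else 0)
      = (- 1) ^ j * (2 * (- 1) ^ (L ! j) * kap n i (L ! j) x) * phiL n (del_nth j L) x"
      by simp
  qed
  finally show ?thesis by simp
qed

text \<open>The value of \<open>Qtilde2\<close> (\<open>EV_Qtilde2\<close>): in
  \<open>2 * kap\<close> the product \<open>es n i * es n j\<close> is counted twice, so one copy is
  taken off.\<close>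

definition q2 :: "nat \<Rightarrow> nat \<Rightarrow> nat \<Rightarrow> gfun" where
  "q2 n i j x = 2 * (- 1) ^ j * kap n i j x - es n i x * es n j x"

text \<open>The tail \<open>K\<close> has odd length, so \<open>alternating_deletion_sum\<close>
  spreads the term with \<open>es n i\<close> over the deletions from \<open>K\<close>. The
  coefficients then become \<open>q2\<close>, and the recursion is that of
  \<open>pfl_Cons\<close>.\<close>

lemma phiL_eq_pfl:
  assumes "even (length L)" "set L \<subseteq> {..<n}"
  shows "phiL n L x = pfl (\<lambda>i j. q2 n i j x) L"
  using assms
proof (induction "length L" arbitrary: L rule: less_induct)
  case less
  show ?case
  proof (cases L)
    case (Cons i K)
    let ?M = "\<lambda>i j. 2 * (- 1) ^ j * kap n i j x"
    have K: "odd (length K)" "set K \<subseteq> {..<n}" "set (i # K) \<subseteq> {..<n}" using less.prems Cons by auto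
    have S: "(\<Sum>j<length K. (- 1) ^ j * es n (K ! j) x * phiL n (del_nth j K) x) = phiL n K x"
      using alternating_deletion_sum[of "{..<n}" "\<lambda>L. phiL n L x" "\<lambda>i. es n i x" ?M K] phiL_Cons_recursion K(1,2) by simp
    have "phiL n (i # K) x = - es n i x * phiL n K x
        + (\<Sum>j<length K. (- 1) ^ j * ?M i (K ! j) * phiL n (del_nth j K) x)"
      using phiL_Cons_recursion[OF K(3), of x] K(1) by simp
    also have "\<dots> = (\<Sum>j<length K. (- 1) ^ j * q2 n i (K ! j) x * phiL n (del_nth j K) x)"
      unfolding S [symmetric] sum_distrib_left sum.distrib [symmetric] q2_def
      by (rule sum.cong) (simp_all add: algebra_simps)
    also have "\<dots> = (\<Sum>j<length K. (- 1) ^ j * q2 n i (K ! j) x * pfl (\<lambda>i j. q2 n i j x) (del_nth j K))"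
    proof (rule sum.cong[OF refl])
      fix j assume "j \<in> {..<length K}"
      then have "phiL n (del_nth j K) x = pfl (\<lambda>i j. q2 n i j x) (del_nth j K)"
        using K Cons set_del_nth[of j K] by (intro less.hyps) auto
      then show "(- 1) ^ j * q2 n i (K ! j) x * phiL n (del_nth j K) x
        = (- 1) ^ j * q2 n i (K ! j) x * pfl (\<lambda>i j. q2 n i j x) (del_nth j K)" by simp
    qed
    finally show ?thesis unfolding Cons pfl_Cons[OF K(1)] .
  qed simp
qed

section \<open>Action on \<open>P\<close>-tilde polynomials\<close>

lemma neg_one_power_diff: "m \<le> n \<Longrightarrow> (- 1 :: 'a::ring_1) ^ (n - m) = (- 1) ^ n * (- 1) ^ m"
  by (simp add: minus_one_power_iff)

abbreviation EV :: "dpoly \<Rightarrow> gfun" where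
  "EV f \<equiv> \<lambda>x. ev (co x) f"

text \<open>Injective points with positive coordinates are generic, so \<open>dpoly_eq_0I\<close>
  applies to functions on \<open>gpt\<close>.\<close>

lemma dpoly_eqI:
  assumes "EV f = EV g"
  shows "f = g"
proof -
  have "f - g = 0"
  proof (rule dpoly_eq_0I)
    fix x :: "nat \<Rightarrow> rat" assume pos: "\<And>i. x i > 0" and "inj x"
    have "x i \<noteq> - x j" for i j using pos[of i] pos[of j] by linarith
    then have "co (Abs_gpt x) = x" using \<open>inj x\<close> by (intro Abs_gpt_inverse) simp
    then show "ev x (f - g) = 0" using fun_cong[OF assms, of "Abs_gpt x"] by simp
  qed
  then show ?thesis by simp
qed

section \<open>Translation of the polynomials and operators into functions\<close>

lemma EV_Simple: "EV (divdiff (Simple i) f) = dd i (EV f)"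
proof
  fix x
  have "co x i \<noteq> co x (i + 1)" by simp
  moreover have "co x \<circ> Transposition.transpose i (i + 1) = co (sw i x)" by (simp add: sw.rep_eq)
  ultimately show "EV (divdiff (Simple i) f) x = dd i (EV f) x"
    using ev_divdiff_Simple[of "co x" i f] by (simp add: dd_def)
qed

lemma EV_Heart: "EV (divdiff Heart f) = tau (dd 1 (tau (EV f)))"
proof
  fix x
  have "- co x 1 \<noteq> co x 2" by (metis co_neq_minus)
  moreover have "(co x)(1 := - co x 2, 2 := - co x 1) = co (fl 1 (sw 1 (fl 1 x)))"
    by (auto simp: fun_eq_iff co_fl co_sw numeral_2_eq_2)
  ultimately show "EV (divdiff Heart f) x = tau (dd 1 (tau (EV f))) x"
    using ev_divdiff_Heart[of "co x" f] by (simp add: dd_def tau_def co_fl numeral_2_eq_2)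
qed

lemma EV_act_Simple: "EV (act f (map Simple w)) = dds w (EV f)"
  unfolding act_def by (induction w arbitrary: f) (simp_all only: list.map fold_simps EV_Simple)

lemma act_append: "act f (v @ w) = act (act f v) w"
  by (simp add: act_def)

text \<open>The second \<open>tau\<close> of \<open>\<partial>\<^sub>\<heartsuit>\<close> slides
  behind the letters \<open>2, ..., m - 1\<close>. What precedes it is then \<open>Om m\<close>, and
  together with the second run it forms \<open>Om (m - 1)\<close>.\<close>

lemma EV_act_nablaD_factor:
  assumes "m = n - 2 * j + 2"
  shows "EV (act f (nablaD_factor n j)) = Om (m - 1) (Om m (EV f))"
proof -
  have m: "2 \<le> m" "n - 2 * j + 1 = m - 1" using assms by auto
  have tau2: "dds [2..<m] (tau g) = tau (dds [2..<m] g)" for g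
    by (rule dds_tau_commute) auto
  have "act f (nablaD_factor n j) = act (act (divdiff Heart f) (map Simple [2..<m])) (map Simple [1..<m - 1])"
    unfolding nablaD_factor_def assms [symmetric] m by (simp add: act_def)
  then have "EV (act f (nablaD_factor n j)) = dds [1..<m - 1] (dds [2..<m] (tau (dd 1 (tau (EV f)))))"
    by (simp only: EV_act_Simple EV_Heart)
  also have "\<dots> = Om (m - 1) (Om m (EV f))"
    unfolding Om_def upt_1_split[OF m(1)] tau2 by simp
  finally show ?thesis .
qed

lemma Omc_Suc_right: "Omc n (Suc r) f = Om (n - r) (Omc n r f)"
proof (induction r arbitrary: n f)
  case (Suc r)
  have "Omc n (Suc (Suc r)) f = Omc (n - 1) (Suc r) (Om n f)" by simp
  also have "\<dots> = Om (n - 1 - r) (Omc (n - 1) r (Om n f))" by (rule Suc.IH)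
  finally show ?case by simp
qed simp

lemma EV_act_nablaD: "2 * k \<le> n \<Longrightarrow> EV (act f (nablaD n k)) = Omc n (2 * k) (EV f)"
proof (induction k)
  case 0
  then show ?case by (simp add: nablaD_def act_def)
next
  case (Suc k)
  have "nablaD n (Suc k) = nablaD n k @ nablaD_factor n (Suc k)" by (simp add: nablaD_def)
  moreover have "EV (act (act f (nablaD n k)) (nablaD_factor n (Suc k)))
      = Om (n - 2 * k - 1) (Om (n - 2 * k) (EV (act f (nablaD n k))))"
    by (rule EV_act_nablaD_factor) (use Suc.prems in simp)
  moreover have "EV (act f (nablaD n k)) = Omc n (2 * k) (EV f)"
    by (rule Suc.IH) (use Suc.prems in simp)
  moreover have "2 * Suc k = Suc (Suc (2 * k))" "n - 2 * k - 1 = n - Suc (2 * k)" by simp_all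
  ultimately show ?case by (simp only: act_append Omc_Suc_right)
qed

lemma ev_alternant: "ev (co x) (alternant \<mu>) = vdet (\<lambda>a. co x (1 + a)) \<mu>"
proof -
  interpret comm_ring_hom "ev (co x)" by (rule comm_ring_hom_ev)
  show ?thesis
    unfolding alternant_def vdet_def hom_det [symmetric]
    by (intro arg_cong[where f = det] eq_matI) auto
qed

text \<open>The quotient of the alternants is exhibited as a polynomial \<open>q\<close>, the image
  of a monomial under genuine divided differences; \<open>dds_wd_lmono\<close> verifies the product
  on points.\<close>

lemma EV_schur:
  fixes lam :: "nat list"
  defines "r \<equiv> length lam"
  defines "d \<equiv> map (\<lambda>j. lam ! j + (r - 1 - j)) [0..<r]"
  shows "EV (schur lam) = dds (wd 1 r) (lmono 1 d)"
proof -
  define q where "q = act (\<Prod>j<r. X (1 + j) ^ (d ! j)) (map Simple (wd 1 r))"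
  have d: "length d = r" by (simp add: d_def)
  have "EV (\<Prod>j<r. X (1 + j) ^ (d ! j)) = lmono 1 d"
    by (simp add: fun_eq_iff lmono_def d)
  then have q: "EV q = dds (wd 1 r) (lmono 1 d)" by (simp only: q_def EV_act_Simple)
  have "EV (q * alternant (staircase r)) = EV (alternant d)"
    using dds_wd_lmono[of 1 d] by (simp add: ev_alternant fun_cong[OF q] d)
  then have "q * alternant (staircase r) = alternant d" by (rule dpoly_eqI)
  moreover have "alternant (staircase r) \<noteq> 0"
  proof
    assume "alternant (staircase r) = 0"
    then have "vdet (\<lambda>a. co x (1 + a)) (staircase r) = 0" for x using ev_alternant[of x "staircase r"] by simp
    then show False using vdet_staircase_neq_0[of "\<lambda>a. co undefined (1 + a)" r] by (auto simp: inj_on_def)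
  qed
  ultimately have "exact_quot (alternant d) (alternant (staircase r)) = q" by (rule exact_quot_eqI)
  then have "schur lam = q" by (simp add: schur_def Let_def d_def r_def staircase_def)
  then show ?thesis using q by simp
qed

lemma EV_esym: "EV (esym n i) = es n i"
proof
  fix x
  have 1: "(\<Prod>j\<in>S. [:0, co x j:]) = Polynomial.monom (\<Prod>j\<in>S. co x j) (card S)" for S
    by (induction S rule: infinite_finite_induct) (simp_all add: monom_Suc flip: smult_monom)
  have "es n i x = Polynomial.coeff (\<Prod>j\<in>{1..n}. [:0, co x j:] + 1) i"
    by (simp add: es_def one_pCons)
  also have "\<dots> = (\<Sum>S\<in>Pow {1..n}. if card S = i then \<Prod>j\<in>S. co x j else 0)"
    by (subst prod_add) (simp_all add: 1 Polynomial.coeff_sum)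
  also have "\<dots> = (\<Sum>S\<in>{S \<in> Pow {1..n}. card S = i}. \<Prod>j\<in>S. co x j)"
    by (rule sum.inter_filter [symmetric]) simp
  also have "\<dots> = EV (esym n i) x"
    by (simp add: esym_def Pow_def)
  finally show "EV (esym n i) x = es n i x" ..
qed

lemma EV_Qtilde2: "EV (Qtilde2 n i j) = q2 n i j"
proof
  fix x
  have "(- 1) ^ j * kap n i j x = (\<Sum>q\<le>j. (- 1) ^ (j - q) * es n (i + (j - q)) x * es n q x)"
    unfolding kap_def sum_distrib_left
  proof (rule sum.cong[OF refl])
    fix q assume "q \<in> {..j}"
    then have "(- 1 :: rat) ^ (j - q) = (- 1) ^ j * (- 1) ^ q" "i + j - q = i + (j - q)"
      by (simp_all add: neg_one_power_diff)
    then show "(- 1) ^ j * ((- 1) ^ q * es n q x * es n (i + j - q) x) = (- 1) ^ (j - q) * es n (i + (j - q)) x * es n q x"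
      by (simp add: mult_ac)
  qed
  also have "\<dots> = (\<Sum>p\<le>j. (- 1) ^ p * es n (i + p) x * es n (j - p) x)"
    by (rule sum.reindex_bij_witness[of _ "\<lambda>p. j - p" "\<lambda>p. j - p"]) auto
  also have "\<dots> = es n i x * es n j x + (\<Sum>p = 1..j. (- 1) ^ p * es n (i + p) x * es n (j - p) x)"
    by (simp add: atMost_atLeast0 sum.atLeast_Suc_atMost)
  finally show "EV (Qtilde2 n i j) x = q2 n i j x"
    using fun_cong[OF EV_esym] by (simp add: Qtilde2_def q2_def)
qed

lemma ev_pfaffian_Qtilde_mat: "ev (co x) (pfaffian (Qtilde_mat n L)) = pfl (\<lambda>i j. q2 n i j x) L"
proof -
  have "ev (co x) (\<Prod>a<length L div 2. Qtilde_mat n L $$ (\<sigma> (2 * a), \<sigma> (2 * a + 1)))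
    = (\<Prod>a<length L div 2. q2 n (L ! \<sigma> (2 * a)) (L ! \<sigma> (2 * a + 1)) x)" if "\<sigma> \<in> matching_perms (length L)" for \<sigma>
    unfolding ev_prod
  proof (rule prod.cong[OF refl])
    fix a assume a: "a \<in> {..<length L div 2}"
    have "\<sigma> b < length L" if "b < length L" for b
      using permutes_in_image[of \<sigma> "{..<length L}" b] that \<open>\<sigma> \<in> _\<close> by (auto simp: matching_perms_def)
    moreover have "2 * a + 1 < length L" using a by auto
    ultimately have "\<sigma> (2 * a) < length L" "\<sigma> (2 * a + 1) < length L" by auto
    moreover have "\<sigma> (2 * a) < \<sigma> (2 * a + 1)" using that a by (auto simp: matching_perms_def)
    ultimately show "ev (co x) (Qtilde_mat n L $$ (\<sigma> (2 * a), \<sigma> (2 * a + 1))) = q2 n (L ! \<sigma> (2 * a)) (L ! \<sigma> (2 * a + 1)) x"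
      using fun_cong[OF EV_Qtilde2] by (simp add: Qtilde_mat_def)
  qed
  moreover have "dim_row (Qtilde_mat n L) = length L" by (simp add: Qtilde_mat_def)
  ultimately show ?thesis
    unfolding pfaffian_def pfl_def by (simp del: ev_prod)
qed

text \<open>The appended 0 acts first, on the constant 1, and fixes it. This matches the padding in
  \<open>Qtilde\<close>.\<close>

lemma phiL_snoc_0: "0 < n \<Longrightarrow> phiL n (L @ [0]) = phiL n L"
proof -
  assume n: "0 < n"
  have "phiL n [0] x = 1" for x using phiL_Cons_recursion[of 0 "[]" n x] n by simp
  then have "phi n 0 (\<lambda>x. 1) = (\<lambda>x. 1)" by (simp add: phiL_def fun_eq_iff)
  then show ?thesis by (simp add: phiL_def)
qed

lemma EV_Qtilde:
  assumes "0 < n" "set L \<subseteq> {..<n}"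
  shows "EV (Qtilde n L) = phiL n L"
proof
  fix x
  show "EV (Qtilde n L) x = phiL n L x"
    using assms phiL_eq_pfl[of L n x] phiL_eq_pfl[of "L @ [0]" n x]
    by (auto simp: Qtilde_def ev_pfaffian_Qtilde_mat phiL_snoc_0)
qed

lemma sym_on_es: "sym_on 1 n (es n i)"
  unfolding sym_on_def
proof (intro allI impI)
  fix l x assume l: "1 \<le> l" "l < n"
  have "(\<Prod>j\<in>{1..n}. [:1, co (sw l x) j:]) = (\<Prod>j\<in>{1..n}. [:1, co x j:])"
    by (rule prod.reindex_bij_witness[of _ "Transposition.transpose l (Suc l)" "Transposition.transpose l (Suc l)"])
      (use l in \<open>auto simp: sw.rep_eq Transposition.transpose_def split: if_splits\<close>)
  then show "es n i (sw l x) = es n i x" by (simp add: es_def)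
qed

lemma sym_on_phiL:
  assumes "0 < n" "set L \<subseteq> {..<n}"
  shows "sym_on 1 n (phiL n L)"
proof -
  have "sym_on 1 n (phiL n L)" if "even (length L)" "set L \<subseteq> {..<n}" for L
    using sym_on_es[of n] unfolding sym_on_def phiL_eq_pfl[OF that] pfl_def q2_def kap_def by simp
  from this[of L] this[of "L @ [0]"] show ?thesis
    using assms by (cases "even (length L)") (auto simp: phiL_snoc_0)
qed

section \<open>Erasing parts from \<open>P\<close>-tilde polynomials\<close>

definition PP :: "nat \<Rightarrow> nat list \<Rightarrow> gfun" where
  "PP n I x = (1 / 2) ^ length I * phiL n I x"

lemma EV_Ptilde:
  assumes "0 < n" "set I \<subseteq> {..<n}" "0 \<notin> set I"
  shows "EV (Ptilde n I) = PP n I"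
proof -
  have "filter (\<lambda>i. i \<noteq> 0) I = I" by (intro filter_True ballI notI) (use assms(3) in auto)
  then have "num_parts I = length I" by (simp add: num_parts_def)
  moreover have "Rep_dyadic (half ^ k) = (1 / 2) ^ k" for k
    by (induction k) (simp_all add: dyadic_rep)
  ultimately show ?thesis
    using fun_cong[OF EV_Qtilde[OF assms(1,2)]] by (simp add: fun_eq_iff Ptilde_def PP_def)
qed

text \<open>By \<open>Om_eq_aop\<close> this is the step with exponent \<open>n - 1 - b\<close> on
  symmetric functions, indexed by the part \<open>b\<close> that it erases.\<close>

definition ann :: "nat \<Rightarrow> nat \<Rightarrow> gfun \<Rightarrow> gfun" where
  "ann n b f x = (- 1) ^ (n - 1 - b) * aop n (n - 1 - b) f x"

lemma ann_scale: "ann n b (\<lambda>x. k * f x) = (\<lambda>x. k * ann n b f x)"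
  by (simp add: ann_def aop_def fun_eq_iff sum_distrib_left mult_ac)

lemma ann_zero: "ann n b (\<lambda>x. 0) = (\<lambda>x. 0)"
  using ann_scale[of n b 0 "\<lambda>x. 0"] by simp

lemma fold_ann_scale: "fold (ann n) bs (\<lambda>x. k * f x) = (\<lambda>x. k * fold (ann n) bs f x)"
  by (induction bs arbitrary: f) (simp_all add: ann_scale)

lemma fold_Om_eq_ann:
  assumes "sym_on 1 n f" "1 \<le> n" "\<forall>c\<in>set d. c < n"
  shows "fold (\<lambda>c f. Om n (\<lambda>x. co x 1 ^ c * f x)) d f = fold (ann n) (map (\<lambda>c. n - 1 - c) d) f"
  using assms
proof (induction d arbitrary: f)
  case (Cons c d)
  have "Om n (\<lambda>x. co x 1 ^ c * f x) = ann n (n - 1 - c) f"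
    unfolding Om_eq_aop[OF Cons.prems(1,2)] using Cons.prems(3) by (simp add: ann_def fun_eq_iff)
  then show ?case using Cons.IH[OF sym_on_Om[OF Cons.prems(1), of c]] Cons.prems by simp
qed simp

text \<open>The origin of \<open>s''\<close>: the value 0 only contributes the sign from passing all
  parts. The factor \<open>(- 1) ^ n\<close> is kept apart, as every step has it.\<close>

lemma ann_PP_0:
  assumes "0 < n" "set I \<subseteq> {..<n}" "0 \<notin> set I"
  shows "ann n 0 (PP n I) = (\<lambda>x. (- 1) ^ n * (- 1) ^ Suc (length I) * PP n I x)"
proof
  fix x
  have "aop n (n - 1) (PP n I) x = (1 / 2) ^ length I * aop n (n - 1) (phiL n I) x"
    by (simp add: aop_def PP_def sum_distrib_left mult_ac)
  also have "aop n (n - 1) (phiL n I) x = (- 1) ^ length I * phiL n I x"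
  proof -
    have "(\<Sum>j<length I. (- 1) ^ j * (if I ! j = 0 then 2 * (- 1) ^ 0 else 0) * phiL n (del_nth j I) x) = 0"
      by (rule sum.neutral) (use assms(3) nth_mem[of _ I] in \<open>metis lessThan_iff mult_zero_left mult_zero_right\<close>)
    then show ?thesis using aop_phiL[of 0 n I x] assms by simp
  qed
  finally have "aop n (n - 1) (PP n I) x = (- 1) ^ length I * PP n I x"
    unfolding PP_def[of n I x] by (simp only: mult.left_commute)
  then show "ann n 0 (PP n I) x = (- 1) ^ n * (- 1) ^ Suc (length I) * PP n I x"
    using neg_one_power_diff[of 1 n, where 'a = rat] assms(1) by (simp add: ann_def mult_ac)
qed

text \<open>The 2 of the contraction makes up for the power of 1/2 belonging to the erased part. The
  signs \<open>(- 1) ^ (n - 1 - b)\<close> and \<open>(- 1) ^ b\<close> combine to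
  \<open>- ((- 1) ^ n)\<close>; the extra minus turns the index \<open>p\<close> into the position
  \<open>Suc p\<close>, counted from 1.\<close>

lemma ann_PP:
  assumes "0 < b" "b < n" "set I \<subseteq> {..<n}" "distinct I"
  shows "b \<notin> set I \<Longrightarrow> ann n b (PP n I) = (\<lambda>x. 0)"
    and "p < length I \<Longrightarrow> I ! p = b \<Longrightarrow> ann n b (PP n I) = (\<lambda>x. (- 1) ^ n * (- 1) ^ Suc p * PP n (del_nth p I) x)"
proof -
  have eq: "ann n b (PP n I) x = (- 1) ^ (n - 1 - b) * (1 / 2) ^ length I
     * (\<Sum>j<length I. if I ! j = b then (- 1) ^ j * (2 * (- 1) ^ b) * phiL n (del_nth j I) x else 0)" for x
  proof -
    have "aop n (n - 1 - b) (PP n I) x = (1 / 2) ^ length I * aop n (n - 1 - b) (phiL n I) x"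
      by (simp add: aop_def PP_def sum_distrib_left mult_ac)
    also have "aop n (n - 1 - b) (phiL n I) x
      = (\<Sum>j<length I. if I ! j = b then (- 1) ^ j * (2 * (- 1) ^ b) * phiL n (del_nth j I) x else 0)"
      unfolding aop_phiL[OF assms(2,3)] using assms(1) by (auto intro!: sum.cong)
    finally show ?thesis by (simp add: ann_def)
  qed
  show "ann n b (PP n I) = (\<lambda>x. 0)" if "b \<notin> set I"
  proof
    fix x
    have "(\<Sum>j<length I. if I ! j = b then (- 1) ^ j * (2 * (- 1) ^ b) * phiL n (del_nth j I) x else 0) = 0"
      by (rule sum.neutral) (use that in auto)
    then show "ann n b (PP n I) x = 0" by (simp add: eq)
  qed
  show "ann n b (PP n I) = (\<lambda>x. (- 1) ^ n * (- 1) ^ Suc p * PP n (del_nth p I) x)" if p: "p < length I" "I ! p = b"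
  proof
    fix x
    have "(\<Sum>j<length I. if I ! j = b then (- 1) ^ j * (2 * (- 1) ^ b) * phiL n (del_nth j I) x else 0)
      = (\<Sum>j<length I. if j = p then (- 1) ^ j * (2 * (- 1) ^ b) * phiL n (del_nth j I) x else 0)"
      by (rule sum.cong) (use p nth_eq_iff_index_eq[OF assms(4)] in auto)
    then have sum: "(\<Sum>j<length I. if I ! j = b then (- 1) ^ j * (2 * (- 1) ^ b) * phiL n (del_nth j I) x else 0)
      = (- 1) ^ p * (2 * (- 1) ^ b) * phiL n (del_nth p I) x" using p by simp
    have h: "(1 / 2 :: rat) ^ length I * 2 = (1 / 2) ^ length (del_nth p I)" using p by (cases "length I") auto
    have e: "(- 1 :: rat) ^ (n - 1 - b) * (- 1) ^ b = - ((- 1) ^ n)"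
      using neg_one_power_diff[of "Suc b" n, where 'a = rat] assms(2) by (simp add: mult_ac flip: power_mult_distrib)
    have gen: "A * h * (r * (2 * s) * F) = (A * s) * r * ((h * 2) * F)" for A h r s F :: rat
      by simp
    show "ann n b (PP n I) x = (- 1) ^ n * (- 1) ^ Suc p * PP n (del_nth p I) x"
      unfolding eq sum gen h e PP_def[of n "del_nth p I" x] by simp
  qed
qed

text \<open>Smaller parts are erased first, so the positions of the parts still to be erased do not change.\<close>

lemma fold_ann_PP:
  assumes "set I \<subseteq> {..<n}" "sorted_wrt (>) I" "sorted_wrt (<) bs" "set bs \<subseteq> {0<..<n}"
  shows "fold (ann n) bs (PP n I) = (if set bs \<subseteq> set I
    then (\<lambda>x. (- 1) ^ (n * length bs + (\<Sum>p | p < length I \<and> I ! p \<in> set bs. Suc p)) * PP n (filter (\<lambda>i. i \<notin> set bs) I) x)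
    else (\<lambda>x. 0))"
  using assms(3,4)
proof (induction bs rule: rev_induct)
  case (snoc b bs)
  have IH: "fold (ann n) bs (PP n I) = (if set bs \<subseteq> set I
    then (\<lambda>x. (- 1) ^ (n * length bs + (\<Sum>p | p < length I \<and> I ! p \<in> set bs. Suc p)) * PP n (filter (\<lambda>i. i \<notin> set bs) I) x)
    else (\<lambda>x. 0))"
    by (rule snoc.IH) (use snoc.prems in \<open>auto simp: sorted_wrt_append\<close>)
  have b: "0 < b" "b < n" "\<forall>c\<in>set bs. c < b" using snoc.prems by (auto simp: sorted_wrt_append)
  define J where "J = filter (\<lambda>i. i \<notin> set bs) I"
  have dI: "distinct I" using assms(2) by (induction I) auto
  have J: "set J \<subseteq> {..<n}" "distinct J" "b \<in> set J \<longleftrightarrow> b \<in> set I"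
    using assms(1) dI b by (auto simp: J_def)
  show ?case
  proof (cases "set bs \<subseteq> set I")
    case sub: True
    define s where "s = n * length bs + (\<Sum>p | p < length I \<and> I ! p \<in> set bs. Suc p)"
    have fold: "fold (ann n) (bs @ [b]) (PP n I) = (\<lambda>x. (- 1) ^ s * ann n b (PP n J) x)"
      using IH sub by (simp add: ann_scale s_def J_def)
    show ?thesis
    proof (cases "b \<in> set I")
      case True
      then obtain p where p: "p < length I" "I ! p = b" by (auto simp: in_set_conv_nth)
      have I: "I = take p I @ b # drop (Suc p) I" using id_take_nth_drop[OF p(1)] p(2) by simp
      have gt: "\<forall>i\<in>set (take p I). i > b" and lt: "\<forall>i\<in>set (drop (Suc p) I). i < b"
        using assms(2) by (subst (asm) I, simp add: sorted_wrt_append)+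
      have t: "filter (\<lambda>i. i \<notin> set bs) (take p I) = take p I" "filter (\<lambda>i. i \<notin> set (bs @ [b])) (take p I) = take p I"
        using gt b(3) by (fastforce intro: filter_True)+
      have dr: "filter (\<lambda>i. i \<notin> set (bs @ [b])) (drop (Suc p) I) = filter (\<lambda>i. i \<notin> set bs) (drop (Suc p) I)"
        using lt by (intro filter_cong) auto
      have "b \<notin> set bs" using b(3) by auto
      then have JI: "J = take p I @ b # filter (\<lambda>i. i \<notin> set bs) (drop (Suc p) I)"
        unfolding J_def by (subst I) (simp only: filter_append t, simp)
      have del: "del_nth p J = filter (\<lambda>i. i \<notin> set (bs @ [b])) I"
      proof -
        have "filter (\<lambda>i. i \<notin> set (bs @ [b])) I = take p I @ filter (\<lambda>i. i \<notin> set bs) (drop (Suc p) I)"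
          by (subst I) (simp only: filter_append t filter.simps dr, simp)
        then show ?thesis using p unfolding JI by (simp add: del_nth_def)
      qed
      have "p < length J" "J ! p = b" using p unfolding JI by (auto simp: nth_append)
      note ann = ann_PP(2)[OF b(1,2) J(1,2) this]
      have "{q. q < length I \<and> I ! q \<in> set (bs @ [b])} = insert p {q. q < length I \<and> I ! q \<in> set bs}"
        using p nth_eq_iff_index_eq[OF dI] by auto
      moreover have "p \<notin> {q. q < length I \<and> I ! q \<in> set bs}" using p \<open>b \<notin> set bs\<close> by auto
      ultimately have "(\<Sum>q | q < length I \<and> I ! q \<in> set (bs @ [b]). Suc q)
          = Suc p + (\<Sum>q | q < length I \<and> I ! q \<in> set bs. Suc q)" by simp
      then have "n * length (bs @ [b]) + (\<Sum>q | q < length I \<and> I ! q \<in> set (bs @ [b]). Suc q) = s + (n + Suc p)"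
        by (simp add: s_def)
      then show ?thesis
        unfolding fold ann del using sub True by (simp only: power_add) (simp add: mult.assoc)
    next
      case False
      then show ?thesis using fold ann_PP(1)[OF b(1,2) J(1,2)] J(3) by simp
    qed
  next
    case False
    then have "fold (ann n) bs (PP n I) = (\<lambda>x. 0)" using IH by (simp only: if_False)
    moreover have "\<not> set (bs @ [b]) \<subseteq> set I" using False by auto
    ultimately show ?thesis by (simp only: fold_append fold_simps comp_apply id_apply ann_zero if_False)
  qed
qed simp

theorem theorem11:
  fixes n k :: nat and I \<alpha> :: "nat list"
  assumes "0 < n" and "0 < k" and "2 * k \<le> n"
    and "strict_partition I" and "diagram_subset I (rho (n - 1))"
    and "length \<alpha> = 2 * k" and "sorted \<alpha>" and "\<alpha> ! (2 * k - 1) \<le> n - 2 * k"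
  shows "let E = {n - p - \<alpha> ! (p - 1) | p. p \<in> {1..2 * k}};
             R = act (Ptilde n I * Y \<alpha>) (nablaD n k);
             J = filter (\<lambda>i. i \<notin> E) I;
             s' = (\<Sum>p | p \<in> {1..length I} \<and> I ! (p - 1) \<in> E. p);
             s'' = length I + 1;
             s = (if \<alpha> ! (2 * k - 1) < n - 2 * k then s' else s' + s'')
         in (\<not> E \<subseteq> set I \<union> {0} \<longrightarrow> R = 0) \<and>
            (E \<subseteq> set I \<union> {0} \<longrightarrow> R = (- 1) ^ s * Ptilde n J)"
proof -
  define E where "E = {n - p - \<alpha> ! (p - 1) | p. p \<in> {1..2 * k}}"
  define R where "R = act (Ptilde n I * Y \<alpha>) (nablaD n k)"
  define s' where "s' = (\<Sum>p | p \<in> {1..length I} \<and> I ! (p - 1) \<in> E. p)"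
  define d where "d = map (\<lambda>j. rev \<alpha> ! j + (2 * k - 1 - j)) [0..<2 * k]"
  \<comment> \<open>\<open>bs ! j\<close> is the number \<open>n - p - \<alpha> ! (p - 1)\<close>
    for \<open>p = 2 * k - j\<close>; the order is thus increasing.\<close>
  define bs where "bs = map (\<lambda>c. n - 1 - c) d"
  have I: "sorted_wrt (>) I" "0 \<notin> set I" using assms(4) by (auto simp: strict_partition_def)
  have In: "set I \<subseteq> {..<n}"
  proof
    fix i assume "i \<in> set I"
    then obtain p where p: "p < length I" "I ! p = i" by (auto simp: in_set_conv_nth)
    have "part I p \<le> part (rho (n - 1)) p" using assms(5) by (auto simp: diagram_subset_def)
    also have "\<dots> < n"
    proof (cases "p < length (rho (n - 1))")
      case True
      then have "rho (n - 1) ! p \<in> set (rho (n - 1))" by (rule nth_mem)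
      then show ?thesis using True assms(1) by (auto simp: part_def rho_def)
    qed (use assms(1) in \<open>simp add: part_def\<close>)
    finally show "i \<in> {..<n}" using p by (simp add: part_def)
  qed
  have ld: "length d = 2 * k" by (simp add: d_def)
  have dj: "d ! j = \<alpha> ! (2 * k - 1 - j) + (2 * k - 1 - j)" if "j < 2 * k" for j
    using that assms(6) by (simp add: d_def rev_nth)
  have \<alpha>: "\<alpha> ! i \<le> n - 2 * k" if "i < 2 * k" for i
  proof -
    have "\<alpha> ! i \<le> \<alpha> ! (2 * k - 1)"
      by (rule sorted_nth_mono[OF assms(7)]) (use that assms(6) in auto)
    then show ?thesis using assms(8) by (rule order_trans)
  qed
  \<comment> \<open>The bound on the largest entry of \<open>\<alpha>\<close> is exactly the degree
    condition of \<open>Omc_lmono\<close>.\<close>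
  have dle: "d ! j + j + 1 \<le> n" if "j < 2 * k" for j
    using dj[OF that] \<alpha>[of "2 * k - 1 - j"] that assms(3) by simp
  have bj: "bs ! j = n - 1 - d ! j" if "j < 2 * k" for j using that ld by (simp add: bs_def)
  have sym: "sym_on 1 n (PP n I)"
    using sym_on_phiL[OF assms(1) In] by (simp add: sym_on_def PP_def)
  have "EV R = Omc n (2 * k) (\<lambda>x. PP n I x * dds (wd 1 (2 * k)) (lmono 1 d) x)"
    using fun_cong[OF EV_Ptilde[OF assms(1) In I(2)]] fun_cong[OF EV_schur[of "rev \<alpha>"]] assms(3,6)
    by (simp add: R_def EV_act_nablaD Y_def d_def)
  also have "(\<lambda>x. PP n I x * dds (wd 1 (2 * k)) (lmono 1 d) x) = dds (wd 1 (length d)) (\<lambda>x. PP n I x * lmono 1 d x)"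
    unfolding ld by (rule dds_mult_sym[OF sym, symmetric]) (use set_wd[of 1 "2 * k"] assms(3) in auto)
  also have "Omc n (2 * k) \<dots> = fold (\<lambda>c f. Om n (\<lambda>x. co x 1 ^ c * f x)) d (PP n I)"
    unfolding ld [symmetric] by (rule Omc_lmono[OF sym]) (use ld dle assms(3) in auto)
  also have "\<dots> = fold (ann n) bs (PP n I)"
    unfolding bs_def by (rule fold_Om_eq_ann[OF sym]) (use assms(1) dle ld in \<open>auto simp: in_set_conv_nth, fastforce\<close>)
  finally have R: "EV R = fold (ann n) bs (PP n I)" .
  have lbs: "length bs = 2 * k" by (simp add: bs_def ld)
  have setbs: "set bs = E"
  proof -
    have "E = (\<lambda>p. n - p - \<alpha> ! (p - 1)) ` {1..2 * k}" by (auto simp: E_def)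
    also have "{1..2 * k} = (\<lambda>j. 2 * k - j) ` {..<2 * k}"
    proof -
      have "p \<in> (\<lambda>j. 2 * k - j) ` {..<2 * k}" if "p \<in> {1..2 * k}" for p
        using that by (intro image_eqI[of _ _ "2 * k - p"]) auto
      then show ?thesis by auto
    qed
    also have "(\<lambda>p. n - p - \<alpha> ! (p - 1)) ` \<dots> = (\<lambda>j. bs ! j) ` {..<2 * k}"
      unfolding image_image
    proof (rule image_cong[OF refl])
      fix j assume "j \<in> {..<2 * k}"
      then show "n - (2 * k - j) - \<alpha> ! (2 * k - j - 1) = bs ! j"
        using assms(3) by (simp add: bj dj)
    qed
    also have "\<dots> = set bs" by (auto simp: in_set_conv_nth lbs)
    finally show ?thesis ..
  qed
  have sorted: "sorted_wrt (<) bs"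
    unfolding sorted_wrt_iff_nth_less lbs
  proof (intro allI impI)
    fix i j assume ij: "i < j" "j < 2 * k"
    have "\<alpha> ! (2 * k - 1 - j) \<le> \<alpha> ! (2 * k - 1 - i)"
      by (rule sorted_nth_mono[OF assms(7)]) (use ij assms(6) in auto)
    then have "d ! j < d ! i" using ij by (simp add: dj)
    then show "bs ! i < bs ! j" using ij dle[of i] by (simp add: bj)
  qed
  have bsn: "set bs \<subseteq> {..<n}" using assms(1) by (auto simp: bs_def)
  have b0: "bs ! 0 = n - 2 * k - \<alpha> ! (2 * k - 1)"
    using assms(2,3) by (simp add: bj dj)
  \<comment> \<open>Only the smallest number \<open>b = n - 2 * k - \<alpha> ! (2 * k - 1)\<close>
    can be 0, so it alone is split off.\<close>
  obtain b bs' where bs: "bs = b # bs'" using lbs assms(2) by (cases bs) auto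
  have pos: "set bs' \<subseteq> {0<..<n}" "sorted_wrt (<) bs'" "length bs' = 2 * k - 1"
  proof
    fix x assume x: "x \<in> set bs'"
    then have "b < x" using sorted unfolding bs by simp
    moreover have "x < n" using x bsn unfolding bs by auto
    ultimately show "x \<in> {0<..<n}" by simp
  qed (use sorted lbs in \<open>auto simp: bs\<close>)
  have sum: "(\<Sum>p | p < length I \<and> I ! p \<in> A. Suc p) = (\<Sum>p | p \<in> {1..length I} \<and> I ! (p - 1) \<in> A. p)" for A
    by (rule sum.reindex_bij_witness[of _ "\<lambda>p. p - 1" Suc]) auto
  have key: "EV R = (if E \<subseteq> set I \<union> {0}
    then (\<lambda>x. (- 1) ^ (if \<alpha> ! (2 * k - 1) < n - 2 * k then s' else s' + (length I + 1)) * PP n (filter (\<lambda>i. i \<notin> E) I) x)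
    else (\<lambda>x. 0))"
  proof (cases "\<alpha> ! (2 * k - 1) < n - 2 * k")
    case True
    then have "0 < b" "b < n" using b0 bsn unfolding bs by simp_all
    then have bpos: "set bs \<subseteq> {0<..<n}" using pos(1) unfolding bs by simp
    then have "E \<subseteq> set I \<union> {0} \<longleftrightarrow> set bs \<subseteq> set I" unfolding setbs [symmetric] by auto
    \<comment> \<open>The factors \<open>(- 1) ^ n\<close> of the \<open>2 * k\<close> steps
      cancel.\<close>
    moreover have "(- 1 :: rat) ^ (n * (2 * k) + m) = (- 1) ^ m" for m
      by (simp add: minus_one_power_iff)
    ultimately show ?thesis
      unfolding R fold_ann_PP[OF In I(1) sorted bpos] using True
      by (simp add: setbs sum s'_def lbs)
  next
    case False
    then have b: "b = 0" using b0 unfolding bs by simp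
    have E: "E = insert 0 (set bs')" unfolding setbs [symmetric] bs b by simp
    then have iff: "E \<subseteq> set I \<union> {0} \<longleftrightarrow> set bs' \<subseteq> set I" using pos(1) by auto
    have filter: "filter (\<lambda>i. i \<notin> set bs') I = filter (\<lambda>i. i \<notin> E) I"
      by (rule filter_cong[OF refl]) (use I(2) E in \<open>metis insert_iff\<close>)
    have "{p. p < length I \<and> I ! p \<in> set bs'} = {p. p < length I \<and> I ! p \<in> E}"
      unfolding E using I(2) by (metis insert_iff nth_mem)
    then have s: "(\<Sum>p | p < length I \<and> I ! p \<in> set bs'. Suc p) = s'"
      unfolding s'_def sum [symmetric] by simp
    \<comment> \<open>The step for 0 comes before any part is erased, so its sign involves the
      length of \<open>I\<close> itself; with its factor \<open>(- 1) ^ n\<close> there are again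
      \<open>2 * k\<close> of them.\<close>
    have sgn: "(- 1 :: rat) ^ n * (- 1) ^ Suc (length I) * (- 1) ^ (n * (2 * k - 1) + s') = (- 1) ^ (s' + (length I + 1))"
    proof -
      have eq: "n + Suc (length I) + (n * (2 * k - 1) + s') = 2 * (n * k) + (s' + (length I + 1))"
        using assms(2) by (cases k) (auto simp: algebra_simps)
      show ?thesis unfolding power_add [symmetric] eq by (simp add: minus_one_power_iff)
    qed
    have "EV R = (\<lambda>x. (- 1) ^ n * (- 1) ^ Suc (length I) * fold (ann n) bs' (PP n I) x)"
      unfolding R bs b by (simp only: fold_simps ann_PP_0[OF assms(1) In I(2)] fold_ann_scale)
    then show ?thesis
      unfolding fold_ann_PP[OF In I(1) pos(2,1)] iff s filter pos(3) using False sgn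
      by (auto simp: fun_eq_iff mult.assoc [symmetric] simp del: power_Suc)
  qed
  have J: "set (filter (\<lambda>i. i \<notin> E) I) \<subseteq> {..<n}" "0 \<notin> set (filter (\<lambda>i. i \<notin> E) I)" using In I(2) by auto
  have 1: "R = 0" if "\<not> E \<subseteq> set I \<union> {0}"
    by (rule dpoly_eqI) (use key that in simp)
  have 2: "R = (- 1) ^ (if \<alpha> ! (2 * k - 1) < n - 2 * k then s' else s' + (length I + 1)) * Ptilde n (filter (\<lambda>i. i \<notin> E) I)"
    if "E \<subseteq> set I \<union> {0}"
    by (rule dpoly_eqI) (use key that fun_cong[OF EV_Ptilde[OF assms(1) J]] in \<open>simp add: fun_eq_iff\<close>)
  show ?thesis
    unfolding Let_def E_def [symmetric] R_def [symmetric] s'_def [symmetric] using 1 2 by blast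
qed

end
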